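(* Let $1<k\le n$, $\sigma\in S^k_n$, and assume $\mathrm{sign}(a_{\mathbf{e}_{\sigma(j)}}a_{\mathbf{e}_{\sigma(i)}})=1$ for all $1\le i<j\le k$ (case $s=1$). Consider, on the closure $\overline{\mathcal{M}_{k,\sigma}}$ of the open $2k$-cell, the one-parametric Eulerian flow associated with $$\Theta+v=\Theta+\sum_{i=1}^n\Big(\nu_0+\sum_{j=1}^na_{\mathbf{e}_j}(x_j^2+y_j^2)\Big)\Big(x_i\frac{\partial}{\partial x_i}+y_i\frac{\partial}{\partial y_i}\Big).$$ Then there is a cell-bifurcation variety at $T_{Pch}=\{\nu_0:\nu_0=0\}$. Here, a flow-invariant toral CW complex associated with the CW complex $\overline{\mathbb{S}^{k-1,\sigma}_{>0}}=\bigsqcup_{l=0}^{k-1}\bigsqcup_{\gamma\in S^{l+1,\sigma}_n}\mathbb{S}^{l,\gamma}_{>0}$ bifurcates from the origin, for the dynamics on $\overline{\mathcal{M}_{k,\sigma}}$. This toral CW complex and its partition are homeomorphic to the quotient toral CW complex $X_\sigma$ (defined in the context) and the partition $\{\mathbb{T}_{l+1}\times\mathbb{S}^{l,\gamma}_{>0}:\gamma\in S^{l+1,\sigma}_n,\ 0\le l\le k-1\}$. This flow-invariant toral manifold exists when $a_{\mathbf{e}_{\sigma(k)}}\nu_0<0$. It is asymptotically stable when $a_{\mathbf{e}_{\sigma(k)}}<0$ and otherwise it is unstable. A trajectory associated with $\rho_{\sigma(i)}$, $1\le i\le k$, converges to/diverges from the stable/unstable toral CW complex at frequency $\frac{\omega_{\sigma(i)}}{2\pi}$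 and radial velocity $$\frac{c_{\sigma(i)}}{c_{\sigma(k)}}\rho_{\sigma(k)}\Big(\nu_0+\rho_{\sigma(k)}^2\sum_{j=1}^na_{\mathbf{e}_j}\frac{c_j^2}{c_{\sigma(k)}^2}\Big),$$ where $C=(c_1,\dots,c_n)$ is determined by the initial conditions and $\rho_{\sigma(k)}^2=x_{\sigma(k)}^2+y_{\sigma(k)}^2$.
   Context: $S^k_n$ is the set of permutations $\sigma$ of $\{1,\dots,n\}$ with $\sigma(i)<\sigma(j)$ for $i<j\le k$ and for $k<i<j\le n$; for $\sigma\in S^k_n$, $l\le k$, $S^{l,\sigma}_n=\{\gamma\in S^l_n:\{\sigma(i):i>k\}\subseteq\{\gamma(i):i>l\}\}$. For $\gamma\in S^l_n$, $\mathbb{S}^{l-1,\gamma}_{>0}=\{(c_i)\in\mathbb{R}^n:\sum_{i\le l}c_{\gamma(i)}^2=1,\ c_{\gamma(i)}>0\ (i\le l),\ c_{\gamma(i)}=0\ (i>l)\}$. $\mathcal{M}_{k,\sigma}=\{\mathbf{x}=(x_1,y_1,\dots,x_n,y_n):(x_{\sigma(i)},y_{\sigma(i)})\ne0\ (i\le k),\ =0\ (i>k)\}$, and $\rho_i=\|(x_i,y_i)\|$. The leaf $\mathcal{M}^C_{k,\sigma}$, $C\in\mathbb{S}^{k-1,\sigma}_{>0}$, consists of the points of $\mathcal{M}_{k,\sigma}$ with $(\rho_1,\dots,\rho_n)$ a positive multiple of $C$; leaves are invariant, so $C$ is determined by the initial condition. $\Theta=\sum_i\omega_i(-y_i\partial_{x_i}+x_i\partial_{y_i})$,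 all $\omega_i\ne0$, $\omega_i/\omega_j\notin\mathbb{Q}$ for $i<j$; $a_{\mathbf{e}_j}$ are real constants ($\mathbf{e}_j$ the standard basis vector, indexing monomials $\prod_j(x_j^2+y_j^2)^{m_j}$), and $\nu_0$ is a real parameter. The case $s=1$ means that the cubic coefficient of the amplitude equation on the leaves is nonzero. A cell-bifurcation variety is the set of parameters at which the qualitative dynamics on $\overline{\mathcal{M}_{k,\sigma}}$ changes. $X_\sigma$ is the quotient of $(\prod_{j=1}^k\mathbb{S}^1_{\sigma(j)})\times\overline{\mathbb{S}^{k-1,\sigma}_{>0}}$ (each $\mathbb{S}^1_{\sigma(j)}=\mathbb{S}^1$) identifying, for every $x\in\mathbb{S}^{l-1,\gamma}_{>0}$ with $\gamma\in S^{l,\sigma}_n$, $l<k$, any two points over $x$ whose circle components with indices $\gamma(1),\dots,\gamma(l)$ agree; its toral cells are the images of the parts over the cells $\mathbb{S}^{l-1,\gamma}_{>0}$. Toral CW complex: a Hausdorff space $X$ with a finite partition into open toral cells, associated with a regular CW complex $\tilde X$, such that the following hold. (i) Each toral cell $\mathfrak{C}$ corresponds to an open CW cell $e$ of $\tilde X$, of dimension $d$ say, and there is a homeomorphism $g:\mathfrak{C}\to T\times e$, where $T=\mathbb{T}_{d+1}$ (odd-dimensional toral cell) or $T=\mathbb{T}_{d+2}$ (even-dimensional toral cell). (ii) Let $\tilde\Phi:\overline{\mathbb{B}^d}\to\bar e$ be the attaching homeomorphism of $e$. There is an attaching homeomorphism $\Phi:\overline{T\times\mathbb{B}^d}\to\overline{\mathfrak{C}}\subseteq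 X$ with $\Phi(\partial(T\times\mathbb{B}^d))$ contained in the union of the toral cells of lower dimension and $g(\Phi(s,y))=(s,\tilde\Phi(y))$ for $(s,y)\in T\times\mathbb{B}^d$. Here $\overline{T\times\mathbb{B}^d}$ is a space which, as a set, is the disjoint union, over the cells $e'\subseteq\bar e$ of $\tilde X$, of $T_{e'}\times\tilde\Phi^{-1}(e')$, where $T_{e'}$ is the torus fiber of the toral cell over $e'$. It carries a metrizable topology which is the product topology on each piece, in which $T\times\mathbb{B}^d$ is a dense, relatively compact, open subset, in which no sequence in one piece converges to a point of another piece of equal or higher dimension, and in which a sequence $(s^{x_j},x_j)$ in a higher dimensional piece converges to $(s^y,y)$ in a lower dimensional piece when $x_j\to y$ in $\overline{\mathbb{B}^d}$ and those circle components of $s^{x_j}$ that correspond to the circle components of the fiber over $y$ converge to $s^y$, the remaining circle components collapsing to a point. *)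

theory Defs
  imports "HOL-Analysis.Analysis"
begin

section \<open>Solutions of autonomous vector fields\<close>

text \<open>The flows considered here are only local flows (orbits may blow up in finite time), so all
  dynamical notions are phrased through solution curves on open intervals.\<close>

definition solution :: "('a::real_normed_vector \<Rightarrow> 'a) \<Rightarrow> real set \<Rightarrow> (real \<Rightarrow> 'a) \<Rightarrow> bool" where
  "solution V J x \<longleftrightarrow> open J \<and> is_interval J \<and> J \<noteq> {} \<and>
     (\<forall>t\<in>J. (x has_vector_derivative V (x t)) (at t))"

definition maximal_solution :: "('a::real_normed_vector \<Rightarrow> 'a) \<Rightarrow> real set \<Rightarrow> (real \<Rightarrow> 'a) \<Rightarrow> bool" where
  "maximal_solution V J x \<longleftrightarrow> solution V J x \<and>
     (\<forall>J' y. solution V J' y \<and> J \<subseteq> J' \<and> (\<forall>t\<in>J. y t = x t) \<longrightarrow> J' = J)"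

definition flow_invariant :: "('a::real_normed_vector \<Rightarrow> 'a) \<Rightarrow> 'a set \<Rightarrow> bool" where
  "flow_invariant V A \<longleftrightarrow>
     (\<forall>J x. solution V J x \<and> (\<exists>t\<in>J. x t \<in> A) \<longrightarrow> (\<forall>t\<in>J. x t \<in> A))"

text \<open>Stability of a set \<open>K\<close> for the dynamics restricted to an invariant set \<open>M\<close>.\<close>

definition lyapunov_stable :: "('a::real_normed_vector \<Rightarrow> 'a) \<Rightarrow> 'a set \<Rightarrow> 'a set \<Rightarrow> bool" where
  "lyapunov_stable V M K \<longleftrightarrow>
     (\<forall>U. open U \<and> K \<subseteq> U \<longrightarrow>
        (\<exists>W. open W \<and> K \<subseteq> W \<and>
           (\<forall>J x. maximal_solution V J x \<and> 0 \<in> J \<and> x 0 \<in> W \<inter> M \<longrightarrow>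
              {0..} \<subseteq> J \<and> (\<forall>t\<ge>0. x t \<in> U))))"

definition converges_to :: "'a::real_normed_vector set \<Rightarrow> real set \<Rightarrow> (real \<Rightarrow> 'a) \<Rightarrow> bool" where
  "converges_to K J x \<longleftrightarrow> {0..} \<subseteq> J \<and> ((\<lambda>t. infdist (x t) K) \<longlongrightarrow> 0) at_top"

definition asymptotically_stable :: "('a::real_normed_vector \<Rightarrow> 'a) \<Rightarrow> 'a set \<Rightarrow> 'a set \<Rightarrow> bool" where
  "asymptotically_stable V M K \<longleftrightarrow> lyapunov_stable V M K \<and>
     (\<exists>W. open W \<and> K \<subseteq> W \<and>
        (\<forall>J x. maximal_solution V J x \<and> 0 \<in> J \<and> x 0 \<in> W \<inter> M \<longrightarrow> converges_to K J x))"

text \<open>Divergence from \<open>K\<close>: the curve emanates from \<open>K\<close> (it approaches \<open>K\<close> in backward time) and,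
  unless it lies on \<open>K\<close>, eventually stays away from \<open>K\<close> in forward time. The forward existence
  interval may be bounded.\<close>

definition diverges_from :: "'a::real_normed_vector set \<Rightarrow> real set \<Rightarrow> (real \<Rightarrow> 'a) \<Rightarrow> bool" where
  "diverges_from K J x \<longleftrightarrow> {..0} \<subseteq> J \<and> ((\<lambda>t. infdist (x t) K) \<longlongrightarrow> 0) at_bot \<and>
     (x 0 \<notin> K \<longrightarrow> (\<exists>\<epsilon>>0. \<exists>t0\<in>J. \<forall>t\<in>J. t0 \<le> t \<longrightarrow> \<epsilon> \<le> infdist (x t) K))"

text \<open>Topological equivalence on \<open>M\<close>: a homeomorphism of \<open>M\<close> maps orbits onto orbits, preserving
  the direction of time. Requiring this for the maximal solutions of \<open>V\<close> suffices: for fields with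
  unique solutions the inverse of \<open>h\<close> then maps the orbits of \<open>W\<close> in \<open>M\<close> onto those of \<open>V\<close>.\<close>

definition topologically_equivalent ::
  "'a::real_normed_vector set \<Rightarrow> ('a \<Rightarrow> 'a) \<Rightarrow> ('a \<Rightarrow> 'a) \<Rightarrow> bool" where
  "topologically_equivalent M V W \<longleftrightarrow>
     (\<exists>h h'. homeomorphism M M h h' \<and>
        (\<forall>J x. maximal_solution V J x \<and> x ` J \<subseteq> M \<longrightarrow>
           (\<exists>J' y \<tau>. maximal_solution W J' y \<and> strict_mono_on J \<tau> \<and> \<tau> ` J = J' \<and>
              (\<forall>t\<in>J. y (\<tau> t) = h (x t)))))"

text \<open>The parameters at which the qualitative dynamics on \<open>M\<close> changes: those without a neighbourhood
  of parameters giving topologically equivalent dynamics.\<close>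

definition cell_bifurcation_variety ::
  "'a::real_normed_vector set \<Rightarrow> (real \<Rightarrow> 'a \<Rightarrow> 'a) \<Rightarrow> real set" where
  "cell_bifurcation_variety M F =
     {\<nu>. \<not> (\<forall>\<^sub>F \<nu>' in nhds \<nu>. topologically_equivalent M (F \<nu>) (F \<nu>'))}"


section \<open>Cells, leaves and the Eulerian field\<close>

text \<open>The index set \<open>{1..n}\<close> of the oscillators is an arbitrary finite linear order \<open>'n\<close> with
  \<open>CARD('n) = n\<close>; positions \<open>1, ..., n\<close> are natural numbers, so a permutation is a bijection from
  \<open>{1..n}\<close> onto \<open>'n\<close>. It is taken extensional so that it is determined by its values on \<open>{1..n}\<close>.
  The phase space \<open>\<real>\<^bsup>2n\<^esup>\<close> is \<open>(real \<times> real) ^ 'n\<close>, with \<open>p $ i = (x\<^sub>i, y\<^sub>i)\<close> and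
  \<open>\<rho>\<^sub>i = norm (p $ i)\<close>.\<close>

type_synonym 'n amplitude = "(real, 'n) vec"
type_synonym 'n phase = "(real \<times> real, 'n) vec"

definition perms_S :: "nat \<Rightarrow> (nat \<Rightarrow> 'n::{finite,linorder}) set" where
  "perms_S k = {\<sigma> \<in> extensional {1..CARD('n)}. bij_betw \<sigma> {1..CARD('n)} UNIV \<and>
     strict_mono_on {1..k} \<sigma> \<and> strict_mono_on {k<..CARD('n)} \<sigma>}"

text \<open>\<open>S\<^sup>l\<^sup>,\<^sup>\<sigma>\<close> for \<open>\<sigma> \<in> perms_S k\<close>, \<open>l \<le> k\<close>.\<close>

definition sub_perms_S :: "nat \<Rightarrow> (nat \<Rightarrow> 'n::{finite,linorder}) \<Rightarrow> nat \<Rightarrow> (nat \<Rightarrow> 'n) set" where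
  "sub_perms_S k \<sigma> l = {\<gamma> \<in> perms_S l. \<sigma> ` {k<..CARD('n)} \<subseteq> \<gamma> ` {l<..CARD('n)}}"

text \<open>\<open>pos_sphere l \<gamma>\<close> has dimension \<open>l - 1\<close>.\<close>

definition pos_sphere :: "nat \<Rightarrow> (nat \<Rightarrow> 'n::{finite,linorder}) \<Rightarrow> 'n amplitude set" where
  "pos_sphere l \<gamma> = {c. (\<Sum>i=1..l. (c $ \<gamma> i)\<^sup>2) = 1 \<and> (\<forall>i\<in>{1..l}. c $ \<gamma> i > 0) \<and>
     (\<forall>i\<in>{l<..CARD('n)}. c $ \<gamma> i = 0)}"

definition cell_M :: "nat \<Rightarrow> (nat \<Rightarrow> 'n::{finite,linorder}) \<Rightarrow> 'n phase set" where
  "cell_M k \<sigma> = {p. (\<forall>i\<in>{1..k}. p $ \<sigma> i \<noteq> 0) \<and> (\<forall>i\<in>{k<..CARD('n)}. p $ \<sigma> i = 0)}"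

definition leaf_M ::
  "nat \<Rightarrow> (nat \<Rightarrow> 'n::{finite,linorder}) \<Rightarrow> 'n amplitude \<Rightarrow> 'n phase set" where
  "leaf_M k \<sigma> C = {p \<in> cell_M k \<sigma>. \<exists>r>0. \<forall>i. norm (p $ i) = r * C $ i}"

definition euler_field ::
  "('n::finite \<Rightarrow> real) \<Rightarrow> ('n \<Rightarrow> real) \<Rightarrow> real \<Rightarrow> 'n phase \<Rightarrow> 'n phase" where
  "euler_field \<omega> a \<nu> p = (\<chi> i.
     (- \<omega> i * snd (p $ i), \<omega> i * fst (p $ i)) +
     (\<nu> + (\<Sum>j\<in>UNIV. a j * ((fst (p $ j))\<^sup>2 + (snd (p $ j))\<^sup>2))) *\<^sub>R (p $ i))"


section \<open>Regular CW complexes and toral CW complexes\<close>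

definition closed_unit_ball :: "nat \<Rightarrow> (nat \<Rightarrow> real) topology" where
  "closed_unit_ball d = subtopology (Euclidean_space d) {x. (\<Sum>i<d. (x i)\<^sup>2) \<le> 1}"

definition open_ball_set :: "nat \<Rightarrow> (nat \<Rightarrow> real) set" where
  "open_ball_set d = {x \<in> topspace (Euclidean_space d). (\<Sum>i<d. (x i)\<^sup>2) < 1}"

text \<open>The torus whose circle components are labelled by \<open>A\<close>.\<close>

definition torus :: "'i set \<Rightarrow> ('i \<Rightarrow> real \<times> real) topology" where
  "torus A = product_topology (\<lambda>_. top_of_set (sphere 0 1)) A"

text \<open>Finite regular CW complexes, with cells \<open>e c\<close> indexed by \<open>c \<in> P\<close>, dimensions \<open>d c\<close> and attaching
  homeomorphisms \<open>\<phi> c\<close> of closed balls onto closed cells. Since \<open>P\<close> is finite, closure finiteness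
  and the weak topology condition hold automatically.\<close>

locale regular_CW_complex =
  fixes B :: "'b topology" and P :: "'c set" and e :: "'c \<Rightarrow> 'b set"
    and d :: "'c \<Rightarrow> nat" and \<phi> :: "'c \<Rightarrow> (nat \<Rightarrow> real) \<Rightarrow> 'b"
  assumes CW_Hausdorff: "Hausdorff_space B"
    and CW_finite: "finite P"
    and CW_disjoint: "disjoint_family_on e P"
    and CW_cover: "(\<Union>c\<in>P. e c) = topspace B"
    and CW_attach: "c \<in> P \<Longrightarrow>
      homeomorphic_map (closed_unit_ball (d c)) (subtopology B (B closure_of e c)) (\<phi> c)"
    and CW_interior: "c \<in> P \<Longrightarrow> \<phi> c ` open_ball_set (d c) = e c"
    and CW_boundary: "c \<in> P \<Longrightarrow>
      \<phi> c ` (topspace (closed_unit_ball (d c)) - open_ball_set (d c))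
        \<subseteq> (\<Union>c'\<in>{c' \<in> P. d c' < d c}. e c')"

text \<open>\<open>I c\<close> is the set of labels of the circle components of the torus fiber over \<open>e c\<close>. The
  correspondence between the circle components of two fibers is equality of labels.\<close>

definition toral_dim :: "('c \<Rightarrow> nat) \<Rightarrow> ('c \<Rightarrow> 'i set) \<Rightarrow> 'c \<Rightarrow> nat" where
  "toral_dim d I c = card (I c) + d c"

text \<open>For \<open>e c' \<subseteq> closure (e c)\<close>, the piece over \<open>e c'\<close> of the closure of \<open>T \<times> \<bbbB>\<^sup>d\<close>, where
  \<open>T \<times> \<bbbB>\<^sup>d\<close> belongs to \<open>c\<close>. Distinct pieces are disjoint, having disjoint second components.\<close>

definition toral_piece ::
  "('c \<Rightarrow> 'b set) \<Rightarrow> ('c \<Rightarrow> nat) \<Rightarrow> ('c \<Rightarrow> (nat \<Rightarrow> real) \<Rightarrow> 'b) \<Rightarrow> ('c \<Rightarrow> 'i set) \<Rightarrow> 'c \<Rightarrow> 'c \<Rightarrow>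
    (('i \<Rightarrow> real \<times> real) \<times> (nat \<Rightarrow> real)) set" where
  "toral_piece e d \<phi> I c c' =
     topspace (torus (I c')) \<times> {y \<in> topspace (closed_unit_ball (d c)). \<phi> c y \<in> e c'}"

text \<open>\<open>toral_closure B P e d \<phi> I c Y\<close>: the space \<open>Y\<close> is the closure of \<open>T \<times> \<bbbB>\<^sup>d\<close> for the cell \<open>c\<close>.
  Here \<open>toral_piece e d \<phi> I c c\<close> is \<open>T \<times> \<bbbB>\<^sup>d\<close> itself, and dimensions of pieces are those of the
  toral cells.\<close>

definition toral_closure ::
  "'b topology \<Rightarrow> 'c set \<Rightarrow> ('c \<Rightarrow> 'b set) \<Rightarrow> ('c \<Rightarrow> nat) \<Rightarrow> ('c \<Rightarrow> (nat \<Rightarrow> real) \<Rightarrow> 'b) \<Rightarrow>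
    ('c \<Rightarrow> 'i set) \<Rightarrow> 'c \<Rightarrow> (('i \<Rightarrow> real \<times> real) \<times> (nat \<Rightarrow> real)) topology \<Rightarrow> bool" where
  "toral_closure B P e d \<phi> I c Y \<longleftrightarrow>
     (let F = {c' \<in> P. e c' \<subseteq> B closure_of e c}; Q = toral_piece e d \<phi> I c in
        topspace Y = (\<Union>c'\<in>F. Q c') \<and>
        metrizable_space Y \<and>
        (\<forall>c'\<in>F. subtopology Y (Q c') =
           prod_topology (torus (I c'))
             (subtopology (closed_unit_ball (d c)) {y. \<phi> c y \<in> e c'})) \<and>
        openin Y (Q c) \<and>
        Y closure_of (Q c) = topspace Y \<and>
        compactin Y (Y closure_of (Q c)) \<and>
        (\<forall>c1\<in>F. \<forall>c2\<in>F. c1 \<noteq> c2 \<and> toral_dim d I c1 \<le> toral_dim d I c2 \<longrightarrow>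
           (\<forall>u q. range u \<subseteq> Q c1 \<and> q \<in> Q c2 \<longrightarrow> \<not> limitin Y u q sequentially)) \<and>
        (\<forall>c1\<in>F. \<forall>c2\<in>F. toral_dim d I c2 < toral_dim d I c1 \<and> e c2 \<subseteq> B closure_of e c1 \<longrightarrow>
           (\<forall>s x t y. range (\<lambda>j::nat. (s j, x j)) \<subseteq> Q c1 \<and> (t, y) \<in> Q c2 \<and>
              limitin (closed_unit_ball (d c)) x y sequentially \<and>
              (\<forall>i\<in>I c2. (\<lambda>j. s j i) \<longlonglongrightarrow> t i) \<longrightarrow>
              limitin Y (\<lambda>j. (s j, x j)) (t, y) sequentially)))"

text \<open>\<open>X\<close> is a toral CW complex with toral cells \<open>T c\<close>, associated with the regular CW complex \<open>B\<close>.\<close>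

locale toral_CW_complex = regular_CW_complex B P e d \<phi>
  for B :: "'b topology" and P :: "'c set" and e :: "'c \<Rightarrow> 'b set"
    and d :: "'c \<Rightarrow> nat" and \<phi> :: "'c \<Rightarrow> (nat \<Rightarrow> real) \<Rightarrow> 'b" +
  fixes I :: "'c \<Rightarrow> 'i set" and X :: "'a topology" and T :: "'c \<Rightarrow> 'a set"
  assumes toral_Hausdorff: "Hausdorff_space X"
    and toral_disjoint: "disjoint_family_on T P"
    and toral_cover: "(\<Union>c\<in>P. T c) = topspace X"
    and toral_card: "c \<in> P \<Longrightarrow> card (I c) = d c + 1 \<or> card (I c) = d c + 2"
    and toral_labels: "c \<in> P \<Longrightarrow> c' \<in> P \<Longrightarrow> e c' \<subseteq> B closure_of e c \<Longrightarrow> I c' \<subseteq> I c"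
    and toral_attach: "c \<in> P \<Longrightarrow>
      \<exists>g Y \<Phi>.
        homeomorphic_map (subtopology X (T c)) (prod_topology (torus (I c)) (subtopology B (e c))) g \<and>
        toral_closure B P e d \<phi> I c Y \<and>
        homeomorphic_map Y (subtopology X (X closure_of T c)) \<Phi> \<and>
        \<Phi> ` (topspace Y - toral_piece e d \<phi> I c c)
          \<subseteq> (\<Union>c'\<in>{c' \<in> P. toral_dim d I c' < toral_dim d I c}. T c') \<and>
        (\<forall>s\<in>topspace (torus (I c)). \<forall>y\<in>open_ball_set (d c).
           \<Phi> (s, y) \<in> T c \<and> g (\<Phi> (s, y)) = (s, \<phi> c y))"


section \<open>The quotient space \<open>X\<^sub>\<sigma>\<close>\<close>

definition quotient_topology :: "'a topology \<Rightarrow> ('a \<Rightarrow> 'b) \<Rightarrow> 'b topology" where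
  "quotient_topology X f =
     topology (\<lambda>U. U \<subseteq> f ` topspace X \<and> openin X {x \<in> topspace X. f x \<in> U})"

lemma openin_quotient_topology:
  "openin (quotient_topology X f) U \<longleftrightarrow>
     U \<subseteq> f ` topspace X \<and> openin X {x \<in> topspace X. f x \<in> U}"
proof -
  have "istopology (\<lambda>U. U \<subseteq> f ` topspace X \<and> openin X {x \<in> topspace X. f x \<in> U})"
    unfolding istopology_def
  proof (intro conjI allI impI)
    fix S T
    assume "S \<subseteq> f ` topspace X \<and> openin X {x \<in> topspace X. f x \<in> S}"
      and "T \<subseteq> f ` topspace X \<and> openin X {x \<in> topspace X. f x \<in> T}"
    moreover have "{x \<in> topspace X. f x \<in> S \<inter> T} =
        {x \<in> topspace X. f x \<in> S} \<inter> {x \<in> topspace X. f x \<in> T}" by auto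
    ultimately show "S \<inter> T \<subseteq> f ` topspace X" "openin X {x \<in> topspace X. f x \<in> S \<inter> T}"
      by auto
  next
    fix \<K>
    assume *: "\<forall>K\<in>\<K>. K \<subseteq> f ` topspace X \<and> openin X {x \<in> topspace X. f x \<in> K}"
    then show "\<Union>\<K> \<subseteq> f ` topspace X" by auto
    have "{x \<in> topspace X. f x \<in> \<Union>\<K>} = (\<Union>K\<in>\<K>. {x \<in> topspace X. f x \<in> K})" by auto
    with * show "openin X {x \<in> topspace X. f x \<in> \<Union>\<K>}" by (metis (no_types, lifting) imageE openin_Union)
  qed
  then show ?thesis
    by (simp add: quotient_topology_def)
qed

lemma topspace_quotient_topology: "topspace (quotient_topology X f) = f ` topspace X"
proof
  show "topspace (quotient_topology X f) \<subseteq> f ` topspace X"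
    by (meson openin_quotient_topology openin_topspace)
  have "{x \<in> topspace X. f x \<in> f ` topspace X} = topspace X" by auto
  then have "openin (quotient_topology X f) (f ` topspace X)"
    by (simp add: openin_quotient_topology)
  then show "f ` topspace X \<subseteq> topspace (quotient_topology X f)"
    by (rule openin_subset)
qed

lemma quotient_map_quotient_topology: "quotient_map X (quotient_topology X f) f"
  by (auto simp: quotient_map_def topspace_quotient_topology openin_quotient_topology)

definition X_base ::
  "nat \<Rightarrow> (nat \<Rightarrow> 'n::{finite,linorder}) \<Rightarrow> (('n \<Rightarrow> real \<times> real) \<times> 'n amplitude) topology" where
  "X_base k \<sigma> =
     prod_topology (torus (\<sigma> ` {1..k})) (top_of_set (closure (pos_sphere k \<sigma>)))"

definition X_rel ::
  "nat \<Rightarrow> (nat \<Rightarrow> 'n::{finite,linorder}) \<Rightarrow> (('n \<Rightarrow> real \<times> real) \<times> 'n amplitude) rel" where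
  "X_rel k \<sigma> = {((s, x), (s', x')).
     (s, x) \<in> topspace (X_base k \<sigma>) \<and> (s', x') \<in> topspace (X_base k \<sigma>) \<and> x = x' \<and>
     (s = s' \<or> (\<exists>l\<in>{1..<k}. \<exists>\<gamma>\<in>sub_perms_S k \<sigma> l.
        x \<in> pos_sphere l \<gamma> \<and> (\<forall>i\<in>{1..l}. s (\<gamma> i) = s' (\<gamma> i))))}"

definition X_class ::
  "nat \<Rightarrow> (nat \<Rightarrow> 'n::{finite,linorder}) \<Rightarrow> ('n \<Rightarrow> real \<times> real) \<times> 'n amplitude \<Rightarrow>
    (('n \<Rightarrow> real \<times> real) \<times> 'n amplitude) set" where
  "X_class k \<sigma> p = X_rel k \<sigma> `` {p}"

definition X_space ::
  "nat \<Rightarrow> (nat \<Rightarrow> 'n::{finite,linorder}) \<Rightarrow> (('n \<Rightarrow> real \<times> real) \<times> 'n amplitude) set topology" where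
  "X_space k \<sigma> = quotient_topology (X_base k \<sigma>) (X_class k \<sigma>)"

text \<open>Cells are indexed by pairs \<open>(l, \<gamma>)\<close> with \<open>0 \<le> l \<le> k - 1\<close> and \<open>\<gamma> \<in> S\<^sup>l\<^sup>+\<^sup>1\<^sup>,\<^sup>\<sigma>\<close>; the cell of
  \<open>(l, \<gamma>)\<close> has dimension \<open>l\<close>, and the circles of its torus fiber are labelled by
  \<open>\<gamma>(1), ..., \<gamma>(l + 1)\<close>.\<close>

definition cell_index :: "nat \<Rightarrow> (nat \<Rightarrow> 'n::{finite,linorder}) \<Rightarrow> (nat \<times> (nat \<Rightarrow> 'n)) set" where
  "cell_index k \<sigma> = (SIGMA l:{0..k - 1}. sub_perms_S k \<sigma> (l + 1))"

definition sphere_cell :: "nat \<times> (nat \<Rightarrow> 'n::{finite,linorder}) \<Rightarrow> 'n amplitude set" where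
  "sphere_cell c = pos_sphere (fst c + 1) (snd c)"

definition circle_labels :: "nat \<times> (nat \<Rightarrow> 'n) \<Rightarrow> 'n set" where
  "circle_labels c = snd c ` {1..fst c + 1}"

definition X_cell ::
  "nat \<Rightarrow> (nat \<Rightarrow> 'n::{finite,linorder}) \<Rightarrow> nat \<times> (nat \<Rightarrow> 'n) \<Rightarrow>
    (('n \<Rightarrow> real \<times> real) \<times> 'n amplitude) set set" where
  "X_cell k \<sigma> c = X_class k \<sigma> ` {p \<in> topspace (X_base k \<sigma>). snd p \<in> sphere_cell c}"

end

theory Submission
  imports Defs
begin

text \<open>On the closed cell only the oscillators \<open>i \<in> \<sigma> ` {1..k}\<close> move, and every oscillator is rotated with its own
  frequency and stretched at the common rate \<open>\<nu> + quad a p\<close>. A trajectory is therefore its initial point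
  with each coordinate rotated uniformly and all coordinates multiplied by one positive factor. The inverse
  square of that factor solves a linear scalar equation, so the local flow is explicit
  (\<open>maximal_solution_flow_line\<close>, \<open>maximal_solution_eq_flow_line\<close>), and all claims about the dynamics become
  claims about the scalar function \<open>inv_sq\<close>. Frequencies and radial velocities are read off directly.

  The sign condition makes \<open>quad a\<close> definite on the closed cell. The bifurcating object is its level set
  \<open>\<nu> + quad a p = 0\<close>, which consists of the points where the common rate vanishes. When the sign of \<open>\<nu>\<close> is
  opposite to that of the coefficients, every ray of nonnegative amplitude vectors meets the level set in
  exactly one point, so angles and amplitude direction parametrise it (\<open>level_pt\<close>): it is the quotient of
  torus times spherical simplex in which a circle collapses as soon as its amplitude vanishes. The toral
  cells are the sets of points with a prescribed set of nonzero coordinates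
  (\<open>homeomorphic_maps_level_cell\<close>). The closure of torus times ball for a toral cell
  is obtained by pulling the topology of the level set back along the attaching map
  (\<open>toral_CW_complex_level\<close>), and \<open>X_space\<close> is identified with the level set because the parametrisation is a
  continuous map of a compact space onto a Hausdorff space with the same fibres as \<open>X_class\<close>
  (\<open>homeomorphic_map_level_set_X_space\<close>). The underlying regular CW complex is a spherical simplex with its
  faces; the closed ball is mapped onto it by the explicit radial map \<open>face_map\<close>.

  Along a trajectory the deviation \<open>\<nu> + quad a p\<close> from the level set has an explicit form, which is
  monotone in absolute value; this gives asymptotic stability for negative coefficients, and instability and
  divergence for positive ones.

  For parameters \<open>\<nu>\<close>, \<open>\<nu>'\<close> of the same sign the quantity \<open>- \<nu> / quad a p - 1\<close> decays exactly like
  \<open>exp (- 2 * \<nu> * t)\<close>. Raising it to the power \<open>\<nu>' / \<nu>\<close>, with its sign kept, turns one scalar dynamics into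
  the other without changing time, so rescaling each point accordingly respects the rotations too and is a
  topological equivalence (\<open>topologically_equivalent_same_sign\<close>). At \<open>\<nu> = 0\<close> every trajectory except the
  origin is unbounded, while arbitrarily small \<open>\<nu>'\<close> have the compact invariant level set with more than one
  point; no homeomorphism can match these (\<open>not_topologically_equivalent_zero\<close>). The same unboundedness shows
  that no invariant copy of \<open>X_space\<close> exists when \<open>\<nu>\<close> is zero or has the sign of the coefficients.\<close>

section \<open>The explicit flow of the Eulerian field\<close>

definition rot :: "real \<Rightarrow> real \<times> real \<Rightarrow> real \<times> real" where
  "rot \<theta> v = (cos \<theta> * fst v - sin \<theta> * snd v, sin \<theta> * fst v + cos \<theta> * snd v)"

lemma norm_rot [simp]: "norm (rot \<theta> v) = norm v"
proof -
  have "(cos \<theta> * fst v - sin \<theta> * snd v)\<^sup>2 + (sin \<theta> * fst v + cos \<theta> * snd v)\<^sup>2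
      = ((cos \<theta>)\<^sup>2 + (sin \<theta>)\<^sup>2) * ((fst v)\<^sup>2 + (snd v)\<^sup>2)"
    by (simp add: power2_eq_square algebra_simps del: sin_cos_squared_add sin_cos_squared_add2 sin_cos_squared_add3)
  then show ?thesis
    by (simp add: rot_def norm_prod_def)
qed

lemma rot_zero [simp]: "rot 0 v = v"
  by (simp add: rot_def)

lemma rot_zero_right [simp]: "rot \<theta> 0 = 0"
  by (simp add: rot_def zero_prod_def)

lemma rot_scaleR: "rot \<theta> (r *\<^sub>R v) = r *\<^sub>R rot \<theta> v"
  by (simp add: rot_def algebra_simps)

lemma rot_rot: "rot \<alpha> (rot \<beta> v) = rot (\<alpha> + \<beta>) v"
  by (simp add: rot_def cos_add sin_add algebra_simps)

definition quad :: "('n::finite \<Rightarrow> real) \<Rightarrow> 'n phase \<Rightarrow> real" where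
  "quad a p = (\<Sum>j\<in>UNIV. a j * (norm (p $ j))\<^sup>2)"

lemma norm_prod_squared: "(norm (v :: real \<times> real))\<^sup>2 = (fst v)\<^sup>2 + (snd v)\<^sup>2"
  by (simp add: norm_prod_def)

lemma quad_scaleR: "quad a (r *\<^sub>R p) = r\<^sup>2 * quad a p"
  by (simp add: quad_def power_mult_distrib sum_distrib_left algebra_simps)

lemma euler_field_nth:
  "euler_field \<omega> a \<nu> p $ i =
     (- \<omega> i * snd (p $ i) + (\<nu> + quad a p) * fst (p $ i),
        \<omega> i * fst (p $ i) + (\<nu> + quad a p) * snd (p $ i))"
  by (cases "p $ i") (simp add: euler_field_def quad_def norm_prod_squared)

text \<open>A vector of vectors is the sum of the images of its entries under the bounded linear maps \<open>axis i\<close>, so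
  derivatives may be computed entrywise.\<close>

lemma has_vector_derivative_vec_nth:
  fixes f :: "real \<Rightarrow> ('a::euclidean_space, 'n::finite) vec"
  shows "(f has_vector_derivative D) (at t within S) \<longleftrightarrow>
    (\<forall>i. ((\<lambda>t. f t $ i) has_vector_derivative D $ i) (at t within S))" (is "?L \<longleftrightarrow> ?R")
proof
  assume ?L
  then show ?R
    by (auto intro: bounded_linear.has_vector_derivative [OF bounded_linear_vec_nth])
next
  assume R: ?R
  have axis: "bounded_linear (axis i :: 'a \<Rightarrow> ('a, 'n) vec)" for i
    by (intro linear_linear [THEN iffD2] linearI) (auto simp: vec_eq_iff axis_def)
  have sum_axis: "v = (\<Sum>i\<in>UNIV. axis i (v $ i))" for v :: "('a, 'n) vec"
    by (simp add: vec_eq_iff axis_def)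
  have "((\<lambda>t. \<Sum>i\<in>UNIV. axis i (f t $ i)) has_vector_derivative (\<Sum>i\<in>UNIV. axis i (D $ i))) (at t within S)"
    using R by (intro has_vector_derivative_sum bounded_linear.has_vector_derivative [OF axis]) auto
  then show ?L
    by (simp flip: sum_axis)
qed

lemma has_vector_derivative_fst_snd:
  fixes f :: "real \<Rightarrow> real \<times> real"
  shows "(f has_vector_derivative D) (at t within S) \<longleftrightarrow>
    ((\<lambda>t. fst (f t)) has_real_derivative fst D) (at t within S) \<and>
    ((\<lambda>t. snd (f t)) has_real_derivative snd D) (at t within S)"
  using bounded_linear.has_vector_derivative [OF bounded_linear_fst, of f D]
    bounded_linear.has_vector_derivative [OF bounded_linear_snd, of f D]
    has_vector_derivative_Pair [of "\<lambda>t. fst (f t)" "fst D" t S "\<lambda>t. snd (f t)" "snd D"]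
  by (auto simp: has_real_derivative_iff_has_vector_derivative)

lemma solution_euler_field_iff:
  "solution (euler_field \<omega> a \<nu>) J x \<longleftrightarrow> open J \<and> is_interval J \<and> J \<noteq> {} \<and>
     (\<forall>t\<in>J. \<forall>i.
        ((\<lambda>t. fst (x t $ i)) has_real_derivative
           - \<omega> i * snd (x t $ i) + (\<nu> + quad a (x t)) * fst (x t $ i)) (at t) \<and>
        ((\<lambda>t. snd (x t $ i)) has_real_derivative
           \<omega> i * fst (x t $ i) + (\<nu> + quad a (x t)) * snd (x t $ i)) (at t))"
  unfolding solution_def has_vector_derivative_vec_nth has_vector_derivative_fst_snd
    euler_field_nth by simp

lemma exists_primitive_open_interval:
  fixes f :: "real \<Rightarrow> real"
  assumes "open J" "is_interval J" "continuous_on J f"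
  obtains F where "\<And>t. t \<in> J \<Longrightarrow> (F has_real_derivative f t) (at t)"
proof (cases "J = {}")
  case False
  then obtain c where c: "c \<in> J" by blast
  have "((\<lambda>u. LBINT y=c..u. f y) has_real_derivative f t) (at t)" if "t \<in> J" for t
  proof -
    have "min c t \<in> J" "max c t \<in> J"
      using c that by (auto simp: min_def max_def)
    then obtain e e' where e: "e > 0" "cball (min c t) e \<subseteq> J"
      and e': "e' > 0" "cball (max c t) e' \<subseteq> J"
      using assms(1) by (meson open_contains_cball)
    define l u where "l = min c t - e" and "u = max c t + e'"
    have lu: "l \<in> J" "u \<in> J" "l < c" "l < t" "c < u" "t < u"
      using e e' by (auto simp: l_def u_def subset_iff dist_real_def)
    then have "{l..u} \<subseteq> J"
      using assms(2) by (meson atLeastAtMost_iff mem_is_interval_1_I subsetI)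
    then have "((\<lambda>u. LBINT y=c..u. f y) has_vector_derivative f t) (at t within {l..u})"
      using lu assms(3) by (intro interval_integral_FTC2) (auto intro: continuous_on_subset)
    moreover have "at t within {l..u} = at t"
      using lu by (intro at_within_interior) auto
    ultimately show ?thesis
      by (simp add: has_real_derivative_iff_has_vector_derivative)
  qed
  then show ?thesis using that by blast
qed (use that in auto)

lemma constant_on_interval:
  fixes f :: "real \<Rightarrow> real"
  assumes "is_interval J" "\<And>t. t \<in> J \<Longrightarrow> (f has_real_derivative 0) (at t)"
    and "s \<in> J" "t \<in> J"
  shows "f s = f t"
proof -
  have "\<exists>c. \<forall>x\<in>J. f x = c"
    using assms(1,2)
    by (intro has_field_derivative_zero_constant)
       (auto simp: is_interval_convex intro: has_field_derivative_at_within)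
  then show ?thesis using assms(3,4) by auto
qed

text \<open>The radial rate is the same for all oscillators. With \<open>F\<close> a primitive of the rate along the curve,
  multiplying a coordinate by the inverse rotation and by \<open>exp (- F)\<close> gives a curve with derivative zero.\<close>

lemma solution_common_factor:
  assumes sol: "solution (euler_field \<omega> a \<nu>) J x" and t0: "t0 \<in> J"
  obtains \<mu> where "\<mu> t0 = 1"
    and "\<And>t. t \<in> J \<Longrightarrow> \<mu> t > 0"
    and "\<And>t. t \<in> J \<Longrightarrow> (\<mu> has_real_derivative \<mu> t * (\<nu> + quad a (x t))) (at t)"
    and "\<And>t i. t \<in> J \<Longrightarrow> x t $ i = \<mu> t *\<^sub>R rot (\<omega> i * (t - t0)) (x t0 $ i)"
proof -
  note S = sol [unfolded solution_euler_field_iff]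
  have J: "open J" "is_interval J" using S by auto
  have d1: "((\<lambda>t. fst (x t $ i)) has_real_derivative
      - \<omega> i * snd (x t $ i) + (\<nu> + quad a (x t)) * fst (x t $ i)) (at t)"
    and d2: "((\<lambda>t. snd (x t $ i)) has_real_derivative
      \<omega> i * fst (x t $ i) + (\<nu> + quad a (x t)) * snd (x t $ i)) (at t)" if "t \<in> J" for t i
    using S that by auto
  have "continuous_on J x"
    using sol unfolding solution_def
    by (meson continuous_at_imp_continuous_on has_vector_derivative_continuous)
  then have "continuous_on J (\<lambda>t. \<nu> + quad a (x t))"
    unfolding quad_def by (intro continuous_intros)
  then obtain F where F: "\<And>t. t \<in> J \<Longrightarrow> (F has_real_derivative \<nu> + quad a (x t)) (at t)"
    using exists_primitive_open_interval J by blast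
  define \<mu> where "\<mu> t = exp (F t - F t0)" for t
  have \<mu>: "(\<mu> has_real_derivative \<mu> t * (\<nu> + quad a (x t))) (at t)" if "t \<in> J" for t
    unfolding \<mu>_def using that by (auto intro!: derivative_eq_intros F)
  have rep: "x t $ i = \<mu> t *\<^sub>R rot (\<omega> i * (t - t0)) (x t0 $ i)" if t: "t \<in> J" for t i
  proof -
    define u where "u t = exp (F t0 - F t) * (cos (\<omega> i * (t - t0)) * fst (x t $ i) + sin (\<omega> i * (t - t0)) * snd (x t $ i))" for t
    define v where "v t = exp (F t0 - F t) * (cos (\<omega> i * (t - t0)) * snd (x t $ i) - sin (\<omega> i * (t - t0)) * fst (x t $ i))" for t
    have "(u has_real_derivative 0) (at s)" if "s \<in> J" for s
      unfolding u_def
      by (rule derivative_eq_intros refl d1 [OF that] d2 [OF that] F [OF that] | simp)+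
         (simp add: algebra_simps)
    then have u: "u t = u t0" using J t t0 by (intro constant_on_interval [of J])
    have "(v has_real_derivative 0) (at s)" if "s \<in> J" for s
      unfolding v_def
      by (rule derivative_eq_intros refl d1 [OF that] d2 [OF that] F [OF that] | simp)+
         (simp add: algebra_simps)
    then have v: "v t = v t0" using J t t0 by (intro constant_on_interval [of J])
    have "(u t, v t) = exp (F t0 - F t) *\<^sub>R rot (- \<theta>) (x t $ i)"
      if "\<theta> = \<omega> i * (t - t0)" for \<theta>
      unfolding u_def v_def that [symmetric] by (simp add: rot_def right_diff_distrib)
    then have "(u t, v t) = exp (F t0 - F t) *\<^sub>R rot (- (\<omega> i * (t - t0))) (x t $ i)"
      by blast
    moreover have "(u t0, v t0) = x t0 $ i"
      by (simp add: u_def v_def)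
    then have "(u t, v t) = x t0 $ i"
      unfolding u v .
    ultimately have "x t0 $ i = exp (F t0 - F t) *\<^sub>R rot (- (\<omega> i * (t - t0))) (x t $ i)"
      by simp
    then have "\<mu> t *\<^sub>R rot (\<omega> i * (t - t0)) (x t0 $ i) =
        (\<mu> t * exp (F t0 - F t)) *\<^sub>R (x t $ i)"
      by (simp only: rot_scaleR rot_rot add.right_inverse rot_zero scaleR_scaleR)
    moreover have "\<mu> t * exp (F t0 - F t) = 1"
      by (simp add: \<mu>_def flip: exp_add)
    ultimately show ?thesis by simp
  qed
  show thesis
    by (rule that [of \<mu>]) (use \<mu> rep in \<open>auto simp: \<mu>_def\<close>)
qed

text \<open>The solution of the linear equation \<open>z' = - 2 * (\<nu> * z + q)\<close> with \<open>z 0 = 1\<close>. If a trajectory starts at \<open>p\<close>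
  with \<open>q = quad a p\<close>, then \<open>z\<close> is the inverse square of its common factor: the factor \<open>\<mu>\<close> satisfies
  \<open>\<mu>' = \<mu> * (\<nu> + \<mu>\<^sup>2 * q)\<close>.\<close>

definition inv_sq :: "real \<Rightarrow> real \<Rightarrow> real \<Rightarrow> real" where
  "inv_sq \<nu> q t = (if \<nu> = 0 then 1 - 2 * q * t else (1 + q / \<nu>) * exp (- 2 * \<nu> * t) - q / \<nu>)"

lemma inv_sq_0 [simp]: "inv_sq \<nu> q 0 = 1"
  by (simp add: inv_sq_def)

lemma inv_sq_derivative:
  "(inv_sq \<nu> q has_real_derivative - 2 * (\<nu> * inv_sq \<nu> q t + q)) (at t)"
proof (cases "\<nu> = 0")
  case True
  then show ?thesis unfolding inv_sq_def by (auto intro!: derivative_eq_intros)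
next
  case False
  then show ?thesis unfolding inv_sq_def
    by (auto intro!: derivative_eq_intros simp: field_simps)
qed

definition flow_line ::
  "('n::finite \<Rightarrow> real) \<Rightarrow> ('n \<Rightarrow> real) \<Rightarrow> real \<Rightarrow> 'n phase \<Rightarrow> real \<Rightarrow> 'n phase" where
  "flow_line \<omega> a \<nu> p t = (\<chi> i. (1 / sqrt (inv_sq \<nu> (quad a p) t)) *\<^sub>R rot (\<omega> i * t) (p $ i))"

definition life_span :: "('n::finite \<Rightarrow> real) \<Rightarrow> real \<Rightarrow> 'n phase \<Rightarrow> real set" where
  "life_span a \<nu> p = {t. inv_sq \<nu> (quad a p) t > 0}"

lemma flow_line_0 [simp]: "flow_line \<omega> a \<nu> p 0 = p"
  by (simp add: flow_line_def vec_eq_iff)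

lemma zero_in_life_span [simp]: "0 \<in> life_span a \<nu> p"
  by (simp add: life_span_def)

lemma norm_flow_line:
  "t \<in> life_span a \<nu> p \<Longrightarrow>
    norm (flow_line \<omega> a \<nu> p t $ i) = norm (p $ i) / sqrt (inv_sq \<nu> (quad a p) t)"
  by (simp add: flow_line_def life_span_def)

lemma quad_flow_line:
  assumes "t \<in> life_span a \<nu> p"
  shows "quad a (flow_line \<omega> a \<nu> p t) = quad a p / inv_sq \<nu> (quad a p) t"
  using assms
  by (simp add: quad_def [of a "flow_line \<omega> a \<nu> p t"] norm_flow_line power_divide life_span_def)
     (simp add: quad_def sum_divide_distrib)

text \<open>Both \<open>inv_sq\<close> and the inverse square of the common factor solve the same linear equation, so their
  difference times \<open>exp (2 * \<nu> * t)\<close> is constant, and it vanishes initially. This is uniqueness of solutions, and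
  it also bounds the domain of any solution by the set where \<open>inv_sq\<close> is positive.\<close>

lemma solution_eq_flow_line:
  assumes sol: "solution (euler_field \<omega> a \<nu>) J x" and t0: "t0 \<in> J" and t: "t \<in> J"
  shows "t - t0 \<in> life_span a \<nu> (x t0)" and "x t = flow_line \<omega> a \<nu> (x t0) (t - t0)"
proof -
  have J: "open J" "is_interval J" using sol by (auto simp: solution_def)
  obtain \<mu> where \<mu>: "\<mu> t0 = 1" "\<And>t. t \<in> J \<Longrightarrow> \<mu> t > 0"
    "\<And>t. t \<in> J \<Longrightarrow> (\<mu> has_real_derivative \<mu> t * (\<nu> + quad a (x t))) (at t)"
    "\<And>t i. t \<in> J \<Longrightarrow> x t $ i = \<mu> t *\<^sub>R rot (\<omega> i * (t - t0)) (x t0 $ i)"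
    using solution_common_factor [OF sol t0] by metis
  define q where "q = quad a (x t0)"
  have q: "quad a (x s) = (\<mu> s)\<^sup>2 * q" if "s \<in> J" for s
    using \<mu>(2) [OF that]
    by (simp add: quad_def q_def \<mu>(4) [OF that] power_mult_distrib sum_distrib_left algebra_simps)
  define f where "f s = exp (2 * \<nu> * (s - t0)) * (1 / (\<mu> s)\<^sup>2 - inv_sq \<nu> q (s - t0))" for s
  have "(f has_real_derivative 0) (at s)" if s: "s \<in> J" for s
  proof -
    have "((\<lambda>s. inv_sq \<nu> q (s - t0)) has_real_derivative - 2 * (\<nu> * inv_sq \<nu> q (s - t0) + q)) (at s)"
      using DERIV_shift [of "inv_sq \<nu> q" _ s "- t0"] inv_sq_derivative [of \<nu> q "s - t0"] by simp
    moreover have "((\<lambda>s. 1 / (\<mu> s)\<^sup>2) has_real_derivative - 2 * (\<nu> * (1 / (\<mu> s)\<^sup>2) + q)) (at s)"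
      using \<mu>(2) [OF s]
      by (auto intro!: derivative_eq_intros \<mu>(3) [OF s] simp: q [OF s] field_simps power2_eq_square)
    ultimately have D: "((\<lambda>s. 1 / (\<mu> s)\<^sup>2 - inv_sq \<nu> q (s - t0)) has_real_derivative
        - 2 * \<nu> * (1 / (\<mu> s)\<^sup>2 - inv_sq \<nu> q (s - t0))) (at s)"
      by (rule DERIV_cong [OF DERIV_diff [rotated]]) (simp add: algebra_simps)
    show ?thesis
      unfolding f_def by (rule DERIV_cong [OF DERIV_mult [OF _ D]])
        (auto intro!: derivative_eq_intros simp: algebra_simps)
  qed
  then have "f t = f t0" using J t t0 by (intro constant_on_interval [of J])
  then have z: "inv_sq \<nu> q (t - t0) = 1 / (\<mu> t)\<^sup>2"
    by (simp add: f_def \<mu>(1))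
  then show "t - t0 \<in> life_span a \<nu> (x t0)"
    using \<mu>(2) [OF t] by (simp add: life_span_def flip: q_def)
  show "x t = flow_line \<omega> a \<nu> (x t0) (t - t0)"
    using \<mu>(2) [OF t] by (simp add: flow_line_def vec_eq_iff \<mu>(4) [OF t] z real_sqrt_divide flip: q_def)
qed

lemma open_life_span: "open (life_span a \<nu> p)"
proof -
  have "continuous_on UNIV (inv_sq \<nu> (quad a p))"
    by (meson DERIV_isCont continuous_at_imp_continuous_on inv_sq_derivative)
  then show ?thesis
    unfolding life_span_def by (intro open_Collect_less) auto
qed

text \<open>The derivative of \<open>inv_sq \<nu> q\<close> is \<open>- 2 * (\<nu> + q) * exp (- 2 * \<nu> * t)\<close>, which has a fixed sign. Monotonicity
  makes the set where \<open>inv_sq\<close> is positive an interval.\<close>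

lemma inv_sq_mono:
  "s \<le> t \<Longrightarrow> (inv_sq \<nu> q s \<le> inv_sq \<nu> q t \<longleftrightarrow> \<nu> + q \<le> 0 \<or> s = t)
     \<and> (inv_sq \<nu> q t \<le> inv_sq \<nu> q s \<longleftrightarrow> \<nu> + q \<ge> 0 \<or> s = t)"
proof (cases "\<nu> = 0")
  case True
  then show "s \<le> t \<Longrightarrow> ?thesis"
    by (auto simp: inv_sq_def mult_le_cancel_left)
next
  case False
  define d where "d = (exp (- 2 * \<nu> * t) - exp (- 2 * \<nu> * s)) / \<nu>"
  have "inv_sq \<nu> q t - inv_sq \<nu> q s = (\<nu> + q) * d"
    using False by (simp add: inv_sq_def d_def field_simps)
  moreover assume "s \<le> t"
  moreover have "d < 0" if "s < t"
    using that False by (cases "\<nu> > 0") (auto simp: d_def divide_less_0_iff)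
  ultimately show ?thesis
    by (smt (verit) mult_le_0_iff zero_le_mult_iff)
qed

lemma is_interval_life_span: "is_interval (life_span a \<nu> p)"
proof -
  have "inv_sq \<nu> q t > 0" if "inv_sq \<nu> q s > 0" "inv_sq \<nu> q u > 0" "s \<le> t" "t \<le> u" for q s t u
    using inv_sq_mono [of s t \<nu> q] inv_sq_mono [of t u \<nu> q] that by linarith
  then show ?thesis
    unfolding is_interval_1 life_span_def by blast
qed

lemma solution_flow_line: "solution (euler_field \<omega> a \<nu>) (life_span a \<nu> p) (flow_line \<omega> a \<nu> p)"
proof -
  have "((\<lambda>t. fst (flow_line \<omega> a \<nu> p t $ i)) has_real_derivative
      - \<omega> i * snd (flow_line \<omega> a \<nu> p t $ i) + (\<nu> + quad a (flow_line \<omega> a \<nu> p t)) * fst (flow_line \<omega> a \<nu> p t $ i)) (at t) \<and>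
     ((\<lambda>t. snd (flow_line \<omega> a \<nu> p t $ i)) has_real_derivative
      \<omega> i * fst (flow_line \<omega> a \<nu> p t $ i) + (\<nu> + quad a (flow_line \<omega> a \<nu> p t)) * snd (flow_line \<omega> a \<nu> p t $ i)) (at t)"
    if t: "t \<in> life_span a \<nu> p" for t i
  proof -
    let ?z = "inv_sq \<nu> (quad a p)"
    have z: "?z t > 0" using t by (simp add: life_span_def)
    have "((\<lambda>t. 1 / sqrt (?z t)) has_real_derivative (1 / sqrt (?z t)) * (\<nu> + quad a p / ?z t)) (at t)"
      using z by (auto intro!: derivative_eq_intros inv_sq_derivative simp: field_simps)
    moreover define r where "r t = 1 / sqrt (?z t)" for t
    ultimately have r: "(r has_real_derivative r t * (\<nu> + quad a p / ?z t)) (at t)"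
      by (simp add: r_def [abs_def])
    have "flow_line \<omega> a \<nu> p t $ i = r t *\<^sub>R rot (\<omega> i * t) (p $ i)" for t
      by (simp add: flow_line_def r_def)
    then show ?thesis
      unfolding quad_flow_line [OF t]
      by (auto simp: rot_def intro!: derivative_eq_intros r)
         (simp_all add: algebra_simps)
  qed
  then show ?thesis
    unfolding solution_euler_field_iff
    using open_life_span is_interval_life_span zero_in_life_span by blast
qed

text \<open>A larger domain is impossible because \<open>solution_eq_flow_line\<close> already confines every solution to the life span.\<close>

lemma maximal_solution_flow_line:
  "maximal_solution (euler_field \<omega> a \<nu>) (life_span a \<nu> p) (flow_line \<omega> a \<nu> p)"
  unfolding maximal_solution_def
proof (intro conjI allI impI, rule solution_flow_line)
  fix J y
  assume *: "solution (euler_field \<omega> a \<nu>) J y \<and> life_span a \<nu> p \<subseteq> J \<and>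
    (\<forall>t\<in>life_span a \<nu> p. y t = flow_line \<omega> a \<nu> p t)"
  then have "0 \<in> J" "y 0 = p" by (auto simp: subset_iff)
  then have "J \<subseteq> life_span a \<nu> p"
    using * solution_eq_flow_line(1) [of \<omega> a \<nu> J y 0] by auto
  then show "J = life_span a \<nu> p" using * by blast
qed

lemma maximal_solution_eq_flow_line:
  assumes max: "maximal_solution (euler_field \<omega> a \<nu>) J x" and "0 \<in> J"
  shows "J = life_span a \<nu> (x 0)" and "t \<in> J \<Longrightarrow> x t = flow_line \<omega> a \<nu> (x 0) t"
proof -
  have sol: "solution (euler_field \<omega> a \<nu>) J x"
    using max by (simp add: maximal_solution_def)
  show eq: "x t = flow_line \<omega> a \<nu> (x 0) t" if "t \<in> J" for t
    using solution_eq_flow_line(2) [OF sol \<open>0 \<in> J\<close> that] by simp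
  have "J \<subseteq> life_span a \<nu> (x 0)"
    using solution_eq_flow_line(1) [OF sol \<open>0 \<in> J\<close>] by auto
  then show "J = life_span a \<nu> (x 0)"
    using max solution_flow_line [of \<omega> a \<nu> "x 0"] eq unfolding maximal_solution_def by metis
qed

section \<open>Cells and sets of active oscillators\<close>

lemma perms_S_bij: "\<gamma> \<in> perms_S l \<Longrightarrow> bij_betw \<gamma> {1..CARD('n)} (UNIV :: 'n::{finite,linorder} set)"
  by (simp add: perms_S_def)

lemma perms_S_inj_on:
  fixes \<gamma> :: "nat \<Rightarrow> 'n::{finite,linorder}"
  shows "\<gamma> \<in> perms_S l \<Longrightarrow> l \<le> CARD('n) \<Longrightarrow> inj_on \<gamma> {1..l}"
  using perms_S_bij [of \<gamma> l] by (auto simp: bij_betw_def intro: inj_on_subset)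

lemma perms_S_image_rest:
  fixes \<gamma> :: "nat \<Rightarrow> 'n::{finite,linorder}"
  assumes "\<gamma> \<in> perms_S l" "l \<le> CARD('n)"
  shows "\<gamma> ` {l<..CARD('n)} = - \<gamma> ` {1..l}"
proof -
  have "inj_on \<gamma> {1..CARD('n)}" "\<gamma> ` {1..CARD('n)} = UNIV"
    using perms_S_bij [OF assms(1)] unfolding bij_betw_def by blast+
  moreover have "{l<..CARD('n)} = {1..CARD('n)} - {1..l}" "{1..l} \<subseteq> {1..CARD('n)}"
    using assms(2) by auto
  ultimately show ?thesis
    by (metis Compl_eq_Diff_UNIV Diff_subset inj_on_image_set_diff)
qed

lemma perms_S_card_image:
  fixes \<gamma> :: "nat \<Rightarrow> 'n::{finite,linorder}"
  shows "\<gamma> \<in> perms_S l \<Longrightarrow> l \<le> CARD('n) \<Longrightarrow> card (\<gamma> ` {1..l}) = l"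
  using perms_S_inj_on [of \<gamma> l] by (simp add: card_image)

lemma strict_mono_on_map_upt:
  fixes f :: "nat \<Rightarrow> 'a::linorder"
  assumes "strict_mono_on {m..<n} f"
  shows "map f [m..<n] = sorted_list_of_set (f ` {m..<n})"
proof -
  have "sorted (map f [m..<n])"
    using assms unfolding sorted_map
    by (intro sorted_wrt_mono_rel [OF _ sorted_upt]) (auto simp: strict_mono_on_leD)
  moreover have "distinct (map f [m..<n])"
    using strict_mono_on_imp_inj_on [OF assms] by (simp add: distinct_map)
  ultimately show ?thesis
    by (metis image_set list.set_map set_upt sorted_list_of_set.idem_if_sorted_distinct)
qed

lemma strict_mono_on_same_image:
  fixes f g :: "nat \<Rightarrow> 'a::linorder"
  assumes "strict_mono_on {m..<n} f" "strict_mono_on {m..<n} g" "f ` {m..<n} = g ` {m..<n}"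
    and "i \<in> {m..<n}"
  shows "f i = g i"
proof -
  have "map f [m..<n] = map g [m..<n]"
    using assms(1-3) by (simp add: strict_mono_on_map_upt)
  then show ?thesis using assms(4) by (metis map_eq_conv set_upt)
qed

text \<open>Both blocks of a permutation in \<open>perms_S l\<close> are increasing enumerations, so they are determined by the sets
  they enumerate, and these are complementary.\<close>

lemma perms_S_eqI:
  fixes \<gamma> \<delta> :: "nat \<Rightarrow> 'n::{finite,linorder}"
  assumes "\<gamma> \<in> perms_S l" "\<delta> \<in> perms_S l" "l \<le> CARD('n)" "\<gamma> ` {1..l} = \<delta> ` {1..l}"
  shows "\<gamma> = \<delta>"
proof
  fix i
  have eqs: "{1..l} = {1..<Suc l}" "{l<..CARD('n)} = {Suc l..<Suc CARD('n)}" by auto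
  have "\<gamma> ` {l<..CARD('n)} = \<delta> ` {l<..CARD('n)}"
    using assms by (simp add: perms_S_image_rest)
  then have "i \<in> {l<..CARD('n)} \<Longrightarrow> \<gamma> i = \<delta> i"
    using assms(1,2) unfolding perms_S_def eqs
    by (intro strict_mono_on_same_image [of "Suc l" "Suc CARD('n)"]) auto
  moreover have "i \<in> {1..l} \<Longrightarrow> \<gamma> i = \<delta> i"
    using assms(1,2,4) unfolding perms_S_def eqs
    by (intro strict_mono_on_same_image [of 1 "Suc l"]) auto
  moreover have "i \<notin> {1..CARD('n)} \<Longrightarrow> \<gamma> i = \<delta> i"
    using assms(1,2) by (auto simp: perms_S_def extensional_def)
  ultimately show "\<gamma> i = \<delta> i" by fastforce
qed

text \<open>The two increasing blocks list a set and its complement.\<close>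

lemma perms_S_exists:
  fixes A :: "'n::{finite,linorder} set"
  obtains \<gamma> where "\<gamma> \<in> perms_S (card A)" "\<gamma> ` {1..card A} = A"
proof -
  define l where "l = card A"
  define xs ys where "xs = sorted_list_of_set A" and "ys = sorted_list_of_set (- A)"
  have xs: "sorted_wrt (<) xs" "set xs = A" "length xs = l"
    and ys: "sorted_wrt (<) ys" "set ys = - A" "length ys = CARD('n) - l"
    by (simp_all add: xs_def ys_def l_def card_Diff_subset Compl_eq_Diff_UNIV)
  have l: "l \<le> CARD('n)" by (simp add: l_def card_mono)
  define \<gamma> where "\<gamma> = (\<lambda>i\<in>{1..CARD('n)}. if i \<le> l then xs ! (i - 1) else ys ! (i - l - 1))"
  have "\<gamma> ` {1..l} = (!) xs ` {..<l}"
    using l by (force simp: \<gamma>_def image_iff Bex_def intro: exI [of _ "Suc _"])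
  then have A: "\<gamma> ` {1..l} = A"
    using xs by (metis nth_image order_refl take_all_iff atLeast0LessThan)
  have "\<gamma> ` {l<..CARD('n)} = (!) ys ` {..<CARD('n) - l}"
  proof (intro equalityI subsetI)
    fix x assume "x \<in> (!) ys ` {..<CARD('n) - l}"
    then obtain j where "j < CARD('n) - l" "x = ys ! j" by auto
    then have "x = \<gamma> (Suc (l + j))" "Suc (l + j) \<in> {l<..CARD('n)}"
      by (auto simp: \<gamma>_def)
    then show "x \<in> \<gamma> ` {l<..CARD('n)}" by blast
  qed (auto simp: \<gamma>_def)
  then have B: "\<gamma> ` {l<..CARD('n)} = - A"
    using ys by (metis nth_image order_refl take_all_iff atLeast0LessThan)
  have "{1..CARD('n)} = {1..l} \<union> {l<..CARD('n)}" using l by auto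
  then have "\<gamma> ` {1..CARD('n)} = UNIV" using A B by (simp add: image_Un)
  then have "bij_betw \<gamma> {1..CARD('n)} UNIV"
    by (metis bij_betw_def card_atLeastAtMost diff_Suc_1 eq_card_imp_inj_on finite_atLeastAtMost)
  moreover have "strict_mono_on {1..l} \<gamma>"
    using xs l by (auto simp: strict_mono_on_def \<gamma>_def sorted_wrt_iff_nth_less)
  moreover have "strict_mono_on {l<..CARD('n)} \<gamma>"
    using ys l by (auto simp: strict_mono_on_def \<gamma>_def sorted_wrt_iff_nth_less)
  ultimately have "\<gamma> \<in> perms_S l"
    by (simp add: perms_S_def \<gamma>_def)
  then show thesis using that A by (simp add: l_def)
qed

lemma sub_perms_S_iff:
  fixes \<sigma> :: "nat \<Rightarrow> 'n::{finite,linorder}"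
  assumes "\<sigma> \<in> perms_S k" "l \<le> k" "k \<le> CARD('n)"
  shows "\<gamma> \<in> sub_perms_S k \<sigma> l \<longleftrightarrow> \<gamma> \<in> perms_S l \<and> \<gamma> ` {1..l} \<subseteq> \<sigma> ` {1..k}"
proof -
  have "- \<sigma> ` {1..k} \<subseteq> \<gamma> ` {l<..CARD('n)} \<longleftrightarrow> \<gamma> ` {1..l} \<subseteq> \<sigma> ` {1..k}" if "\<gamma> \<in> perms_S l"
    using assms that by (subst perms_S_image_rest) (blast | simp)+
  then show ?thesis
    using assms(1,3) perms_S_image_rest [OF assms(1,3)] by (auto simp only: sub_perms_S_def mem_Collect_eq)
qed

context
  fixes \<sigma> :: "nat \<Rightarrow> 'n::{finite,linorder}" and k :: nat
  assumes \<sigma>: "\<sigma> \<in> perms_S k" and k: "0 < k" "k \<le> CARD('n)"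
begin

lemma cell_index_iff:
  "(l, \<gamma>) \<in> cell_index k \<sigma> \<longleftrightarrow> l < k \<and> \<gamma> \<in> perms_S (l + 1) \<and> \<gamma> ` {1..l + 1} \<subseteq> \<sigma> ` {1..k}"
  using k sub_perms_S_iff [OF \<sigma>, of "l + 1" \<gamma>]
  by (cases "l < k") (auto simp: cell_index_def simp del: One_nat_def image_Suc_atLeastAtMost)

lemma card_circle_labels: "c \<in> cell_index k \<sigma> \<Longrightarrow> card (circle_labels c) = fst c + 1"
  using k perms_S_card_image [of "snd c" "fst c + 1"]
  by (cases c) (simp add: cell_index_iff circle_labels_def)

lemma circle_labels_inj_on: "inj_on circle_labels (cell_index k \<sigma>)"
proof (rule inj_onI)
  fix c d assume *: "c \<in> cell_index k \<sigma>" "d \<in> cell_index k \<sigma>" "circle_labels c = circle_labels d"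
  then have "fst c = fst d" using card_circle_labels [of c] card_circle_labels [of d] by simp
  then show "c = d"
    using * k perms_S_eqI [of "snd c" "fst c + 1" "snd d"]
    by (cases c; cases d) (auto simp: cell_index_iff circle_labels_def)
qed

text \<open>Together with injectivity this identifies the cells of dimension \<open>l\<close> with the subsets of \<open>\<sigma> ` {1..k}\<close> that have
  \<open>l + 1\<close> elements, which allows all later arguments to speak of supports instead of permutations.\<close>

lemma circle_labels_image: "circle_labels ` cell_index k \<sigma> = {A. A \<noteq> {} \<and> A \<subseteq> \<sigma> ` {1..k}}"
proof (intro equalityI subsetI)
  fix A assume "A \<in> {A. A \<noteq> {} \<and> A \<subseteq> \<sigma> ` {1..k}}"
  then have A: "A \<noteq> {}" "A \<subseteq> \<sigma> ` {1..k}" by auto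
  obtain \<gamma> where \<gamma>: "\<gamma> \<in> perms_S (card A)" "\<gamma> ` {1..card A} = A"
    using perms_S_exists by blast
  have "card A > 0" "card A \<le> k"
    using A card_mono [OF _ A(2)] k perms_S_card_image [OF \<sigma>] by (auto simp: card_gt_0_iff)
  then have "(card A - 1, \<gamma>) \<in> cell_index k \<sigma>" "circle_labels (card A - 1, \<gamma>) = A"
    using \<gamma> A by (auto simp: cell_index_iff circle_labels_def)
  then show "A \<in> circle_labels ` cell_index k \<sigma>" by force
next
  fix A assume "A \<in> circle_labels ` cell_index k \<sigma>"
  then obtain l \<gamma> where "(l, \<gamma>) \<in> cell_index k \<sigma>" "A = \<gamma> ` {1..l + 1}"
    by (force simp: circle_labels_def)
  then show "A \<in> {A. A \<noteq> {} \<and> A \<subseteq> \<sigma> ` {1..k}}"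
    unfolding cell_index_iff by auto
qed

end

section \<open>Faces of the spherical simplex and the closed cell\<close>

definition open_face :: "'n::finite set \<Rightarrow> 'n amplitude set" where
  "open_face A = {c. norm c = 1 \<and> (\<forall>i\<in>A. c $ i > 0) \<and> (\<forall>i. i \<notin> A \<longrightarrow> c $ i = 0)}"

definition closed_face :: "'n::finite set \<Rightarrow> 'n amplitude set" where
  "closed_face A = {c. norm c = 1 \<and> (\<forall>i. c $ i \<ge> 0) \<and> (\<forall>i. i \<notin> A \<longrightarrow> c $ i = 0)}"

lemma norm_vec_squared: "(norm (c :: ('a::real_normed_vector, 'n::finite) vec))\<^sup>2 = (\<Sum>i\<in>UNIV. (norm (c $ i))\<^sup>2)"
  by (simp add: norm_vec_def L2_set_def sum_nonneg)

lemma pos_sphere_eq_open_face: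
  fixes \<gamma> :: "nat \<Rightarrow> 'n::{finite,linorder}"
  assumes "\<gamma> \<in> perms_S l" "l \<le> CARD('n)"
  shows "pos_sphere l \<gamma> = open_face (\<gamma> ` {1..l})"
proof -
  have "norm c = 1 \<longleftrightarrow> (\<Sum>i=1..l. (c $ \<gamma> i)\<^sup>2) = 1" if "\<forall>i\<in>- \<gamma> ` {1..l}. c $ i = 0" for c :: "'n amplitude"
  proof -
    have "(\<Sum>i=1..l. (c $ \<gamma> i)\<^sup>2) = (\<Sum>i\<in>\<gamma> ` {1..l}. (c $ i)\<^sup>2)"
      using perms_S_inj_on [OF assms] by (simp add: sum.reindex)
    also have "\<dots> = (\<Sum>i\<in>UNIV. (c $ i)\<^sup>2)"
      using that by (intro sum.mono_neutral_left) auto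
    also have "\<dots> = (norm c)\<^sup>2" by (simp add: norm_vec_squared)
    finally show ?thesis
      by (metis norm_ge_zero one_power2 power2_eq_iff_nonneg zero_le_one)
  qed
  moreover have "(\<forall>i\<in>{l<..CARD('n)}. c $ \<gamma> i = 0) \<longleftrightarrow> (\<forall>i\<in>- \<gamma> ` {1..l}. c $ i = 0)" for c :: "'n amplitude"
    unfolding perms_S_image_rest [OF assms, symmetric] by blast
  ultimately show ?thesis
    unfolding pos_sphere_def open_face_def by auto
qed

lemma closed_closed_face: "closed (closed_face A)"
proof -
  have "closed_face A = {c. norm c = 1} \<inter> (\<Inter>i. {c. c $ i \<ge> 0}) \<inter> (\<Inter>i\<in>-A. {c. c $ i = 0})"
    by (auto simp: closed_face_def)
  moreover have "closed {c :: 'a amplitude. norm c = 1}" "closed {c :: 'a amplitude. c $ i \<ge> 0}" "closed {c :: 'a amplitude. c $ i = 0}" for i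
    by (intro closed_Collect_eq closed_Collect_le continuous_intros)+
  ultimately show ?thesis by (metis closed_INT closed_Int)
qed

lemma compact_closed_face: "compact (closed_face A)"
  using closed_closed_face [of A]
  by (auto simp: compact_eq_bounded_closed closed_face_def intro!: boundedI [where B = 1])

lemma open_face_subset: "open_face A \<subseteq> closed_face A"
  by (force simp: open_face_def closed_face_def intro: less_imp_le)

lemma closed_face_mono: "A \<subseteq> B \<Longrightarrow> closed_face A \<subseteq> closed_face B"
  by (auto simp: closed_face_def)

text \<open>A point of the closed face is approached by adding a small positive multiple of the indicator vector of \<open>A\<close>
  and normalising.\<close>

lemma closure_open_face:
  assumes "A \<noteq> {}"
  shows "closure (open_face A) = closed_face A"
proof
  show "closure (open_face A) \<subseteq> closed_face A"
    by (simp add: closure_minimal closed_closed_face open_face_subset)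
  show "closed_face A \<subseteq> closure (open_face A)"
  proof
    fix c assume c: "c \<in> closed_face A"
    define u :: "'a amplitude" where "u = (\<chi> i. if i \<in> A then 1 else 0)"
    define b where "b n = c + (1 / (real n + 1)) *\<^sub>R u" for n :: nat
    have pos: "b n $ i > 0" if "i \<in> A" for i n
      using c that by (auto simp: b_def u_def closed_face_def intro!: add_nonneg_pos)
    have zero: "b n $ i = 0" if "i \<notin> A" for i n
      using c that by (auto simp: b_def u_def closed_face_def)
    have "b n \<noteq> 0" for n
      using assms pos [of _ n] by (metis all_not_in_conv less_irrefl zero_index)
    then have "b n /\<^sub>R norm (b n) \<in> open_face A" for n
      using pos zero by (auto simp: open_face_def)
    moreover have "(\<lambda>n. b n /\<^sub>R norm (b n)) \<longlonglongrightarrow> c /\<^sub>R norm c"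
    proof -
      have "(\<lambda>n. 1 / (real n + 1)) \<longlonglongrightarrow> 0"
        using LIMSEQ_inverse_real_of_nat by (simp add: inverse_eq_divide add.commute)
      then have "b \<longlonglongrightarrow> c + 0 *\<^sub>R u"
        unfolding b_def by (intro tendsto_intros)
      then show ?thesis
        using c by (intro tendsto_intros) (auto simp: closed_face_def)
    qed
    ultimately show "c \<in> closure (open_face A)"
      using c unfolding closure_sequential closed_face_def
      by (intro exI [of _ "\<lambda>n. b n /\<^sub>R norm (b n)"]) simp
  qed
qed

text \<open>A nonnegative unit vector lies in the open face of its support and in no other.\<close>

lemma closed_face_eq_Union: "closed_face A = (\<Union>B\<in>{B. B \<noteq> {} \<and> B \<subseteq> A}. open_face B)"
proof (intro equalityI subsetI)
  fix c assume c: "c \<in> closed_face A"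
  let ?B = "{i. c $ i \<noteq> 0}"
  have "c \<noteq> 0" using c by (auto simp: closed_face_def)
  then have "?B \<noteq> {}" by (auto simp: vec_eq_iff)
  moreover have "c \<in> open_face ?B" "?B \<subseteq> A"
  proof -
    have "c $ i > 0" if "c $ i \<noteq> 0" for i
      using c that unfolding closed_face_def by (metis (mono_tags, lifting) le_neq_trans mem_Collect_eq)
    then show "c \<in> open_face ?B" using c by (simp add: closed_face_def open_face_def)
    show "?B \<subseteq> A" using c by (auto simp: closed_face_def)
  qed
  ultimately show "c \<in> (\<Union>B\<in>{B. B \<noteq> {} \<and> B \<subseteq> A}. open_face B)"
    by (intro UN_I [of ?B]) simp_all
next
  fix c assume "c \<in> (\<Union>B\<in>{B. B \<noteq> {} \<and> B \<subseteq> A}. open_face B)"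
  then obtain B where "B \<subseteq> A" "c \<in> closed_face B"
    using open_face_subset by blast
  then show "c \<in> closed_face A"
    by (auto simp: closed_face_def)
qed

lemma open_face_support: "c \<in> open_face A \<Longrightarrow> {i. c $ i \<noteq> 0} = A"
  by (force simp: open_face_def)

lemma open_face_nonempty:
  assumes "A \<noteq> {}"
  obtains c where "c \<in> open_face A"
proof -
  have "closed_face A \<noteq> {}"
  proof -
    obtain i where "i \<in> A" using assms by auto
    then have "axis i 1 \<in> closed_face A" by (auto simp: closed_face_def) (auto simp: axis_def)
    then show ?thesis by blast
  qed
  then show thesis using that closure_open_face [OF assms] by fastforce
qed

lemma open_face_subset_closed_face_iff:
  assumes "A \<noteq> {}"
  shows "open_face A \<subseteq> closed_face B \<longleftrightarrow> A \<subseteq> B"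
proof
  assume "open_face A \<subseteq> closed_face B"
  moreover obtain c where "c \<in> open_face A" using open_face_nonempty [OF assms] .
  ultimately show "A \<subseteq> B" by (force simp: open_face_def closed_face_def)
qed (use assms in \<open>auto simp: closed_face_eq_Union\<close>)

definition coord_space :: "'n set \<Rightarrow> 'n::finite phase set" where
  "coord_space A = {p. \<forall>i. i \<notin> A \<longrightarrow> p $ i = 0}"

lemma cell_M_eq:
  fixes \<sigma> :: "nat \<Rightarrow> 'n::{finite,linorder}"
  assumes "\<sigma> \<in> perms_S k" "k \<le> CARD('n)"
  shows "cell_M k \<sigma> = {p. {i. p $ i \<noteq> 0} = \<sigma> ` {1..k}}"
proof -
  have "(\<forall>i\<in>{k<..CARD('n)}. p $ \<sigma> i = 0) \<longleftrightarrow> (\<forall>i\<in>- \<sigma> ` {1..k}. p $ i = 0)" for p :: "'n phase"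
    unfolding perms_S_image_rest [OF assms, symmetric] by blast
  then show ?thesis unfolding cell_M_def by auto
qed

lemma closed_coord_space: "closed (coord_space A)"
proof -
  have "coord_space A = (\<Inter>i\<in>-A. {p. p $ i = 0})" by (auto simp: coord_space_def)
  moreover have "closed {p :: 'a phase. p $ i = 0}" for i
    by (intro closed_Collect_eq continuous_intros)
  ultimately show ?thesis by auto
qed

text \<open>The vanishing coordinates are perturbed to small nonzero values.\<close>

lemma closure_cell_M:
  fixes \<sigma> :: "nat \<Rightarrow> 'n::{finite,linorder}"
  assumes "\<sigma> \<in> perms_S k" "k \<le> CARD('n)"
  shows "closure (cell_M k \<sigma>) = coord_space (\<sigma> ` {1..k})"
proof
  show "closure (cell_M k \<sigma>) \<subseteq> coord_space (\<sigma> ` {1..k})"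
    using cell_M_eq [OF assms]
    by (intro closure_minimal closed_coord_space) (auto simp: coord_space_def)
  show "coord_space (\<sigma> ` {1..k}) \<subseteq> closure (cell_M k \<sigma>)"
  proof
    fix p assume p: "p \<in> coord_space (\<sigma> ` {1..k})"
    define u :: "'n phase" where "u = (\<chi> i. if i \<in> \<sigma> ` {1..k} \<and> p $ i = 0 then (1, 0) else 0)"
    have "p + (1 / (real n + 1)) *\<^sub>R u \<in> cell_M k \<sigma>" for n :: nat
      using p by (auto simp: cell_M_eq [OF assms] coord_space_def u_def zero_prod_def split: if_splits)
    moreover have "(\<lambda>n. p + (1 / (real n + 1)) *\<^sub>R u) \<longlonglongrightarrow> p + 0 *\<^sub>R u"
    proof -
      have "(\<lambda>n. 1 / (real n + 1)) \<longlonglongrightarrow> 0"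
        using LIMSEQ_inverse_real_of_nat by (simp add: inverse_eq_divide add.commute)
      then show ?thesis by (intro tendsto_intros)
    qed
    ultimately show "p \<in> closure (cell_M k \<sigma>)"
      unfolding closure_sequential by (intro exI [of _ "\<lambda>n. p + (1 / (real n + 1)) *\<^sub>R u"]) simp
  qed
qed

section \<open>Closed balls as spherical simplices\<close>

lemma continuous_on_Min:
  fixes f :: "'i \<Rightarrow> 'a::topological_space \<Rightarrow> real"
  assumes "finite I" "I \<noteq> {}" "\<And>i. i \<in> I \<Longrightarrow> continuous_on S (f i)"
  shows "continuous_on S (\<lambda>x. Min ((\<lambda>i. f i x) ` I))"
  using assms by (induction rule: finite_ne_induct) (auto intro!: continuous_intros)

text \<open>The first \<open>l\<close> coordinates are completed to \<open>l + 1\<close> coordinates with sum zero. This identifies the space of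
  dimension \<open>l\<close> with the hyperplane parallel to the simplex, in which all vertices play the same role.\<close>

definition last_coord :: "nat \<Rightarrow> (nat \<Rightarrow> real) \<Rightarrow> nat \<Rightarrow> real" where
  "last_coord l x i = (if i < l then x i else - (\<Sum>j<l. x j))"

definition ball_norm :: "nat \<Rightarrow> (nat \<Rightarrow> real) \<Rightarrow> real" where
  "ball_norm l x = sqrt (\<Sum>j<l. (x j)\<^sup>2)"

definition min_coord :: "nat \<Rightarrow> (nat \<Rightarrow> real) \<Rightarrow> real" where
  "min_coord l x = Min (last_coord l x ` {..l})"

text \<open>Up to a factor, \<open>- min_coord l x\<close> is the gauge of the simplex centred at its barycentre: the point
  \<open>1 + r * last_coord l x\<close> of the hyperplane with coordinate sum \<open>l + 1\<close> stays in the simplex as long as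
  \<open>r * (- min_coord l x) \<le> 1\<close>. Replacing the gauge by the Euclidean norm along each ray maps the unit ball
  onto the simplex. At \<open>x = 0\<close> the quotient has the value \<open>0\<close> by division by zero, as it should.\<close>

definition bary :: "nat \<Rightarrow> (nat \<Rightarrow> real) \<Rightarrow> nat \<Rightarrow> real" where
  "bary l x i = 1 - ball_norm l x * last_coord l x i / min_coord l x"

lemma sum_last_coord: "(\<Sum>i\<le>l. last_coord l x i) = 0"
proof -
  have "(\<Sum>i\<le>l. last_coord l x i) = (\<Sum>i<l. last_coord l x i) + last_coord l x l"
    by (simp add: lessThan_Suc_atMost [symmetric])
  then show ?thesis by (simp add: last_coord_def)
qed

lemma min_coord_le: "i \<le> l \<Longrightarrow> min_coord l x \<le> last_coord l x i"
  unfolding min_coord_def by (intro Min_le) auto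

lemma min_coord_attained: obtains i where "i \<le> l" "min_coord l x = last_coord l x i"
proof -
  have "min_coord l x \<in> last_coord l x ` {..l}"
    unfolding min_coord_def by (intro Min_in) auto
  then show thesis using that by auto
qed

text \<open>The coordinates sum to zero, so each is minus the sum of \<open>l\<close> others, none of which is below the minimum.
  Hence the minimum controls all absolute values, which gives continuity of \<open>bary\<close> at the centre.\<close>

lemma last_coord_le: 
  assumes "i \<le> l"
  shows "last_coord l x i \<le> - real l * min_coord l x"
proof -
  have "0 = last_coord l x i + (\<Sum>j\<in>{..l} - {i}. last_coord l x j)"
    using sum_last_coord [of l x] assms by (simp add: sum.remove)
  moreover have "(\<Sum>j\<in>{..l} - {i}. last_coord l x j) \<ge> (\<Sum>j\<in>{..l} - {i}. min_coord l x)"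
    by (intro sum_mono min_coord_le) auto
  ultimately show ?thesis using assms by simp
qed

lemma min_coord_nonpos: "min_coord l x \<le> 0"
proof -
  have "real (Suc l) * min_coord l x \<le> 0"
    using last_coord_le [of l l x] min_coord_le [of l l x] by (simp add: algebra_simps)
  then show ?thesis by (simp add: mult_le_0_iff)
qed

lemma abs_last_coord_le:
  assumes "i \<le> l"
  shows "\<bar>last_coord l x i\<bar> \<le> real (Suc l) * - min_coord l x"
proof -
  have "real l * min_coord l x \<le> 0" using min_coord_nonpos [of l x] by (simp add: mult_nonneg_nonpos)
  then show ?thesis
    using last_coord_le [OF assms, of x] min_coord_le [OF assms, of x] min_coord_nonpos [of l x]
    by (simp add: algebra_simps abs_le_iff)
qed

lemma ball_norm_nonneg [simp]: "ball_norm l x \<ge> 0"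
  by (simp add: ball_norm_def sum_nonneg)

lemma ball_norm_eq_0: "ball_norm l x = 0 \<longleftrightarrow> (\<forall>i<l. x i = 0)"
  by (auto simp: ball_norm_def sum_nonneg_eq_0_iff)

lemma min_coord_eq_0: "min_coord l x = 0 \<longleftrightarrow> (\<forall>i<l. x i = 0)"
proof
  assume "min_coord l x = 0"
  then have "last_coord l x i = 0" if "i \<le> l" for i using abs_last_coord_le [OF that, of x] by simp
  then show "\<forall>i<l. x i = 0" by (metis last_coord_def less_imp_le)
next
  assume "\<forall>i<l. x i = 0"
  then show "min_coord l x = 0" by (metis (mono_tags, lifting) last_coord_def lessThan_iff min_coord_attained neg_equal_zero sum.neutral)
qed

lemma min_coord_neg_iff: "min_coord l x < 0 \<longleftrightarrow> ball_norm l x > 0"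
  using min_coord_nonpos [of l x] min_coord_eq_0 [of l x] ball_norm_eq_0 [of l x]
    ball_norm_nonneg [of l x] by (metis less_le)

lemma sum_bary: "(\<Sum>i\<le>l. bary l x i) = real l + 1"
  by (simp add: bary_def sum_subtractf sum_last_coord flip: sum_divide_distrib sum_distrib_left)

lemma bary_ge: "i \<le> l \<Longrightarrow> bary l x i \<ge> 1 - ball_norm l x"
  using min_coord_le [of i l x] min_coord_nonpos [of l x]
  by (cases "min_coord l x = 0") (auto simp: bary_def divide_le_eq mult_left_mono)

text \<open>The smallest barycentric coordinate measures the distance from the boundary sphere, so interior points of
  the ball are exactly those with positive coordinates.\<close>

lemma bary_min_attained: obtains i where "i \<le> l" "bary l x i = 1 - ball_norm l x"
proof -
  obtain i where "i \<le> l" "min_coord l x = last_coord l x i" by (rule min_coord_attained)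
  then show thesis
    using that [of i] ball_norm_eq_0 [of l x] min_coord_eq_0 [of l x]
    by (cases "min_coord l x = 0") (auto simp: bary_def)
qed

text \<open>Equal barycentric coordinates force equal norms, by the minimal coordinate, and then positively
  proportional vectors.\<close>

lemma bary_inj:
  assumes eq: "\<And>i. i \<le> l \<Longrightarrow> bary l x i = bary l y i" and i: "i < l"
  shows "x i = y i"
proof -
  have norm: "ball_norm l x = ball_norm l y"
  proof -
    obtain i j where "i \<le> l" "bary l x i = 1 - ball_norm l x" "j \<le> l" "bary l y j = 1 - ball_norm l y"
      using bary_min_attained [of l x] bary_min_attained [of l y] by metis
    then show ?thesis
      using bary_ge [of j l x] bary_ge [of i l y] eq [of i] eq [of j] by linarith
  qed
  show ?thesis
  proof (cases "ball_norm l x = 0")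
    case True
    then show ?thesis using norm i by (metis ball_norm_eq_0)
  next
    case False
    then have mx: "min_coord l x < 0" and my: "min_coord l y < 0"
      unfolding min_coord_neg_iff using norm ball_norm_nonneg [of l y] by linarith+
    define s where "s = min_coord l x / min_coord l y"
    have s: "s > 0" using mx my by (simp add: s_def divide_neg_neg)
    have xy: "x j = s * y j" if "j < l" for j
    proof -
      have "ball_norm l x * x j / min_coord l x = ball_norm l x * y j / min_coord l y"
        using eq [of j] that by (simp add: bary_def last_coord_def norm)
      then show ?thesis using mx my False by (simp add: s_def field_simps)
    qed
    have "ball_norm l x = s * ball_norm l y"
      using s by (simp add: ball_norm_def xy power_mult_distrib real_sqrt_mult flip: sum_distrib_left)
    then have "s = 1" using norm False by simp
    then show ?thesis using xy i by simp
  qed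
qed

text \<open>The deviation \<open>u\<close> of \<open>b\<close> from the barycentre determines the ray; the norm on it has to be \<open>- min_coord l u\<close>.\<close>

lemma bary_surj:
  assumes sum: "(\<Sum>i\<le>l. b i) = real l + 1" and nonneg: "\<And>i. i \<le> l \<Longrightarrow> b i \<ge> 0"
  obtains x where "\<And>i. i \<ge> l \<Longrightarrow> x i = 0" "ball_norm l x \<le> 1" "\<And>i. i \<le> l \<Longrightarrow> bary l x i = b i"
proof -
  define u where "u i = (if i < l then b i - 1 else 0)" for i
  have u: "last_coord l u i = b i - 1" if "i \<le> l" for i
  proof (cases "i < l")
    case False
    then have "i = l" using that by simp
    moreover have "(\<Sum>j<l. b j) + b l = real l + 1"
      using sum by (simp add: lessThan_Suc_atMost [symmetric])
    ultimately show ?thesis by (simp add: last_coord_def u_def sum_subtractf)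
  qed (simp add: last_coord_def u_def)
  show thesis
  proof (cases "min_coord l u = 0")
    case True
    then have "b i = 1" if "i \<le> l" for i
      using u [OF that] abs_last_coord_le [OF that, of u] by simp
    then show ?thesis
      using that [of "\<lambda>_. 0"] by (simp add: ball_norm_def bary_def)
  next
    case False
    define m where "m = - min_coord l u"
    have m: "m > 0" using False min_coord_nonpos [of l u] by (simp add: m_def)
    have nu: "ball_norm l u > 0"
      using m by (simp add: m_def min_coord_neg_iff)
    define t where "t = m / ball_norm l u"
    have t: "t > 0" using m nu by (simp add: t_def)
    define x where "x i = t * u i" for i
    have "last_coord l x i = t * last_coord l u i" for i
      by (simp add: last_coord_def x_def sum_distrib_left)
    moreover from this have "min_coord l x = t * min_coord l u"
      using mono_Min_commute [of "(*) t" "last_coord l u ` {..l}"] t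
      by (simp add: min_coord_def image_image mono_def)
    moreover have nx: "ball_norm l x = m"
      using t nu by (simp add: ball_norm_def x_def power_mult_distrib real_sqrt_mult flip: sum_distrib_left)
        (simp add: t_def ball_norm_def)
    ultimately have "bary l x i = b i" if "i \<le> l" for i
      using m t u [OF that] by (simp add: bary_def m_def)
    moreover have "m \<le> 1"
      using u nonneg by (metis min_coord_attained m_def diff_ge_0_iff_ge minus_diff_eq add.inverse_inverse diff_add_cancel le_add_diff_inverse2 neg_le_iff_le diff_0 diff_left_mono diff_zero)
    ultimately show ?thesis using that [of x] nx by (simp add: x_def u_def)
  qed
qed

definition ball_set :: "nat \<Rightarrow> (nat \<Rightarrow> real) set" where
  "ball_set l = {x. (\<forall>i\<ge>l. x i = 0) \<and> ball_norm l x \<le> 1}"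

lemma closed_unit_ball_eq: "closed_unit_ball l = top_of_set (ball_set l)"
  by (auto simp: closed_unit_ball_def Euclidean_space_def euclidean_product_topology
        subtopology_subtopology ball_set_def ball_norm_def Int_def)

lemma topspace_closed_unit_ball [simp]: "topspace (closed_unit_ball l) = ball_set l"
  by (simp add: closed_unit_ball_eq)

lemma open_ball_set_eq: "open_ball_set l = {x \<in> ball_set l. ball_norm l x < 1}"
  by (auto simp: open_ball_set_def ball_set_def topspace_Euclidean_space ball_norm_def)

lemma continuous_on_coord [continuous_intros]: "continuous_on S (\<lambda>x. x i :: real)"
  by (rule continuous_on_product_coordinates [THEN continuous_on_subset]) auto

lemma continuous_on_ball_norm: "continuous_on S (ball_norm l)"
  unfolding ball_norm_def by (intro continuous_intros)

lemma continuous_on_last_coord: "continuous_on S (\<lambda>x. last_coord l x i)"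
  unfolding last_coord_def by (cases "i < l") (auto intro!: continuous_intros)

lemma compact_ball_set: "compact (ball_set l)"
proof -
  have "closed {x. ball_norm l x \<le> 1}"
    by (intro closed_Collect_le continuous_on_ball_norm continuous_intros)
  moreover have "ball_set l = (\<Inter>i\<in>{l..}. {x. x i = 0}) \<inter> {x. ball_norm l x \<le> 1}"
    by (auto simp: ball_set_def)
  moreover have "closed {x :: nat \<Rightarrow> real. x i = 0}" for i
    by (intro closed_Collect_eq continuous_intros)
  ultimately have "closed (ball_set l)" by (metis closed_INT closed_Int)
  moreover have "ball_set l \<subseteq> PiE UNIV (\<lambda>_. {-1..1})"
  proof
    fix x assume x: "x \<in> ball_set l"
    have "\<bar>x i\<bar> \<le> 1" for i
    proof (cases "i < l")
      case True
      then have "(x i)\<^sup>2 \<le> (\<Sum>j<l. (x j)\<^sup>2)" by (intro member_le_sum) auto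
      then have "\<bar>x i\<bar> \<le> ball_norm l x" by (simp add: ball_norm_def real_le_rsqrt)
      then show ?thesis using x by (simp add: ball_set_def)
    qed (use x in \<open>auto simp: ball_set_def\<close>)
    then show "x \<in> PiE UNIV (\<lambda>_. {-1..1})" by (auto simp: abs_le_iff minus_le_iff)
  qed
  moreover have "compact (PiE UNIV (\<lambda>_. {-1..1}) :: (nat \<Rightarrow> real) set)"
    using compactin_PiE [of "\<lambda>_. euclideanreal" UNIV "\<lambda>_. {-1..1}"] by (simp add: euclidean_product_topology)
  ultimately show ?thesis by (metis compact_Int_closed inf.absorb2)
qed

text \<open>Away from the centre this is composition of continuous functions. At the centre the deviation from \<open>1\<close> is
  at most \<open>l + 1\<close> times the norm.\<close>

lemma continuous_on_bary:
  assumes "i \<le> l"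
  shows "continuous_on (ball_set l) (\<lambda>x. bary l x i)"
proof -
  have "continuous (at x within ball_set l) (\<lambda>x. bary l x i)" if x: "x \<in> ball_set l" for x
  proof (cases "min_coord l x = 0")
    case False
    have cm: "continuous_on (ball_set l) (min_coord l)"
      unfolding min_coord_def by (intro continuous_on_Min continuous_on_last_coord) auto
    show ?thesis
      unfolding bary_def continuous_within using x False cm
        continuous_on_ball_norm [of "ball_set l" l] continuous_on_last_coord [of "ball_set l" l i]
      by (intro tendsto_intros) (auto simp: continuous_on_def)
  next
    case True
    then have 0: "ball_norm l x = 0" by (simp add: min_coord_eq_0 ball_norm_eq_0)
    have bound: "\<bar>bary l y i - 1\<bar> \<le> real (Suc l) * ball_norm l y" for y
    proof (cases "min_coord l y = 0")
      case False
      then have neg: "- min_coord l y > 0" using min_coord_nonpos [of l y] by linarith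
      have "\<bar>ball_norm l y * last_coord l y i\<bar> \<le> (real (Suc l) * ball_norm l y) * - min_coord l y"
        using mult_left_mono [OF abs_last_coord_le [OF assms, of y] ball_norm_nonneg [of l y]]
        by (simp only: abs_mult abs_of_nonneg [OF ball_norm_nonneg] ac_simps)
      moreover have "\<bar>bary l y i - 1\<bar> = \<bar>ball_norm l y * last_coord l y i\<bar> / - min_coord l y"
        using neg by (simp add: bary_def abs_divide)
      ultimately show ?thesis using neg by (metis pos_divide_le_eq)
    qed (simp add: bary_def)
    have "(ball_norm l \<longlongrightarrow> ball_norm l x) (at x within ball_set l)"
      using continuous_on_ball_norm [of "ball_set l" l] x by (simp add: continuous_on_def)
    then have "((\<lambda>y. real (Suc l) * ball_norm l y) \<longlongrightarrow> 0) (at x within ball_set l)"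
      unfolding 0 by (rule tendsto_mult_right_zero)
    then have "((\<lambda>y. bary l y i - 1) \<longlongrightarrow> 0) (at x within ball_set l)"
      by (rule Lim_null_comparison [rotated]) (use bound in auto)
    moreover have "bary l x i = 1" by (simp add: bary_def 0)
    ultimately show ?thesis
      by (simp add: continuous_within LIM_zero_iff)
  qed
  then show ?thesis by (simp add: continuous_on_eq_continuous_within)
qed

text \<open>The vertices of the face are \<open>f 0, ..., f l\<close>, and \<open>bary_vec l f x\<close> lies in the flat simplex that they span,
  scaled to coordinate sum \<open>l + 1\<close>.\<close>

definition bary_vec :: "nat \<Rightarrow> (nat \<Rightarrow> 'n::finite) \<Rightarrow> (nat \<Rightarrow> real) \<Rightarrow> 'n amplitude" where
  "bary_vec l f x = (\<chi> j. if j \<in> f ` {..l} then bary l x (inv_into {..l} f j) else 0)"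

definition face_map :: "nat \<Rightarrow> (nat \<Rightarrow> 'n::finite) \<Rightarrow> (nat \<Rightarrow> real) \<Rightarrow> 'n amplitude" where
  "face_map l f x = bary_vec l f x /\<^sub>R norm (bary_vec l f x)"

context
  fixes l :: nat and f :: "nat \<Rightarrow> 'n::finite"
  assumes inj: "inj_on f {..l}"
begin

lemma bary_vec_nth: "i \<le> l \<Longrightarrow> bary_vec l f x $ f i = bary l x i"
  using inj by (simp add: bary_vec_def inv_into_f_f)

lemma bary_vec_outside: "j \<notin> f ` {..l} \<Longrightarrow> bary_vec l f x $ j = 0"
  by (simp add: bary_vec_def)

lemma sum_bary_vec: "(\<Sum>j\<in>UNIV. bary_vec l f x $ j) = real l + 1"
proof -
  have "(\<Sum>j\<in>UNIV. bary_vec l f x $ j) = (\<Sum>j\<in>f ` {..l}. bary_vec l f x $ j)"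
    by (intro sum.mono_neutral_right) (auto simp: bary_vec_outside)
  also have "\<dots> = (\<Sum>i\<le>l. bary l x i)"
    by (simp add: sum.reindex [OF inj] bary_vec_nth)
  finally show ?thesis by (simp add: sum_bary)
qed

lemma bary_vec_nonzero: "bary_vec l f x \<noteq> 0"
  using sum_bary_vec [of x] by auto

lemma face_map_in:
  assumes "x \<in> ball_set l"
  shows "face_map l f x \<in> closed_face (f ` {..l})"
    and "face_map l f x \<in> open_face (f ` {..l}) \<longleftrightarrow> ball_norm l x < 1"
proof -
  have nn: "bary_vec l f x $ j \<ge> 0" for j
    using bary_ge [of _ l x] assms
    by (cases "j \<in> f ` {..l}") (fastforce simp: bary_vec_nth bary_vec_outside ball_set_def)+
  then show "face_map l f x \<in> closed_face (f ` {..l})"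
    by (auto simp: closed_face_def face_map_def bary_vec_nonzero bary_vec_outside)
  have "face_map l f x \<in> open_face (f ` {..l}) \<longleftrightarrow> (\<forall>i\<le>l. bary l x i > 0)"
    using bary_vec_nonzero
    by (auto simp: open_face_def face_map_def bary_vec_outside bary_vec_nth zero_less_mult_iff)
  also have "\<dots> \<longleftrightarrow> ball_norm l x < 1"
    using bary_ge [of _ l x] bary_min_attained [of l x] by (smt (verit))
  finally show "face_map l f x \<in> open_face (f ` {..l}) \<longleftrightarrow> ball_norm l x < 1" .
qed

text \<open>Central projection is injective on the flat simplex, because the coordinate sum recovers the scaling.\<close>

lemma face_map_inj: "inj_on (face_map l f) (ball_set l)"
proof (rule inj_onI)
  fix x y assume x: "x \<in> ball_set l" and y: "y \<in> ball_set l" and eq: "face_map l f x = face_map l f y"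
  have *: "bary_vec l f z = norm (bary_vec l f z) *\<^sub>R face_map l f z" for z
    by (simp add: face_map_def bary_vec_nonzero)
  have **: "real l + 1 = norm (bary_vec l f z) * (\<Sum>j\<in>UNIV. face_map l f z $ j)" for z
    using sum_bary_vec [of z] by (subst (asm) *) (simp add: sum_distrib_left)
  have "norm (bary_vec l f x) = norm (bary_vec l f y)"
    using ** [of x] ** [of y] unfolding eq
    by (metis add.commute mult_cancel_right mult_zero_right of_nat_Suc of_nat_neq_0)
  then have "bary_vec l f x = bary_vec l f y" by (metis * eq)
  then have "bary l x i = bary l y i" if "i \<le> l" for i
    using bary_vec_nth that by metis
  then have "x i = y i" if "i < l" for i using bary_inj that by blast
  then show "x = y"
  proof (intro ext)
    show "x i = y i" for i
      using x y \<open>i < l \<Longrightarrow> x i = y i\<close> by (cases "i < l") (auto simp: ball_set_def)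
  qed
qed

lemma face_map_image: "face_map l f ` ball_set l = closed_face (f ` {..l})"
proof (intro equalityI subsetI)
  fix c assume c: "c \<in> closed_face (f ` {..l})"
  define s where "s = (\<Sum>i\<le>l. c $ f i)"
  have pos: "c $ j \<ge> 0" for j using c by (simp add: closed_face_def)
  have "s \<noteq> 0"
  proof
    assume "s = 0"
    then have "c $ j = 0" for j
      using c pos by (cases "j \<in> f ` {..l}") (auto simp: s_def sum_nonneg_eq_0_iff closed_face_def)
    then have "c = 0" by (simp add: vec_eq_iff)
    then show False using c by (simp add: closed_face_def)
  qed
  then have s: "s > 0" using pos by (simp add: s_def less_le sum_nonneg)
  define t where "t = (real l + 1) / s"
  have t: "t > 0" using s by (simp add: t_def)
  obtain x where x: "\<And>i. i \<ge> l \<Longrightarrow> x i = 0" "ball_norm l x \<le> 1" "\<And>i. i \<le> l \<Longrightarrow> bary l x i = t * c $ f i"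
  proof (rule bary_surj)
    show "(\<Sum>i\<le>l. t * c $ f i) = real l + 1"
      unfolding sum_distrib_left [symmetric] s_def [symmetric] using s by (simp add: t_def)
    show "t * c $ f i \<ge> 0" for i using t pos by simp
  qed blast
  have "bary_vec l f x = t *\<^sub>R c"
  proof -
    have "bary_vec l f x $ j = t * c $ j" for j
      using x(3) c by (cases "j \<in> f ` {..l}") (auto simp: bary_vec_nth bary_vec_outside closed_face_def)
    then show ?thesis by (simp add: vec_eq_iff)
  qed
  then have "face_map l f x = c"
    using t c by (simp add: face_map_def closed_face_def)
  moreover have "x \<in> ball_set l" using x by (simp add: ball_set_def)
  ultimately show "c \<in> face_map l f ` ball_set l" by blast
qed (use face_map_in in auto)

lemma continuous_on_face_map: "continuous_on (ball_set l) (face_map l f)"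
proof -
  have "continuous_on (ball_set l) (\<lambda>x. if j \<in> f ` {..l} then bary l x (inv_into {..l} f j) else 0)" for j
  proof (cases "j \<in> f ` {..l}")
    case True
    then have "inv_into {..l} f j \<le> l" using inv_into_into [OF True] by simp
    then show ?thesis using True continuous_on_bary by simp
  qed auto
  then have "continuous_on (ball_set l) (bary_vec l f)"
    unfolding bary_vec_def by (intro continuous_on_vec_lambda)
  then show ?thesis
    unfolding face_map_def by (intro continuous_intros) (auto simp: bary_vec_nonzero)
qed

text \<open>A continuous bijection from a compact space onto a Hausdorff space is a homeomorphism.\<close>

lemma homeomorphic_map_face_map:
  "homeomorphic_map (closed_unit_ball l) (top_of_set (closed_face (f ` {..l}))) (face_map l f)"
  unfolding closed_unit_ball_eq
  by (rule continuous_imp_homeomorphic_map)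
     (use compact_ball_set continuous_on_face_map face_map_inj face_map_image in
      \<open>auto simp: compact_space_subtopology Hausdorff_space_subtopology\<close>)

lemma face_map_open_ball: "face_map l f ` open_ball_set l = open_face (f ` {..l})"
proof -
  have "open_face (f ` {..l}) \<subseteq> face_map l f ` ball_set l"
    unfolding face_map_image by (rule open_face_subset)
  then show ?thesis unfolding open_ball_set_eq using face_map_in(2) by blast
qed

end

section \<open>Pullback topologies along injective maps\<close>

lemma homeomorphic_map_pullback_topology:
  assumes "inj_on f S" "f ` S \<subseteq> topspace Z"
  shows "homeomorphic_map (pullback_topology S f Z) (subtopology Z (f ` S)) f"
proof (rule bijective_open_imp_homeomorphic_map)
  have top: "topspace (pullback_topology S f Z) = S"
    using assms(2) by (auto simp: topspace_pullback_topology)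
  show "continuous_map (pullback_topology S f Z) (subtopology Z (f ` S)) f"
    using continuous_map_pullback [OF continuous_map_id, of S f Z]
    by (auto simp: continuous_map_in_subtopology top o_def)
  show "open_map (pullback_topology S f Z) (subtopology Z (f ` S)) f"
    using assms(1) by (auto simp: open_map_def openin_pullback_topology openin_subtopology inj_on_def)
  show "f ` topspace (pullback_topology S f Z) = topspace (subtopology Z (f ` S))"
    using assms(2) by (auto simp: top)
  show "inj_on f (topspace (pullback_topology S f Z))"
    using assms(1) by (simp add: top)
qed

lemma subtopology_pullback_topology:
  "Q \<subseteq> S \<Longrightarrow> subtopology (pullback_topology S f Z) Q = pullback_topology Q f Z"
  unfolding topology_eq openin_subtopology openin_pullback_topology by blast

text \<open>A topology for which \<open>f\<close> is a homeomorphism onto its image is the pullback topology. This is how the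
  topology of a piece is recognised as a product topology.\<close>

lemma homeomorphic_map_imp_eq_pullback_topology:
  assumes hom: "homeomorphic_map W (subtopology Z (f ` topspace W)) f"
  shows "W = pullback_topology (topspace W) f Z"
  unfolding topology_eq openin_pullback_topology
proof (intro allI iffI)
  have inj: "inj_on f (topspace W)"
    using hom by (rule homeomorphic_imp_injective_map)
  fix U
  {
    assume U: "openin W U"
    then have "openin (subtopology Z (f ` topspace W)) (f ` U)"
      using hom homeomorphic_imp_open_map open_map_def by blast
    then obtain V where V: "openin Z V" "f ` U = V \<inter> f ` topspace W"
      by (auto simp: openin_subtopology)
    have "U = f -` V \<inter> topspace W"
    proof (intro equalityI subsetI)
      fix x assume "x \<in> U"
      then have "f x \<in> V" "x \<in> topspace W"
        using V(2) openin_subset [OF U] by (metis IntD1 imageI, metis subsetD)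
      then show "x \<in> f -` V \<inter> topspace W" by simp
    next
      fix x assume x: "x \<in> f -` V \<inter> topspace W"
      then have "f x \<in> f ` U" unfolding V(2) by blast
      then show "x \<in> U" using x inj openin_subset [OF U] by (simp add: inj_on_image_mem_iff)
    qed
    then show "\<exists>V. openin Z V \<and> U = f -` V \<inter> topspace W" using V(1) by blast
  next
    assume "\<exists>V. openin Z V \<and> U = f -` V \<inter> topspace W"
    then obtain V where V: "openin Z V" "U = f -` V \<inter> topspace W" by blast
    have "continuous_map W Z f"
      using hom homeomorphic_imp_continuous_map continuous_map_in_subtopology by blast
    then have "openin W {x \<in> topspace W. f x \<in> V}"
      using V(1) openin_continuous_map_preimage by blast
    moreover have "{x \<in> topspace W. f x \<in> V} = U" using V(2) by auto
    ultimately show "openin W U" by simp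
  }
qed

lemma limitin_pullback_topology:
  fixes Z :: "'b topology"
  assumes "q \<in> S" "range u \<subseteq> S"
  shows "limitin (pullback_topology S f Z) u q sequentially \<longleftrightarrow> limitin Z (\<lambda>j. f (u j)) (f q) sequentially"
proof
  assume L: "limitin (pullback_topology S f Z) u q sequentially"
  show "limitin Z (\<lambda>j. f (u j)) (f q) sequentially"
    unfolding limitin_def
  proof (intro conjI allI impI)
    show "f q \<in> topspace Z"
      using L by (auto simp: limitin_def topspace_pullback_topology)
    fix U assume "openin Z U \<and> f q \<in> U"
    then have "openin (pullback_topology S f Z) (f -` U \<inter> S)" "q \<in> f -` U \<inter> S"
      using assms by (auto simp: openin_pullback_topology)
    then have "\<forall>\<^sub>F j in sequentially. u j \<in> f -` U \<inter> S"
      using L unfolding limitin_def by blast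
    then show "\<forall>\<^sub>F j in sequentially. f (u j) \<in> U" by (auto elim: eventually_mono)
  qed
next
  assume L: "limitin Z (\<lambda>j. f (u j)) (f q) sequentially"
  show "limitin (pullback_topology S f Z) u q sequentially"
    unfolding limitin_def
  proof (intro conjI allI impI)
    show "q \<in> topspace (pullback_topology S f Z)"
      using L assms by (auto simp: limitin_def topspace_pullback_topology)
    fix U assume "openin (pullback_topology S f Z) U \<and> q \<in> U"
    then obtain V where V: "openin Z V" "U = f -` V \<inter> S" "f q \<in> V"
      by (auto simp: openin_pullback_topology)
    then have "\<forall>\<^sub>F j in sequentially. f (u j) \<in> V"
      using L unfolding limitin_def by blast
    then show "\<forall>\<^sub>F j in sequentially. u j \<in> U"
      by (rule eventually_mono) (use V(2) assms(2) in auto)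
  qed
qed

section \<open>Angles and amplitudes on the level set\<close>

lemma continuous_map_vec_lambda:
  fixes f :: "'a \<Rightarrow> 'n::finite \<Rightarrow> 'b::topological_space"
  assumes "\<And>i. continuous_map X euclidean (\<lambda>x. f x i)"
  shows "continuous_map X euclidean (\<lambda>x. \<chi> i. f x i)"
  using assms by (auto simp: continuous_map_atin intro!: vec_tendstoI)

lemma continuous_map_scaleR:
  fixes f :: "'a \<Rightarrow> 'b::real_normed_vector"
  assumes "continuous_map X euclideanreal r" "continuous_map X euclidean f"
  shows "continuous_map X euclidean (\<lambda>x. r x *\<^sub>R f x)"
  using assms by (auto simp: continuous_map_atin intro!: tendsto_scaleR)

lemma topspace_torus: "topspace (torus A) = A \<rightarrow>\<^sub>E sphere 0 1"
  by (simp add: torus_def)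

lemma compact_space_torus: "compact_space (torus A)"
  unfolding torus_def by (subst compact_space_product_topology) (auto simp: compact_space_subtopology)

definition quad_amp :: "('n::finite \<Rightarrow> real) \<Rightarrow> 'n amplitude \<Rightarrow> real" where
  "quad_amp a C = (\<Sum>j\<in>UNIV. a j * (C $ j)\<^sup>2)"

definition amp :: "'n::finite phase \<Rightarrow> 'n amplitude" where
  "amp p = (\<chi> i. norm (p $ i))"

definition direction :: "'n::finite phase \<Rightarrow> 'n amplitude" where
  "direction p = amp p /\<^sub>R norm p"

definition angles :: "'n::finite set \<Rightarrow> 'n phase \<Rightarrow> 'n \<Rightarrow> real \<times> real" where
  "angles A p = (\<lambda>i\<in>A. p $ i /\<^sub>R norm (p $ i))"

definition level_set :: "('n::finite \<Rightarrow> real) \<Rightarrow> real \<Rightarrow> 'n set \<Rightarrow> 'n phase set" where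
  "level_set a \<nu> A = {p \<in> coord_space A. \<nu> + quad a p = 0}"

definition level_cell :: "('n::finite \<Rightarrow> real) \<Rightarrow> real \<Rightarrow> 'n set \<Rightarrow> 'n phase set" where
  "level_cell a \<nu> A = {p. {i. p $ i \<noteq> 0} = A \<and> \<nu> + quad a p = 0}"

text \<open>The factor that moves the amplitude vector \<open>C\<close> onto the level set, from \<open>\<nu> + r\<^sup>2 * quad_amp a C = 0\<close>.\<close>

definition radius :: "('n::finite \<Rightarrow> real) \<Rightarrow> real \<Rightarrow> 'n amplitude \<Rightarrow> real" where
  "radius a \<nu> C = sqrt (- \<nu> / quad_amp a C)"

definition level_pt ::
  "('n::finite \<Rightarrow> real) \<Rightarrow> real \<Rightarrow> ('n \<Rightarrow> real \<times> real) \<times> 'n amplitude \<Rightarrow> 'n phase" where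
  "level_pt a \<nu> = (\<lambda>(s, C). \<chi> i. (radius a \<nu> C * C $ i) *\<^sub>R s i)"

lemma norm_amp [simp]: "norm (amp p) = norm p"
  by (simp add: amp_def norm_vec_def)

lemma quad_amp_amp: "quad_amp a (amp p) = quad a p"
  by (simp add: quad_amp_def quad_def amp_def)

lemma quad_amp_scaleR: "quad_amp a (r *\<^sub>R C) = r\<^sup>2 * quad_amp a C"
  by (simp add: quad_amp_def power_mult_distrib sum_distrib_left algebra_simps)

lemma continuous_on_quad: "continuous_on S (quad a)"
  unfolding quad_def by (intro continuous_intros)

lemma continuous_on_quad_amp: "continuous_on S (quad_amp a)"
  unfolding quad_amp_def by (intro continuous_intros)

lemma closed_level_set: "closed (level_set a \<nu> A)"
proof -
  have "closed {p. \<nu> + quad a p = 0}"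
    by (intro closed_Collect_eq continuous_intros continuous_on_quad)
  moreover have "level_set a \<nu> A = coord_space A \<inter> {p. \<nu> + quad a p = 0}"
    by (auto simp: level_set_def)
  ultimately show ?thesis using closed_coord_space closed_Int by metis
qed

context
  fixes a :: "'n::finite \<Rightarrow> real" and \<nu> :: real and S :: "'n set"
  assumes opposite: "\<And>i. i \<in> S \<Longrightarrow> a i * \<nu> < 0"
begin

lemma quad_amp_sign:
  assumes "C \<in> closed_face S"
  shows "\<nu> * quad_amp a C < 0"
proof -
  have "\<nu> * quad_amp a C = (\<Sum>j\<in>UNIV. (a j * \<nu>) * (C $ j)\<^sup>2)"
    by (simp add: quad_amp_def sum_distrib_left algebra_simps)
  also have "\<dots> = (\<Sum>j\<in>S. (a j * \<nu>) * (C $ j)\<^sup>2)"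
    using assms by (intro sum.mono_neutral_right) (auto simp: closed_face_def)
  also have "\<dots> < 0"
  proof -
    have "C \<noteq> 0" using assms by (auto simp: closed_face_def)
    then obtain j where j: "C $ j \<noteq> 0" by (auto simp: vec_eq_iff)
    then have jS: "j \<in> S" using assms by (auto simp: closed_face_def)
    have "- (a i * \<nu>) * (C $ i)\<^sup>2 \<ge> 0" if "i \<in> S" for i
      using opposite [OF that] by (intro mult_nonneg_nonneg) auto
    moreover have "- (a j * \<nu>) * (C $ j)\<^sup>2 > 0"
      using opposite [OF jS] j by (intro mult_pos_pos) auto
    ultimately have "(\<Sum>j\<in>S. - (a j * \<nu>) * (C $ j)\<^sup>2) > 0"
      by (intro sum_pos2 [OF _ jS]) auto
    then show ?thesis by (simp add: sum_negf)
  qed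
  finally show ?thesis .
qed

lemma radius_pos:
  assumes "C \<in> closed_face S"
  shows "radius a \<nu> C > 0"
proof -
  have "- \<nu> / quad_amp a C > 0"
    using quad_amp_sign [OF assms] by (auto simp: mult_less_0_iff zero_less_divide_iff divide_less_0_iff)
  then show ?thesis by (simp add: radius_def)
qed

text \<open>The angle \<open>s i\<close> is only required to be a unit vector where the amplitude \<open>C $ i\<close> is nonzero. Thus the same
  computation serves the fibre of a cell and the full torus in the construction of \<open>X_space\<close>.\<close>

lemma level_pt_props:
  assumes C: "C \<in> closed_face S" and s: "\<And>i. C $ i \<noteq> 0 \<Longrightarrow> norm (s i) = 1"
  shows "norm (level_pt a \<nu> (s, C) $ i) = radius a \<nu> C * C $ i"
    and "level_pt a \<nu> (s, C) $ i = 0 \<longleftrightarrow> C $ i = 0"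
    and "norm (level_pt a \<nu> (s, C)) = radius a \<nu> C"
    and "direction (level_pt a \<nu> (s, C)) = C"
    and "\<nu> + quad a (level_pt a \<nu> (s, C)) = 0"
    and "i \<in> A \<Longrightarrow> C $ i \<noteq> 0 \<Longrightarrow> angles A (level_pt a \<nu> (s, C)) i = s i"
proof -
  let ?p = "level_pt a \<nu> (s, C)"
  have r: "radius a \<nu> C > 0" by (rule radius_pos [OF C])
  have nn: "C $ i \<ge> 0" for i using C by (simp add: closed_face_def)
  have ni: "norm (?p $ i) = radius a \<nu> C * C $ i" for i
    using r nn [of i] s [of i] by (cases "C $ i = 0") (auto simp: level_pt_def abs_mult)
  then show "norm (?p $ i) = radius a \<nu> C * C $ i" .
  show "?p $ i = 0 \<longleftrightarrow> C $ i = 0" using ni [of i] r by (metis less_irrefl mult_eq_0_iff norm_eq_zero)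
  have amp: "amp ?p = radius a \<nu> C *\<^sub>R C" by (simp add: amp_def ni vec_eq_iff)
  then show np: "norm ?p = radius a \<nu> C"
    using C r norm_amp [of ?p] by (simp add: closed_face_def)
  show "direction ?p = C" unfolding direction_def amp np using r by simp
  have "quad a ?p = (radius a \<nu> C)\<^sup>2 * quad_amp a C"
    by (simp add: amp quad_amp_scaleR flip: quad_amp_amp)
  moreover have "(radius a \<nu> C)\<^sup>2 = - \<nu> / quad_amp a C"
    using r by (simp add: radius_def)
  moreover have "quad_amp a C \<noteq> 0" using quad_amp_sign [OF C] by auto
  ultimately show "\<nu> + quad a ?p = 0" by simp
  show "angles A ?p i = s i" if "i \<in> A" "C $ i \<noteq> 0"
    using that r s [of i] nn [of i] by (simp add: angles_def level_pt_def field_simps)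
qed

lemma level_set_nonzero: "S \<noteq> {} \<Longrightarrow> p \<in> level_set a \<nu> S \<Longrightarrow> p \<noteq> 0"
  using opposite by (fastforce simp: level_set_def quad_def)

lemma direction_level:
  assumes ne: "S \<noteq> {}" and p: "p \<in> level_set a \<nu> S"
  shows "direction p \<in> closed_face S"
    and "direction p $ i = 0 \<longleftrightarrow> p $ i = 0"
    and "radius a \<nu> (direction p) = norm p"
proof -
  have np: "norm p > 0" using level_set_nonzero [OF assms] by simp
  then show "direction p $ i = 0 \<longleftrightarrow> p $ i = 0" by (simp add: direction_def amp_def)
  show C: "direction p \<in> closed_face S"
    using np p by (auto simp: closed_face_def direction_def level_set_def coord_space_def) (simp add: amp_def)+
  have "quad_amp a (direction p) = quad a p / (norm p)\<^sup>2"
    by (simp add: direction_def quad_amp_scaleR quad_amp_amp divide_simps)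
  then have "- \<nu> / quad_amp a (direction p) = (norm p)\<^sup>2"
    using p ne opposite np by (auto simp: level_set_def add_eq_0_iff2 mult_less_0_iff)
  then show "radius a \<nu> (direction p) = norm p" by (simp add: radius_def)
qed

text \<open>Polar coordinates of a point of the level set give back the point.\<close>

lemma level_pt_direction:
  assumes ne: "S \<noteq> {}" and p: "p \<in> level_set a \<nu> S" and A: "{i. p $ i \<noteq> 0} \<subseteq> A"
  shows "level_pt a \<nu> (angles A p, direction p) = p"
proof -
  have np: "norm p > 0" using level_set_nonzero [OF ne p] by simp
  have "level_pt a \<nu> (angles A p, direction p) $ i = p $ i" for i
  proof (cases "p $ i = 0")
    case True
    then show ?thesis by (simp add: level_pt_def direction_level(2) [OF ne p])
  next
    case False
    moreover have "direction p $ i = norm (p $ i) / norm p"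
      by (simp add: direction_def amp_def divide_inverse_commute)
    ultimately show ?thesis
      using A np by (auto simp: level_pt_def direction_level(3) [OF ne p] angles_def)
  qed
  then show ?thesis by (intro vec_eq_iff [THEN iffD2] allI)
qed

lemma level_cell_subset: "A \<subseteq> S \<Longrightarrow> level_cell a \<nu> A \<subseteq> level_set a \<nu> S"
  by (auto simp: level_cell_def level_set_def coord_space_def)

lemma continuous_on_radius: "continuous_on (closed_face S) (radius a \<nu>)"
  unfolding radius_def using quad_amp_sign
  by (intro continuous_intros continuous_on_quad_amp) force

lemma continuous_map_level_pt:
  assumes "D \<subseteq> closed_face S" and D: "\<And>C i. C \<in> D \<Longrightarrow> i \<notin> A \<Longrightarrow> C $ i = 0"
  shows "continuous_map (prod_topology (torus A) (top_of_set D)) euclidean (level_pt a \<nu>)"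
  unfolding level_pt_def case_prod_unfold
proof (rule continuous_map_vec_lambda)
  fix i
  let ?X = "prod_topology (torus A) (top_of_set D)"
  have C: "continuous_map ?X (top_of_set D) snd" by (rule continuous_map_snd)
  have r: "continuous_map ?X euclideanreal (\<lambda>x. radius a \<nu> (snd x) * snd x $ i)"
  proof -
    have "continuous_on D (\<lambda>C. radius a \<nu> C * C $ i)"
      by (intro continuous_intros continuous_on_subset [OF continuous_on_radius assms(1)])
    then show ?thesis
      using continuous_map_compose [OF C, of euclideanreal "\<lambda>C. radius a \<nu> C * C $ i"]
      by (simp add: o_def)
  qed
  show "continuous_map ?X euclidean (\<lambda>x. (radius a \<nu> (snd x) * snd x $ i) *\<^sub>R fst x i)"
  proof (cases "i \<in> A")
    case True
    have "continuous_map (torus A) (top_of_set (sphere 0 1)) (\<lambda>s. s i)"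
      unfolding torus_def using True by (rule continuous_map_product_projection)
    then have "continuous_map (torus A) euclidean (\<lambda>s. s i)"
      by (simp add: continuous_map_in_subtopology)
    then have "continuous_map ?X euclidean (\<lambda>x. fst x i)"
      using continuous_map_compose [OF continuous_map_fst] by (fastforce simp: o_def)
    then show ?thesis using r by (intro continuous_map_scaleR)
  next
    case False
    then have "continuous_map ?X euclidean (\<lambda>x. 0 :: real \<times> real)" by simp
    then show ?thesis
      by (rule continuous_map_eq) (use D False in auto)
  qed
qed

text \<open>Polar coordinates: over an open face all the amplitudes with indices in \<open>A\<close> are positive, so the angles
  depend continuously on the point.\<close>

lemma homeomorphic_maps_level_cell:
  assumes A: "A \<subseteq> S" "A \<noteq> {}"
  shows "homeomorphic_maps (prod_topology (torus A) (top_of_set (open_face A)))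
    (top_of_set (level_cell a \<nu> A)) (level_pt a \<nu>) (\<lambda>p. (angles A p, direction p))"
proof -
  have sub: "open_face A \<subseteq> closed_face S"
    using A open_face_subset_closed_face_iff by blast
  have ne: "S \<noteq> {}" using A by blast
  have cell: "p \<in> level_set a \<nu> S" "{i. p $ i \<noteq> 0} = A" if "p \<in> level_cell a \<nu> A" for p
    using that level_cell_subset [OF A(1)] by (auto simp: level_cell_def)
  have in_cell: "level_pt a \<nu> (s, C) \<in> level_cell a \<nu> A"
    "angles A (level_pt a \<nu> (s, C)) = s" "direction (level_pt a \<nu> (s, C)) = C"
    if "s \<in> A \<rightarrow>\<^sub>E sphere 0 1" "C \<in> open_face A" for s C
  proof -
    have C: "C \<in> closed_face S" "C $ i \<noteq> 0 \<longleftrightarrow> i \<in> A" for i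
      using that(2) sub open_face_support [OF that(2)] by auto
    have s: "norm (s i) = 1" if "C $ i \<noteq> 0" for i
      using that C(2) \<open>s \<in> A \<rightarrow>\<^sub>E sphere 0 1\<close> by (auto simp: PiE_iff)
    show "level_pt a \<nu> (s, C) \<in> level_cell a \<nu> A"
      using level_pt_props(2,5) [OF C(1) s] C(2) by (auto simp: level_cell_def)
    show "direction (level_pt a \<nu> (s, C)) = C"
      by (rule level_pt_props(4) [OF C(1) s])
    show "angles A (level_pt a \<nu> (s, C)) = s"
    proof
      fix i show "angles A (level_pt a \<nu> (s, C)) i = s i"
        using level_pt_props(6) [OF C(1) s, where i = i and A = A] C(2) [of i] that(1)
        by (cases "i \<in> A") (auto simp: angles_def PiE_iff extensional_def)
    qed
  qed
  have "continuous_map (top_of_set (level_cell a \<nu> A)) (torus A) (angles A)"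
    unfolding torus_def continuous_map_componentwise
  proof (intro conjI ballI)
    show "angles A ` topspace (top_of_set (level_cell a \<nu> A)) \<subseteq> extensional A"
      by (auto simp: angles_def)
    fix i assume i: "i \<in> A"
    have nz: "p $ i \<noteq> 0" if "p \<in> level_cell a \<nu> A" for p
      using that i by (auto simp: level_cell_def)
    then show "continuous_map (top_of_set (level_cell a \<nu> A)) (top_of_set (sphere 0 1)) (\<lambda>p. angles A p i)"
      using i by (auto simp: angles_def continuous_map_in_subtopology intro!: continuous_intros)
  qed
  moreover have "continuous_map (top_of_set (level_cell a \<nu> A)) (top_of_set (open_face A)) direction"
  proof -
    have "direction p \<in> open_face A" if "p \<in> level_cell a \<nu> A" for p
    proof -
      have *: "direction p \<in> closed_face S" "direction p $ i = 0 \<longleftrightarrow> i \<notin> A" for i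
        using direction_level(1,2) [OF ne cell(1) [OF that]] cell(2) [OF that] by auto
      have "direction p $ i > 0" if "i \<in> A" for i
        using that *(2) [of i] *(1) unfolding closed_face_def
        by (metis (mono_tags, lifting) le_neq_trans mem_Collect_eq)
      then show ?thesis
        using * by (simp add: open_face_def closed_face_def)
    qed
    moreover have "continuous_on (level_cell a \<nu> A) direction"
      unfolding direction_def amp_def using level_set_nonzero [OF ne cell(1)]
      by (intro continuous_intros continuous_on_vec_lambda) auto
    ultimately show ?thesis by (simp add: continuous_map_in_subtopology image_subset_iff)
  qed
  ultimately have "continuous_map (top_of_set (level_cell a \<nu> A)) (prod_topology (torus A) (top_of_set (open_face A)))
      (\<lambda>p. (angles A p, direction p))"
    by (simp add: continuous_map_pairedI)
  moreover have "continuous_map (prod_topology (torus A) (top_of_set (open_face A))) (top_of_set (level_cell a \<nu> A)) (level_pt a \<nu>)"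
    unfolding continuous_map_in_subtopology
  proof
    show "continuous_map (prod_topology (torus A) (top_of_set (open_face A))) euclidean (level_pt a \<nu>)"
      by (rule continuous_map_level_pt [OF sub]) (simp add: open_face_def)
    show "level_pt a \<nu> \<in> topspace (prod_topology (torus A) (top_of_set (open_face A))) \<rightarrow> level_cell a \<nu> A"
      using in_cell(1) by (auto simp: topspace_torus)
  qed
  ultimately show ?thesis
    unfolding homeomorphic_maps_def
    using in_cell level_pt_direction [OF ne cell(1)] cell(2) by (auto simp: topspace_torus)
qed

end

section \<open>Compactness and closure of the cells of the level set\<close>

text \<open>Coefficients of one sign make \<open>quad a\<close> comparable to the squared norm. All boundedness statements rest on
  this estimate.\<close>

lemma norm_squared_le_quad:
  assumes def: "(\<forall>i\<in>S. a i > 0) \<or> (\<forall>i\<in>S. a i < 0)" and p: "p \<in> coord_space S"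
  shows "(norm p)\<^sup>2 \<le> (\<Sum>i\<in>S. 1 / \<bar>a i\<bar>) * \<bar>quad a p\<bar>"
proof -
  have "\<bar>quad a p\<bar> = \<bar>\<Sum>i\<in>S. a i * (norm (p $ i))\<^sup>2\<bar>"
    using p unfolding quad_def coord_space_def
    by (intro arg_cong [where f = abs] sum.mono_neutral_right) auto
  also have "\<dots> = (\<Sum>i\<in>S. \<bar>a i\<bar> * (norm (p $ i))\<^sup>2)"
    using def
  proof
    assume "\<forall>i\<in>S. a i > 0"
    then show ?thesis by (simp add: sum_nonneg less_imp_le)
  next
    assume neg: "\<forall>i\<in>S. a i < 0"
    then have "(\<Sum>i\<in>S. \<bar>a i\<bar> * (norm (p $ i))\<^sup>2) = - (\<Sum>i\<in>S. a i * (norm (p $ i))\<^sup>2)"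
      by (subst sum_negf [symmetric]) (intro sum.cong, auto)
    moreover have "(\<Sum>i\<in>S. a i * (norm (p $ i))\<^sup>2) \<le> 0"
      using neg by (intro sum_nonpos mult_nonpos_nonneg) (auto simp: less_imp_le)
    ultimately show ?thesis by simp
  qed
  finally have q: "\<bar>quad a p\<bar> = (\<Sum>i\<in>S. \<bar>a i\<bar> * (norm (p $ i))\<^sup>2)" .
  have "(norm p)\<^sup>2 = (\<Sum>i\<in>S. (norm (p $ i))\<^sup>2)"
    unfolding norm_vec_squared using p unfolding coord_space_def
    by (intro sum.mono_neutral_right) auto
  also have "\<dots> \<le> (\<Sum>i\<in>S. 1 / \<bar>a i\<bar> * \<bar>quad a p\<bar>)"
  proof (rule sum_mono)
    fix i assume i: "i \<in> S"
    then have "\<bar>a i\<bar> * (norm (p $ i))\<^sup>2 \<le> \<bar>quad a p\<bar>"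
      unfolding q by (intro member_le_sum) auto
    moreover have "a i \<noteq> 0" using def i by auto
    ultimately show "(norm (p $ i))\<^sup>2 \<le> 1 / \<bar>a i\<bar> * \<bar>quad a p\<bar>"
      by (simp add: field_simps)
  qed
  finally show ?thesis by (simp add: sum_distrib_right)
qed

context
  fixes a :: "'n::finite \<Rightarrow> real" and \<nu> :: real and S :: "'n set"
  assumes opposite: "\<And>i. i \<in> S \<Longrightarrow> a i * \<nu> < 0"
begin

lemma definite: "(\<forall>i\<in>S. a i > 0) \<or> (\<forall>i\<in>S. a i < 0)"
  using opposite by (cases "\<nu> > 0") (force simp: mult_less_0_iff)+

lemma quad_sign:
  assumes "p \<in> coord_space S" "p \<noteq> 0"
  shows "\<nu> * quad a p < 0"
proof -
  have "direction p \<in> closed_face S"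
    using assms by (auto simp: closed_face_def direction_def coord_space_def) (simp add: amp_def)+
  then have "\<nu> * quad_amp a (direction p) < 0"
    using quad_amp_sign opposite by blast
  then have "\<nu> * quad a p * (inverse (norm p))\<^sup>2 < 0"
    by (simp add: direction_def quad_amp_scaleR quad_amp_amp ac_simps)
  then show ?thesis by (simp add: mult_less_0_iff)
qed

lemma compact_level_set: "compact (level_set a \<nu> S)"
proof -
  have "norm p \<le> sqrt ((\<Sum>i\<in>S. 1 / \<bar>a i\<bar>) * \<bar>\<nu>\<bar>)" if "p \<in> level_set a \<nu> S" for p
    using norm_squared_le_quad [OF definite, of p] that
    by (intro real_le_rsqrt) (auto simp: level_set_def add_eq_0_iff)
  then have "bounded (level_set a \<nu> S)" by (meson boundedI)
  then show ?thesis by (simp add: compact_eq_bounded_closed closed_level_set)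
qed

lemma level_set_eq_Union:
  assumes "S \<noteq> {}"
  shows "level_set a \<nu> S = (\<Union>A\<in>{A. A \<noteq> {} \<and> A \<subseteq> S}. level_cell a \<nu> A)"
proof (intro equalityI subsetI)
  fix p assume p: "p \<in> level_set a \<nu> S"
  let ?A = "{i. p $ i \<noteq> 0}"
  have "p \<noteq> 0" using level_set_nonzero opposite assms p by blast
  then have "?A \<noteq> {}" by (auto simp: vec_eq_iff)
  moreover have "?A \<subseteq> S" "p \<in> level_cell a \<nu> ?A"
    using p by (auto simp: level_set_def coord_space_def level_cell_def)
  ultimately show "p \<in> (\<Union>A\<in>{A. A \<noteq> {} \<and> A \<subseteq> S}. level_cell a \<nu> A)"
    by (intro UN_I [of ?A]) simp_all
next
  fix p assume "p \<in> (\<Union>A\<in>{A. A \<noteq> {} \<and> A \<subseteq> S}. level_cell a \<nu> A)"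
  then show "p \<in> level_set a \<nu> S" using level_cell_subset opposite by blast
qed

text \<open>The vanishing coordinates are perturbed as in the closure of the open cell, and the perturbed point is then
  scaled back onto the level set; the scaling factors tend to \<open>1\<close>.\<close>

lemma closure_level_cell:
  assumes "S \<noteq> {}"
  shows "closure (level_cell a \<nu> S) = level_set a \<nu> S"
proof
  show "closure (level_cell a \<nu> S) \<subseteq> level_set a \<nu> S"
    using level_cell_subset opposite by (intro closure_minimal closed_level_set) blast
  show "level_set a \<nu> S \<subseteq> closure (level_cell a \<nu> S)"
  proof
    fix p assume p: "p \<in> level_set a \<nu> S"
    define u :: "'n phase" where "u = (\<chi> i. if i \<in> S \<and> p $ i = 0 then (1, 0) else 0)"
    define b where "b n = p + (1 / (real n + 1)) *\<^sub>R u" for n :: nat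
    have supp: "{i. b n $ i \<noteq> 0} = S" for n
      using p by (auto simp: level_set_def coord_space_def b_def u_def zero_prod_def split: if_splits)
    then have "b n \<noteq> 0" "b n \<in> coord_space S" for n
      using assms by (metis (mono_tags, lifting) Collect_empty_eq zero_index)
        (use supp [of n] in \<open>auto simp: coord_space_def\<close>)
    then have sign: "\<nu> * quad a (b n) < 0" for n by (intro quad_sign)
    define r where "r n = sqrt (- \<nu> / quad a (b n))" for n
    have rpos: "- \<nu> / quad a (b n) > 0" for n
      using sign [of n] by (auto simp: mult_less_0_iff divide_less_0_iff)
    have "r n *\<^sub>R b n \<in> level_cell a \<nu> S" for n
    proof -
      have "(r n)\<^sup>2 = - \<nu> / quad a (b n)"
        using rpos [of n] unfolding r_def by (intro real_sqrt_pow2) simp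
      moreover have "r n > 0" unfolding r_def using rpos [of n] by (rule real_sqrt_gt_zero)
      moreover have "quad a (b n) \<noteq> 0" using sign [of n] by auto
      ultimately show ?thesis
        using supp [of n] by (simp add: level_cell_def quad_scaleR)
    qed
    moreover have "(\<lambda>n. r n *\<^sub>R b n) \<longlonglongrightarrow> p"
    proof -
      have "(\<lambda>n. 1 / (real n + 1)) \<longlonglongrightarrow> 0"
        using LIMSEQ_inverse_real_of_nat by (simp add: inverse_eq_divide add.commute)
      then have "b \<longlonglongrightarrow> p + 0 *\<^sub>R u" unfolding b_def by (intro tendsto_intros)
      then have b: "b \<longlonglongrightarrow> p" by simp
      have \<nu>: "\<nu> \<noteq> 0" "quad a p = - \<nu>" using opposite assms p by (auto simp: level_set_def)
      have "(\<lambda>n. quad a (b n)) \<longlonglongrightarrow> quad a p"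
        using continuous_on_tendsto_compose [OF continuous_on_quad b, of UNIV a] by simp
      then have "r \<longlonglongrightarrow> sqrt (- \<nu> / quad a p)"
        unfolding r_def using \<nu> by (intro tendsto_intros) auto
      then have "r \<longlonglongrightarrow> 1" using \<nu> by simp
      then show ?thesis using tendsto_scaleR [OF _ b, of r 1] by simp
    qed
    ultimately show "p \<in> closure (level_cell a \<nu> S)"
      unfolding closure_sequential by (intro exI [of _ "\<lambda>n. r n *\<^sub>R b n"]) simp
  qed
qed

end

lemma level_cell_disjoint: "A \<noteq> B \<Longrightarrow> level_cell a \<nu> A \<inter> level_cell a \<nu> B = {}"
  by (auto simp: level_cell_def)

section \<open>The spherical simplex as a regular CW complex\<close>

text \<open>The cell \<open>(l, \<gamma>)\<close> has the vertices \<open>\<gamma> 1, ..., \<gamma> (l + 1)\<close>, whereas \<open>face_map\<close> numbers vertices from \<open>0\<close>.\<close>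

definition attach :: "nat \<times> (nat \<Rightarrow> 'n::finite) \<Rightarrow> (nat \<Rightarrow> real) \<Rightarrow> 'n amplitude" where
  "attach c = face_map (fst c) (\<lambda>i. snd c (Suc i))"

context
  fixes \<sigma> :: "nat \<Rightarrow> 'n::{finite,linorder}" and k :: nat and S :: "'n set"
  assumes \<sigma>: "\<sigma> \<in> perms_S k" and k: "0 < k" "k \<le> CARD('n)"
  defines "S \<equiv> \<sigma> ` {1..k}"
begin

lemma labels:
  assumes "c \<in> cell_index k \<sigma>"
  shows "circle_labels c \<noteq> {}" "circle_labels c \<subseteq> S"
  using circle_labels_image [OF \<sigma> k] assms unfolding S_def by blast+

lemma labels_surj:
  assumes "A \<noteq> {}" "A \<subseteq> S"
  obtains c where "c \<in> cell_index k \<sigma>" "circle_labels c = A"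
proof -
  have "A \<in> circle_labels ` cell_index k \<sigma>"
    unfolding circle_labels_image [OF \<sigma> k] using assms by (simp add: S_def)
  then show thesis using that by auto
qed

lemma sphere_cell_eq:
  assumes "c \<in> cell_index k \<sigma>"
  shows "sphere_cell c = open_face (circle_labels c)"
proof (cases c)
  case (Pair l \<gamma>)
  then have "l < k" "\<gamma> \<in> perms_S (l + 1)" using assms cell_index_iff [OF \<sigma> k] by blast+
  then show ?thesis
    using k pos_sphere_eq_open_face [of \<gamma> "l + 1"]
    unfolding sphere_cell_def circle_labels_def Pair by simp
qed

lemma closure_pos_sphere_eq: "closure (pos_sphere k \<sigma>) = closed_face S"
  using k closure_open_face [of S] by (simp add: S_def pos_sphere_eq_open_face [OF \<sigma> k(2)])

lemma closure_of_sphere_cell: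
  assumes "c \<in> cell_index k \<sigma>"
  shows "top_of_set (closure (pos_sphere k \<sigma>)) closure_of sphere_cell c = closed_face (circle_labels c)"
proof -
  have "open_face (circle_labels c) \<subseteq> closed_face S" "closed_face (circle_labels c) \<subseteq> closed_face S"
    using closed_face_mono [OF labels(2) [OF assms]] open_face_subset by blast+
  then show ?thesis
    unfolding closure_pos_sphere_eq sphere_cell_eq [OF assms] closure_of_subtopology
    using closure_open_face [OF labels(1) [OF assms]]
    by (simp add: inf.absorb2)
qed

lemma sphere_cell_subset_closure_iff:
  assumes "c \<in> cell_index k \<sigma>" "c' \<in> cell_index k \<sigma>"
  shows "sphere_cell c' \<subseteq> top_of_set (closure (pos_sphere k \<sigma>)) closure_of sphere_cell c \<longleftrightarrow>
    circle_labels c' \<subseteq> circle_labels c"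
  unfolding closure_of_sphere_cell [OF assms(1)] sphere_cell_eq [OF assms(2)]
  by (rule open_face_subset_closed_face_iff [OF labels(1) [OF assms(2)]])

lemma attach_face:
  assumes "c \<in> cell_index k \<sigma>"
  shows "homeomorphic_map (closed_unit_ball (fst c)) (top_of_set (closed_face (circle_labels c))) (attach c)"
    and "attach c ` open_ball_set (fst c) = open_face (circle_labels c)"
    and "y \<in> ball_set (fst c) \<Longrightarrow> attach c y \<in> closed_face (circle_labels c)"
    and "y \<in> ball_set (fst c) \<Longrightarrow> attach c y \<in> open_face (circle_labels c) \<longleftrightarrow> y \<in> open_ball_set (fst c)"
proof -
  obtain l \<gamma> where c: "c = (l, \<gamma>)" by (cases c)
  then have "l < k" "\<gamma> \<in> perms_S (l + 1)" using assms cell_index_iff [OF \<sigma> k] by blast+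
  then have "inj_on \<gamma> {1..l + 1}" using k by (intro perms_S_inj_on [of _ "l + 1"]) auto
  then have inj: "inj_on (\<lambda>i. \<gamma> (Suc i)) {..l}" by (fastforce simp: inj_on_def)
  have "{1..l + 1} = Suc ` {..l}"
    by (simp add: image_Suc_atMost)
  then have im: "(\<lambda>i. \<gamma> (Suc i)) ` {..l} = circle_labels c"
    by (simp add: circle_labels_def c image_image)
  show "homeomorphic_map (closed_unit_ball (fst c)) (top_of_set (closed_face (circle_labels c))) (attach c)"
    "attach c ` open_ball_set (fst c) = open_face (circle_labels c)"
    "y \<in> ball_set (fst c) \<Longrightarrow> attach c y \<in> closed_face (circle_labels c)"
    "y \<in> ball_set (fst c) \<Longrightarrow> attach c y \<in> open_face (circle_labels c) \<longleftrightarrow> y \<in> open_ball_set (fst c)"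
    using homeomorphic_map_face_map [OF inj] face_map_open_ball [OF inj] face_map_in [OF inj]
    unfolding im by (simp_all add: attach_def c open_ball_set_eq)
qed

text \<open>A boundary point of the ball has a vanishing barycentric coordinate, so it is mapped to an open face with
  fewer vertices, that is, of lower dimension.\<close>

lemma regular_CW_complex_faces:
  "regular_CW_complex (top_of_set (closure (pos_sphere k \<sigma>))) (cell_index k \<sigma>) sphere_cell fst attach"
proof
  show "Hausdorff_space (top_of_set (closure (pos_sphere k \<sigma>)))"
    by (simp add: Hausdorff_space_subtopology)
  show "finite (cell_index k \<sigma>)"
    by (rule finite_imageD [OF _ circle_labels_inj_on [OF \<sigma> k]]) simp
  show "disjoint_family_on sphere_cell (cell_index k \<sigma>)"
  proof (unfold disjoint_family_on_def, intro ballI impI)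
    fix c d assume *: "c \<in> cell_index k \<sigma>" "d \<in> cell_index k \<sigma>" "c \<noteq> d"
    then have "circle_labels c \<noteq> circle_labels d"
      using circle_labels_inj_on [OF \<sigma> k] by (auto dest: inj_onD)
    then show "sphere_cell c \<inter> sphere_cell d = {}"
      using * open_face_support by (metis disjoint_iff sphere_cell_eq)
  qed
  have "(\<Union>c\<in>cell_index k \<sigma>. sphere_cell c) = (\<Union>c\<in>cell_index k \<sigma>. open_face (circle_labels c))"
    by (simp add: sphere_cell_eq)
  also have "\<dots> = (\<Union>A\<in>{A. A \<noteq> {} \<and> A \<subseteq> S}. open_face A)"
    unfolding S_def circle_labels_image [OF \<sigma> k, symmetric] by simp
  finally show "(\<Union>c\<in>cell_index k \<sigma>. sphere_cell c) = topspace (top_of_set (closure (pos_sphere k \<sigma>)))"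
    by (simp add: closure_pos_sphere_eq flip: closed_face_eq_Union)
  fix c assume c: "c \<in> cell_index k \<sigma>"
  have "closed_face (circle_labels c) \<subseteq> closed_face S"
    by (rule closed_face_mono [OF labels(2) [OF c]])
  then have "subtopology (top_of_set (closed_face S)) (closed_face (circle_labels c)) =
      top_of_set (closed_face (circle_labels c))"
    by (simp add: subtopology_subtopology inf.absorb2)
  then show "homeomorphic_map (closed_unit_ball (fst c))
      (subtopology (top_of_set (closure (pos_sphere k \<sigma>)))
         (top_of_set (closure (pos_sphere k \<sigma>)) closure_of sphere_cell c)) (attach c)"
    unfolding closure_of_sphere_cell [OF c] unfolding closure_pos_sphere_eq
    using attach_face(1) [OF c] by simp
  show "attach c ` open_ball_set (fst c) = sphere_cell c"
    by (simp add: attach_face(2) c sphere_cell_eq)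
  show "attach c ` (topspace (closed_unit_ball (fst c)) - open_ball_set (fst c))
      \<subseteq> (\<Union>c'\<in>{c' \<in> cell_index k \<sigma>. fst c' < fst c}. sphere_cell c')"
  proof (intro subsetI, elim imageE)
    fix x y assume x: "x = attach c y" and y: "y \<in> topspace (closed_unit_ball (fst c)) - open_ball_set (fst c)"
    then have "x \<in> closed_face (circle_labels c)" "x \<notin> open_face (circle_labels c)"
      using attach_face(3,4) [OF c, of y] by auto
    then obtain A where A: "A \<noteq> {}" "A \<subset> circle_labels c" "x \<in> open_face A"
      by (auto simp: closed_face_eq_Union)
    then obtain c' where c': "c' \<in> cell_index k \<sigma>" "circle_labels c' = A"
      using labels_surj labels(2) [OF c] by (metis order.trans psubset_imp_subset)
    have "card A < card (circle_labels c)" using A(2) by (intro psubset_card_mono) auto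
    then have "fst c' < fst c"
      using card_circle_labels [OF \<sigma> k] c c' by fastforce
    then show "x \<in> (\<Union>c'\<in>{c' \<in> cell_index k \<sigma>. fst c' < fst c}. sphere_cell c')"
      using c' A(3) sphere_cell_eq by blast
  qed
qed

end

section \<open>The toral CW structure of the level set\<close>

context
  fixes \<sigma> :: "nat \<Rightarrow> 'n::{finite,linorder}" and k :: nat and S :: "'n set"
    and a :: "'n \<Rightarrow> real" and \<nu> :: real
  assumes \<sigma>: "\<sigma> \<in> perms_S k" and k: "0 < k" "k \<le> CARD('n)"
  defines "S \<equiv> \<sigma> ` {1..k}"
  assumes opposite: "\<And>i. i \<in> S \<Longrightarrow> a i * \<nu> < 0"
begin

lemmas lab = labels [OF \<sigma> k, folded S_def]
  and lab_surj = labels_surj [OF \<sigma> k, folded S_def]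
  and lab_sphere_cell = sphere_cell_eq [OF \<sigma> k]
  and lab_closure_iff = sphere_cell_subset_closure_iff [OF \<sigma> k]
  and lab_attach = attach_face [OF \<sigma> k]
  and lab_card = card_circle_labels [OF \<sigma> k]
  and lab_inj = circle_labels_inj_on [OF \<sigma> k]
  and lab_base = closure_pos_sphere_eq [OF \<sigma> k, folded S_def]

lemma S_nonempty: "S \<noteq> {}"
  using k by (simp add: S_def)

lemmas pt_props = level_pt_props [where S = S and a = a and \<nu> = \<nu>, OF opposite]

abbreviation (input) base :: "'n amplitude topology" where
  "base \<equiv> top_of_set (closure (pos_sphere k \<sigma>))"

abbreviation (input) cells :: "(nat \<times> (nat \<Rightarrow> 'n)) set" where
  "cells \<equiv> cell_index k \<sigma>"

abbreviation piece :: "nat \<times> (nat \<Rightarrow> 'n) \<Rightarrow> nat \<times> (nat \<Rightarrow> 'n) \<Rightarrow> (('n \<Rightarrow> real \<times> real) \<times> (nat \<Rightarrow> real)) set" where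
  "piece \<equiv> toral_piece sphere_cell fst attach circle_labels"

definition toral_attach_map :: "nat \<times> (nat \<Rightarrow> 'n) \<Rightarrow> ('n \<Rightarrow> real \<times> real) \<times> (nat \<Rightarrow> real) \<Rightarrow> 'n phase" where
  "toral_attach_map c = (\<lambda>(s, y). level_pt a \<nu> (s, attach c y))"

definition faces :: "nat \<times> (nat \<Rightarrow> 'n) \<Rightarrow> (nat \<times> (nat \<Rightarrow> 'n)) set" where
  "faces c = {c' \<in> cells. circle_labels c' \<subseteq> circle_labels c}"

definition closed_piece :: "nat \<times> (nat \<Rightarrow> 'n) \<Rightarrow> (('n \<Rightarrow> real \<times> real) \<times> (nat \<Rightarrow> real)) set" where
  "closed_piece c = (\<Union>c'\<in>faces c. piece c c')"

text \<open>On a single piece the attaching map is the product of the identity and \<open>attach c\<close>, followed by polar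
  coordinates.\<close>

lemma homeomorphic_map_piece:
  assumes c: "c \<in> cells" and c': "c' \<in> faces c"
  shows "homeomorphic_map
      (prod_topology (torus (circle_labels c')) (subtopology (closed_unit_ball (fst c)) {y. attach c y \<in> sphere_cell c'}))
      (top_of_set (level_cell a \<nu> (circle_labels c'))) (toral_attach_map c)"
proof -
  let ?A = "circle_labels c'"
  have c'': "c' \<in> cells" "?A \<subseteq> circle_labels c" using c' by (auto simp: faces_def)
  have "homeomorphic_map (subtopology (closed_unit_ball (fst c)) {y. attach c y \<in> open_face ?A})
      (subtopology (top_of_set (closed_face (circle_labels c))) (open_face ?A)) (attach c)"
    by (rule homeomorphic_map_subtopologies_alt [OF lab_attach(1) [OF c]]) simp
  moreover have "open_face ?A \<subseteq> closed_face (circle_labels c)"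
    using open_face_subset closed_face_mono [OF c''(2)] by blast
  then have "subtopology (top_of_set (closed_face (circle_labels c))) (open_face ?A) = top_of_set (open_face ?A)"
    by (simp add: subtopology_subtopology inf.absorb2)
  ultimately obtain h where h: "homeomorphic_maps (subtopology (closed_unit_ball (fst c)) {y. attach c y \<in> open_face ?A})
      (top_of_set (open_face ?A)) (attach c) h"
    by (auto simp: homeomorphic_map_maps)
  moreover have "homeomorphic_maps (torus ?A) (torus ?A) id id" by (simp add: homeomorphic_maps_id)
  ultimately have "homeomorphic_map
      (prod_topology (torus ?A) (subtopology (closed_unit_ball (fst c)) {y. attach c y \<in> open_face ?A}))
      (prod_topology (torus ?A) (top_of_set (open_face ?A))) (\<lambda>(s, y). (id s, attach c y))"
    using homeomorphic_maps_prod homeomorphic_map_maps by blast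
  moreover have "homeomorphic_map (prod_topology (torus ?A) (top_of_set (open_face ?A)))
      (top_of_set (level_cell a \<nu> ?A)) (level_pt a \<nu>)"
    using homeomorphic_maps_level_cell [of S a \<nu> ?A] opposite lab [OF c''(1)] homeomorphic_maps_imp_map by blast
  ultimately have "homeomorphic_map
      (prod_topology (torus ?A) (subtopology (closed_unit_ball (fst c)) {y. attach c y \<in> open_face ?A}))
      (top_of_set (level_cell a \<nu> ?A)) (level_pt a \<nu> \<circ> (\<lambda>(s, y). (id s, attach c y)))"
    by (rule homeomorphic_map_compose)
  moreover have "level_pt a \<nu> \<circ> (\<lambda>(s, y). (id s, attach c y)) = toral_attach_map c"
    by (auto simp: toral_attach_map_def)
  ultimately show ?thesis by (simp add: lab_sphere_cell [OF c''(1)])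
qed

lemma topspace_piece:
  "topspace (prod_topology (torus (circle_labels c')) (subtopology (closed_unit_ball (fst c)) {y. attach c y \<in> sphere_cell c'}))
    = piece c c'"
  by (auto simp: toral_piece_def)

lemma piece_image:
  assumes "c \<in> cells" "c' \<in> faces c"
  shows "toral_attach_map c ` piece c c' = level_cell a \<nu> (circle_labels c')" "inj_on (toral_attach_map c) (piece c c')"
  using homeomorphic_imp_surjective_map [OF homeomorphic_map_piece [OF assms]]
    homeomorphic_imp_injective_map [OF homeomorphic_map_piece [OF assms]]
  unfolding topspace_piece by simp_all

lemma closed_piece_image:
  assumes c: "c \<in> cells"
  shows "toral_attach_map c ` closed_piece c = level_set a \<nu> (circle_labels c)"
proof -
  have "circle_labels ` faces c = {A. A \<noteq> {} \<and> A \<subseteq> circle_labels c}"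
  proof (intro equalityI subsetI)
    fix A assume "A \<in> {A. A \<noteq> {} \<and> A \<subseteq> circle_labels c}"
    moreover from this obtain c' where "c' \<in> cells" "circle_labels c' = A"
      using lab_surj lab(2) [OF c] by (metis (mono_tags, lifting) mem_Collect_eq subset_trans)
    ultimately show "A \<in> circle_labels ` faces c" by (auto simp: faces_def)
  qed (use lab in \<open>auto simp: faces_def\<close>)
  moreover have "toral_attach_map c ` closed_piece c = (\<Union>A\<in>circle_labels ` faces c. level_cell a \<nu> A)"
    by (simp add: closed_piece_def image_UN piece_image [OF c])
  moreover have "level_set a \<nu> (circle_labels c) = (\<Union>A\<in>{A. A \<noteq> {} \<and> A \<subseteq> circle_labels c}. level_cell a \<nu> A)"
    using level_set_eq_Union [of "circle_labels c" a \<nu>] opposite lab [OF c] by blast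
  ultimately show ?thesis by simp
qed

text \<open>Points of different pieces have images with different supports.\<close>

lemma closed_piece_inj:
  assumes c: "c \<in> cells"
  shows "inj_on (toral_attach_map c) (closed_piece c)"
proof (rule inj_onI)
  fix p q assume p: "p \<in> closed_piece c" and q: "q \<in> closed_piece c" and eq: "toral_attach_map c p = toral_attach_map c q"
  obtain c1 c2 where c1: "c1 \<in> faces c" "p \<in> piece c c1" and c2: "c2 \<in> faces c" "q \<in> piece c c2"
    using p q by (auto simp: closed_piece_def)
  have "toral_attach_map c p \<in> level_cell a \<nu> (circle_labels c1)" "toral_attach_map c q \<in> level_cell a \<nu> (circle_labels c2)"
    using piece_image(1) [OF c] c1 c2 by blast+
  then have "circle_labels c1 = circle_labels c2" using eq by (auto simp: level_cell_def)
  then have "c1 = c2" using lab_inj c1 c2 by (auto simp: faces_def dest: inj_onD)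
  then show "p = q" using piece_image(2) [OF c c1(1)] c1 c2 eq by (auto dest: inj_onD)
qed

text \<open>The closure of torus times ball that belongs to the cell \<open>c\<close>. Its pieces have tori of different dimensions,
  so the topology is defined by transport: it is the one that makes the attaching map a homeomorphism onto the
  closed toral cell in the level set.\<close>

definition toral_closure_space :: "nat \<times> (nat \<Rightarrow> 'n) \<Rightarrow> (('n \<Rightarrow> real \<times> real) \<times> (nat \<Rightarrow> real)) topology" where
  "toral_closure_space c = pullback_topology (closed_piece c) (toral_attach_map c) euclidean"

lemma homeomorphic_map_toral_attach_map:
  assumes c: "c \<in> cells"
  shows "homeomorphic_map (toral_closure_space c) (top_of_set (level_set a \<nu> (circle_labels c))) (toral_attach_map c)"
  using homeomorphic_map_pullback_topology [OF closed_piece_inj [OF c], of euclidean]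
  by (simp add: toral_closure_space_def closed_piece_image [OF c])

lemma topspace_toral_closure_space [simp]: "topspace (toral_closure_space c) = closed_piece c"
  by (simp add: toral_closure_space_def topspace_pullback_topology)

text \<open>Coordinates that survive in the limit converge because amplitude and angle do. The others are bounded in
  norm by an amplitude that tends to zero.\<close>

lemma toral_attach_map_limit:
  assumes c: "c \<in> cells" and c1: "c1 \<in> faces c" and c2: "c2 \<in> faces c"
    and u: "range (\<lambda>j::nat. (s j, x j)) \<subseteq> piece c c1" and q: "(t, y) \<in> piece c c2"
    and x: "limitin (closed_unit_ball (fst c)) x y sequentially"
    and s: "\<And>i. i \<in> circle_labels c2 \<Longrightarrow> (\<lambda>j. s j i) \<longlonglongrightarrow> t i"
  shows "(\<lambda>j. toral_attach_map c (s j, x j)) \<longlonglongrightarrow> toral_attach_map c (t, y)"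
proof -
  have sub: "closed_face (circle_labels c) \<subseteq> closed_face S"
    by (rule closed_face_mono [OF lab(2) [OF c]])
  have att: "continuous_map (closed_unit_ball (fst c)) (top_of_set (closed_face (circle_labels c))) (attach c)"
    using lab_attach(1) [OF c] homeomorphic_imp_continuous_map by blast
  have "limitin (top_of_set (closed_face (circle_labels c))) (attach c \<circ> x) (attach c y) sequentially"
    by (rule continuous_map_limit [OF att x])
  then have lim: "(\<lambda>j. attach c (x j)) \<longlonglongrightarrow> attach c y"
    by (simp add: limitin_subtopology o_def)
  have x_in: "attach c (x j) \<in> open_face (circle_labels c1)" and s_in: "s j \<in> topspace (torus (circle_labels c1))" for j
    using u c1 by (auto simp: toral_piece_def faces_def lab_sphere_cell image_subset_iff)
  have y_in: "attach c y \<in> open_face (circle_labels c2)"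
    using q c2 by (auto simp: toral_piece_def faces_def lab_sphere_cell)
  have f_in: "C \<in> closed_face S" if "C \<in> open_face (circle_labels c')" "c' \<in> faces c" for C c'
  proof -
    have "C \<in> closed_face (circle_labels c')" using that(1) open_face_subset by blast
    then show ?thesis
      using closed_face_mono [of "circle_labels c'" "circle_labels c"] sub that(2) by (auto simp: faces_def)
  qed
  have "(\<lambda>j. radius a \<nu> (attach c (x j))) \<longlonglongrightarrow> radius a \<nu> (attach c y)"
    by (rule continuous_on_tendsto_compose [OF continuous_on_radius [OF opposite] lim])
       (use f_in [OF x_in c1] f_in [OF y_in c2] in \<open>auto intro: always_eventually\<close>)
  then have rC: "(\<lambda>j. radius a \<nu> (attach c (x j)) * attach c (x j) $ i) \<longlonglongrightarrow> radius a \<nu> (attach c y) * attach c y $ i" for i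
    using lim by (intro tendsto_intros)
  have "(\<lambda>j. (radius a \<nu> (attach c (x j)) * attach c (x j) $ i) *\<^sub>R s j i) \<longlonglongrightarrow>
      (radius a \<nu> (attach c y) * attach c y $ i) *\<^sub>R t i" for i
  proof (cases "i \<in> circle_labels c2")
    case True
    then show ?thesis using rC s by (intro tendsto_scaleR) auto
  next
    case False
    \<comment> \<open>The amplitude of a collapsing circle tends to zero, whatever its angle does.\<close>
    then have y0: "attach c y $ i = 0" using y_in by (simp add: open_face_def)
    have "norm ((radius a \<nu> (attach c (x j)) * attach c (x j) $ i) *\<^sub>R s j i)
        \<le> norm (radius a \<nu> (attach c (x j)) * attach c (x j) $ i)" for j
    proof (cases "i \<in> circle_labels c1")
      case True
      then have "norm (s j i) = 1" using s_in [of j] by (auto simp: topspace_torus PiE_iff)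
      then show ?thesis by simp
    next
      case False
      then show ?thesis using x_in [of j] by (simp add: open_face_def)
    qed
    moreover have "(\<lambda>j. radius a \<nu> (attach c (x j)) * attach c (x j) $ i) \<longlonglongrightarrow> 0"
      using rC [of i] y0 by simp
    ultimately have "(\<lambda>j. (radius a \<nu> (attach c (x j)) * attach c (x j) $ i) *\<^sub>R s j i) \<longlonglongrightarrow> 0"
      by (metis (no_types, lifting) Lim_null_comparison eventually_sequentiallyI tendsto_norm_zero)
    then show ?thesis using y0 by simp
  qed
  then show ?thesis
    unfolding toral_attach_map_def level_pt_def by (auto intro!: vec_tendstoI)
qed

text \<open>Each requirement is transported to the level set. Being a nonzero coordinate is an open condition: this
  makes the top piece open and forces the support of a limit to lie in the supports of the sequence, which
  excludes convergence to another piece of equal or higher dimension.\<close>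

lemma toral_closure_level:
  assumes c: "c \<in> cells"
  shows "toral_closure base cells sphere_cell fst attach
    circle_labels c (toral_closure_space c)"
proof -
  let ?Y = "toral_closure_space c" and ?f = "toral_attach_map c"
  have F: "{c' \<in> cells. sphere_cell c' \<subseteq> base closure_of sphere_cell c} = faces c"
    using lab_closure_iff [OF c] by (auto simp: faces_def)
  have cc: "c \<in> faces c" using c by (simp add: faces_def)
  have sub: "piece c c' \<subseteq> closed_piece c" if "c' \<in> faces c" for c'
    using that by (auto simp: closed_piece_def)
  note hom = homeomorphic_map_toral_attach_map [OF c]
  have lab_op: "\<And>i. i \<in> circle_labels c \<Longrightarrow> a i * \<nu> < 0" using lab(2) [OF c] opposite by blast
  have metr: "metrizable_space ?Y"
    using homeomorphic_metrizable_space [OF homeomorphic_map_imp_homeomorphic_space [OF hom]]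
      metrizable_space_subtopology metrizable_space_euclidean by blast
  have subtop: "subtopology ?Y (piece c c') =
      prod_topology (torus (circle_labels c')) (subtopology (closed_unit_ball (fst c)) {y. attach c y \<in> sphere_cell c'})"
    if c': "c' \<in> faces c" for c'
  proof -
    let ?W = "prod_topology (torus (circle_labels c')) (subtopology (closed_unit_ball (fst c)) {y. attach c y \<in> sphere_cell c'})"
    have "homeomorphic_map ?W (subtopology euclidean (?f ` topspace ?W)) ?f"
      using homeomorphic_map_piece [OF c c'] unfolding topspace_piece piece_image(1) [OF c c'] .
    then have "?W = pullback_topology (piece c c') ?f euclidean"
      using homeomorphic_map_imp_eq_pullback_topology topspace_piece by metis
    then show ?thesis
      by (simp add: toral_closure_space_def subtopology_pullback_topology [OF sub [OF c']])
  qed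
  have piece_iff: "q \<in> piece c c' \<longleftrightarrow> {i. ?f q $ i \<noteq> 0} = circle_labels c'" if q: "q \<in> closed_piece c" and c': "c' \<in> faces c" for q c'
  proof
    assume "q \<in> piece c c'"
    then show "{i. ?f q $ i \<noteq> 0} = circle_labels c'"
      using piece_image(1) [OF c c'] by (fastforce simp: level_cell_def)
  next
    assume L: "{i. ?f q $ i \<noteq> 0} = circle_labels c'"
    obtain c1 where c1: "c1 \<in> faces c" "q \<in> piece c c1"
      using q unfolding closed_piece_def by blast
    then have "circle_labels c1 = circle_labels c'"
      using piece_image(1) [OF c c1(1)] L by (fastforce simp: level_cell_def)
    then have "c1 = c'" using lab_inj c1 c' by (auto simp: faces_def dest: inj_onD)
    then show "q \<in> piece c c'" using c1 by simp
  qed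
  have op: "openin ?Y (piece c c)"
  proof -
    let ?U = "(\<Inter>i\<in>circle_labels c. {p :: 'n phase. p $ i \<noteq> 0})"
    have "open ?U" by (intro open_INT finite ballI open_Collect_neq continuous_intros)
    moreover have "piece c c = ?f -` ?U \<inter> closed_piece c"
    proof -
      have "q \<in> piece c c \<longleftrightarrow> ?f q \<in> ?U" if "q \<in> closed_piece c" for q
      proof -
        have "?f q \<in> level_set a \<nu> (circle_labels c)" using closed_piece_image [OF c] that by blast
        then have "{i. ?f q $ i \<noteq> 0} \<subseteq> circle_labels c" by (auto simp: level_set_def coord_space_def)
        then show ?thesis unfolding piece_iff [OF that cc] by auto
      qed
      then show ?thesis using sub [OF cc] by blast
    qed
    ultimately show ?thesis
      by (auto simp: toral_closure_space_def openin_pullback_topology)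
  qed
  have dense: "?Y closure_of (piece c c) = topspace ?Y"
  proof -
    have "?f ` (?Y closure_of piece c c) = top_of_set (level_set a \<nu> (circle_labels c)) closure_of (?f ` piece c c)"
      using homeomorphic_map_closure_of [OF hom] sub [OF cc] by simp
    also have "\<dots> = level_set a \<nu> (circle_labels c)"
    proof -
      have "closure (level_cell a \<nu> (circle_labels c)) = level_set a \<nu> (circle_labels c)"
        using closure_level_cell [OF lab_op lab(1) [OF c]] .
      moreover have "level_cell a \<nu> (circle_labels c) \<subseteq> level_set a \<nu> (circle_labels c)"
        using level_cell_subset lab_op by blast
      ultimately show ?thesis
        unfolding piece_image(1) [OF c cc] closure_of_subtopology by (simp add: inf.absorb2)
    qed
    also have "\<dots> = ?f ` closed_piece c" by (simp add: closed_piece_image [OF c])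
    finally have "?f ` (?Y closure_of piece c c) = ?f ` closed_piece c" .
    moreover have "?Y closure_of piece c c \<subseteq> closed_piece c"
      using closure_of_subset_topspace [of ?Y] by simp
    ultimately show ?thesis
      using closed_piece_inj [OF c] by (simp add: inj_on_image_eq_iff)
  qed
  have comp: "compact_space ?Y"
  proof -
    have "compact (level_set a \<nu> (circle_labels c))" using compact_level_set lab_op by blast
    then have "compact_space (top_of_set (level_set a \<nu> (circle_labels c)))"
      by (simp add: compact_space_subtopology)
    then show ?thesis
      using homeomorphic_compact_space homeomorphic_map_imp_homeomorphic_space [OF hom] by blast
  qed
  have nolim: "\<not> limitin ?Y u q sequentially"
    if *: "c1 \<in> faces c" "c2 \<in> faces c" "c1 \<noteq> c2" "toral_dim fst circle_labels c1 \<le> toral_dim fst circle_labels c2"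
      "range u \<subseteq> piece c c1" "q \<in> piece c c2" for c1 c2 u q
  proof
    assume "limitin ?Y u q sequentially"
    moreover have uq: "range u \<subseteq> closed_piece c" "q \<in> closed_piece c" using * sub by blast+
    ultimately have lim: "(\<lambda>j. ?f (u j)) \<longlonglongrightarrow> ?f q"
      by (simp add: toral_closure_space_def limitin_pullback_topology)
    have "circle_labels c2 \<subseteq> circle_labels c1"
    proof
      fix i assume "i \<in> circle_labels c2"
      then have "?f q $ i \<noteq> 0" using piece_iff [OF uq(2) *(2)] *(6) by auto
      moreover have "(\<lambda>j. ?f (u j) $ i) \<longlonglongrightarrow> ?f q $ i" using lim by (rule tendsto_vec_nth)
      ultimately have "\<forall>\<^sub>F j in sequentially. ?f (u j) $ i \<noteq> 0" by (intro tendsto_imp_eventually_ne)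
      then obtain j where "?f (u j) $ i \<noteq> 0" by (auto simp: eventually_sequentially)
      moreover have "u j \<in> closed_piece c" "u j \<in> piece c c1" using uq *(5) by auto
      ultimately show "i \<in> circle_labels c1" using piece_iff [of "u j" c1] *(1) by auto
    qed
    moreover have cell: "c1 \<in> cells" "c2 \<in> cells" using * by (auto simp: faces_def)
    then have "card (circle_labels c1) \<le> card (circle_labels c2)"
      using *(4) lab_card by (simp add: toral_dim_def)
    ultimately have "circle_labels c2 = circle_labels c1" by (intro card_seteq) auto
    then show False using cell *(3) lab_inj by (auto dest: inj_onD)
  qed
  have lim: "limitin ?Y (\<lambda>j. (s j, x j)) (t, y) sequentially"
    if *: "c1 \<in> faces c" "c2 \<in> faces c" "range (\<lambda>j::nat. (s j, x j)) \<subseteq> piece c c1" "(t, y) \<in> piece c c2"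
      "limitin (closed_unit_ball (fst c)) x y sequentially" "\<forall>i\<in>circle_labels c2. (\<lambda>j. s j i) \<longlonglongrightarrow> t i"
    for c1 c2 s x t y
  proof -
    have "(t, y) \<in> closed_piece c" "range (\<lambda>j. (s j, x j)) \<subseteq> closed_piece c" using * sub by blast+
    then show ?thesis
      using toral_attach_map_limit [OF c *(1-5)] *(6) by (simp add: toral_closure_space_def limitin_pullback_topology)
  qed
  show ?thesis
    unfolding toral_closure_def Let_def F
    using metr subtop op dense comp nolim lim
    by (intro conjI ballI allI impI) (simp_all add: closed_piece_def compact_space_def)
qed

lemma toral_CW_complex_level:
  "toral_CW_complex base cells sphere_cell fst attach
    circle_labels (top_of_set (level_set a \<nu> S)) (\<lambda>c. level_cell a \<nu> (circle_labels c))"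
proof -
  interpret regular_CW_complex "base" "cells" sphere_cell fst attach
    by (rule regular_CW_complex_faces [OF \<sigma> k])
  show ?thesis
  proof
    show "Hausdorff_space (top_of_set (level_set a \<nu> S))"
      by (simp add: Hausdorff_space_subtopology)
    show "disjoint_family_on (\<lambda>c. level_cell a \<nu> (circle_labels c)) cells"
      unfolding disjoint_family_on_def
      by (intro ballI impI level_cell_disjoint) (meson lab_inj inj_onD)
    have "(\<Union>c\<in>cells. level_cell a \<nu> (circle_labels c)) =
        (\<Union>A\<in>circle_labels ` cells. level_cell a \<nu> A)" by simp
    also have "\<dots> = level_set a \<nu> S"
      unfolding circle_labels_image [OF \<sigma> k] S_def [symmetric]
      using level_set_eq_Union [OF opposite S_nonempty] by simp
    finally show "(\<Union>c\<in>cells. level_cell a \<nu> (circle_labels c)) = topspace (top_of_set (level_set a \<nu> S))"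
      by simp
  next
    fix c assume c: "c \<in> cells"
    then show "card (circle_labels c) = fst c + 1 \<or> card (circle_labels c) = fst c + 2"
      by (simp add: lab_card)
    fix c' assume "c' \<in> cells"
      "sphere_cell c' \<subseteq> base closure_of sphere_cell c"
    then show "circle_labels c' \<subseteq> circle_labels c" using lab_closure_iff [OF c] by blast
  next
    fix c assume c: "c \<in> cells"
    let ?A = "circle_labels c"
    let ?g = "\<lambda>p. (angles ?A p, direction p)"
    have cc: "c \<in> faces c" using c by (simp add: faces_def)
    have lab_op: "\<And>i. i \<in> ?A \<Longrightarrow> a i * \<nu> < 0" using lab(2) [OF c] opposite by blast
    have subK: "level_cell a \<nu> ?A \<subseteq> level_set a \<nu> S"
      by (rule level_cell_subset [OF opposite lab(2) [OF c]])
    have "homeomorphic_maps (prod_topology (torus ?A) (top_of_set (open_face ?A)))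
        (top_of_set (level_cell a \<nu> ?A)) (level_pt a \<nu>) ?g"
      using homeomorphic_maps_level_cell [of S a \<nu> ?A] opposite lab [OF c] by blast
    then have g: "homeomorphic_map (top_of_set (level_cell a \<nu> ?A)) (prod_topology (torus ?A) (top_of_set (open_face ?A))) ?g"
      and gi: "\<And>x. x \<in> topspace (torus ?A) \<times> open_face ?A \<Longrightarrow> ?g (level_pt a \<nu> x) = x"
      unfolding homeomorphic_maps_map by auto
    have t1: "subtopology (top_of_set (level_set a \<nu> S)) (level_cell a \<nu> ?A) = top_of_set (level_cell a \<nu> ?A)"
      using subK by (simp add: subtopology_subtopology inf.absorb2)
    have "open_face ?A \<subseteq> closed_face S"
      using open_face_subset closed_face_mono [OF lab(2) [OF c]] by blast
    then have t2: "subtopology base (sphere_cell c) = top_of_set (open_face ?A)"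
      by (simp add: lab_base lab_sphere_cell [OF c] subtopology_subtopology inf.absorb2)
    have "level_set a \<nu> ?A \<subseteq> level_set a \<nu> S"
      using lab(2) [OF c] by (auto simp: level_set_def coord_space_def)
    then have t3: "top_of_set (level_set a \<nu> S) closure_of level_cell a \<nu> ?A = level_set a \<nu> ?A"
      "subtopology (top_of_set (level_set a \<nu> S)) (level_set a \<nu> ?A) = top_of_set (level_set a \<nu> ?A)"
      using closure_level_cell [OF lab_op lab(1) [OF c]] subK
      by (simp_all add: closure_of_subtopology inf.absorb2 subtopology_subtopology)
    have bd: "toral_attach_map c ` (topspace (toral_closure_space c) - piece c c)
        \<subseteq> (\<Union>c'\<in>{c' \<in> cells. toral_dim fst circle_labels c' < toral_dim fst circle_labels c}. level_cell a \<nu> (circle_labels c'))"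
    proof (intro subsetI, elim imageE)
      fix p q assume p: "p = toral_attach_map c q" and q: "q \<in> topspace (toral_closure_space c) - piece c c"
      then obtain c' where c': "c' \<in> faces c" "q \<in> piece c c'" "c' \<noteq> c" by (auto simp: closed_piece_def)
      then have "circle_labels c' \<noteq> ?A" using lab_inj c by (auto simp: faces_def dest: inj_onD)
      then have "card (circle_labels c') < card ?A"
        using c' by (intro psubset_card_mono) (auto simp: faces_def)
      moreover have "c' \<in> cells" using c' by (simp add: faces_def)
      ultimately have "toral_dim fst circle_labels c' < toral_dim fst circle_labels c"
        using lab_card c by (simp add: toral_dim_def)
      moreover have "p \<in> level_cell a \<nu> (circle_labels c')"
        using piece_image(1) [OF c c'(1)] c'(2) p by blast
      ultimately show "p \<in> (\<Union>c'\<in>{c' \<in> cells. toral_dim fst circle_labels c' < toral_dim fst circle_labels c}. level_cell a \<nu> (circle_labels c'))"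
        using \<open>c' \<in> cells\<close> by blast
    qed
    have fin: "toral_attach_map c (s, y) \<in> level_cell a \<nu> ?A \<and> ?g (toral_attach_map c (s, y)) = (s, attach c y)"
      if "s \<in> topspace (torus ?A)" "y \<in> open_ball_set (fst c)" for s y
    proof -
      have y: "attach c y \<in> open_face ?A" using lab_attach(2) [OF c] that(2) by blast
      moreover have "y \<in> ball_set (fst c)" using that(2) by (simp add: open_ball_set_eq)
      ultimately have "(s, y) \<in> piece c c"
        using that(1) by (simp add: toral_piece_def lab_sphere_cell [OF c])
      then show ?thesis
        using piece_image(1) [OF c cc] gi [of "(s, attach c y)"] that(1) y
        by (auto simp: toral_attach_map_def)
    qed
    show "\<exists>g Y \<Phi>.
        homeomorphic_map (subtopology (top_of_set (level_set a \<nu> S)) (level_cell a \<nu> ?A))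
          (prod_topology (torus ?A) (subtopology base (sphere_cell c))) g \<and>
        toral_closure base cells sphere_cell fst attach circle_labels c Y \<and>
        homeomorphic_map Y (subtopology (top_of_set (level_set a \<nu> S)) (top_of_set (level_set a \<nu> S) closure_of level_cell a \<nu> ?A)) \<Phi> \<and>
        \<Phi> ` (topspace Y - piece c c)
          \<subseteq> (\<Union>c'\<in>{c' \<in> cells. toral_dim fst circle_labels c' < toral_dim fst circle_labels c}. level_cell a \<nu> (circle_labels c')) \<and>
        (\<forall>s\<in>topspace (torus ?A). \<forall>y\<in>open_ball_set (fst c).
           \<Phi> (s, y) \<in> level_cell a \<nu> ?A \<and> g (\<Phi> (s, y)) = (s, attach c y))"
      unfolding t1 t2 t3
      by (intro exI [of _ ?g] exI [of _ "toral_closure_space c"] exI [of _ "toral_attach_map c"] conjI ballI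
          g toral_closure_level c homeomorphic_map_toral_attach_map bd)
         (use fin in auto)
  qed
qed


section \<open>Identification with the quotient space\<close>

lemma level_pt_eq_iff:
  assumes "C \<in> closed_face S" "C' \<in> closed_face S" "s \<in> topspace (torus S)" "s' \<in> topspace (torus S)"
  shows "level_pt a \<nu> (s, C) = level_pt a \<nu> (s', C') \<longleftrightarrow> C = C' \<and> (\<forall>i. C $ i \<noteq> 0 \<longrightarrow> s i = s' i)"
proof -
  have unit: "norm (t i) = 1" if "D \<in> closed_face S" "t \<in> topspace (torus S)" "D $ i \<noteq> 0" for t D i
    using that by (auto simp: closed_face_def topspace_torus PiE_iff)
  show ?thesis
  proof
    assume eq: "level_pt a \<nu> (s, C) = level_pt a \<nu> (s', C')"
    have "C = C'"
      using pt_props(4) [where C = C and s = s, OF _ assms(1) unit [OF assms(1,3)]]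
        pt_props(4) [where C = C' and s = s', OF _ assms(2) unit [OF assms(2,4)]] eq by simp
    moreover have "s i = s' i" if "C $ i \<noteq> 0" for i
      using pt_props(6) [where C = C and s = s and i = i and A = UNIV, OF _ assms(1) unit [OF assms(1,3)]]
        pt_props(6) [where C = C' and s = s' and i = i and A = UNIV, OF _ assms(2) unit [OF assms(2,4)]]
        eq that \<open>C = C'\<close> by simp
    ultimately show "C = C' \<and> (\<forall>i. C $ i \<noteq> 0 \<longrightarrow> s i = s' i)" by simp
  next
    assume "C = C' \<and> (\<forall>i. C $ i \<noteq> 0 \<longrightarrow> s i = s' i)"
    then have "C' = C" "\<And>i. C $ i \<noteq> 0 \<Longrightarrow> s i = s' i" by auto
    then show "level_pt a \<nu> (s, C) = level_pt a \<nu> (s', C')"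
      unfolding level_pt_def by (intro vec_eq_iff [THEN iffD2] allI) auto
  qed
qed

lemma topspace_X_base: "topspace (X_base k \<sigma>) = topspace (torus S) \<times> closed_face S"
  by (simp add: X_base_def lab_base S_def)

text \<open>Two points over \<open>x\<close> are identified exactly when their angles agree on the support of \<open>x\<close>. If the support is
  proper, it is the label set of a cell of dimension less than \<open>k - 1\<close>; if it is all of \<open>S\<close>, agreement means
  equality.\<close>

lemma X_rel_iff:
  assumes p: "p \<in> topspace (X_base k \<sigma>)" and q: "q \<in> topspace (X_base k \<sigma>)"
  shows "(p, q) \<in> X_rel k \<sigma> \<longleftrightarrow> level_pt a \<nu> p = level_pt a \<nu> q"
proof -
  obtain s C where sC: "p = (s, C)" "s \<in> topspace (torus S)" "C \<in> closed_face S"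
    using p unfolding topspace_X_base by blast
  obtain s' C' where sC': "q = (s', C')" "s' \<in> topspace (torus S)" "C' \<in> closed_face S"
    using q unfolding topspace_X_base by blast
  have rel: "(p, q) \<in> X_rel k \<sigma> \<longleftrightarrow> C = C' \<and> (s = s' \<or> (\<exists>l\<in>{1..<k}. \<exists>\<gamma>\<in>sub_perms_S k \<sigma> l.
        C \<in> pos_sphere l \<gamma> \<and> (\<forall>i\<in>{1..l}. s (\<gamma> i) = s' (\<gamma> i))))"
    using p q by (simp add: X_rel_def sC sC')
  have pos: "C \<in> pos_sphere l \<gamma> \<longleftrightarrow> C \<in> open_face (\<gamma> ` {1..l})" if "l < k" "\<gamma> \<in> sub_perms_S k \<sigma> l" for l \<gamma>
    using that k pos_sphere_eq_open_face [of \<gamma> l] by (simp add: sub_perms_S_def)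
  show ?thesis
    unfolding rel unfolding sC(1) sC'(1) level_pt_eq_iff [OF sC(3) sC'(3) sC(2) sC'(2)]
  proof (intro conj_cong iffI refl)
    assume "s = s' \<or> (\<exists>l\<in>{1..<k}. \<exists>\<gamma>\<in>sub_perms_S k \<sigma> l.
        C \<in> pos_sphere l \<gamma> \<and> (\<forall>i\<in>{1..l}. s (\<gamma> i) = s' (\<gamma> i)))"
    then show "\<forall>i. C $ i \<noteq> 0 \<longrightarrow> s i = s' i"
    proof
      assume "\<exists>l\<in>{1..<k}. \<exists>\<gamma>\<in>sub_perms_S k \<sigma> l. C \<in> pos_sphere l \<gamma> \<and> (\<forall>i\<in>{1..l}. s (\<gamma> i) = s' (\<gamma> i))"
      then obtain l \<gamma> where *: "l < k" "\<gamma> \<in> sub_perms_S k \<sigma> l" "C \<in> pos_sphere l \<gamma>" "\<forall>i\<in>{1..l}. s (\<gamma> i) = s' (\<gamma> i)"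
        by auto
      then have "{i. C $ i \<noteq> 0} = \<gamma> ` {1..l}" using pos open_face_support by blast
      then show ?thesis using *(4) by (metis (mono_tags, lifting) imageE mem_Collect_eq)
    qed auto
  next
    assume agree: "\<forall>i. C $ i \<noteq> 0 \<longrightarrow> s i = s' i"
    obtain B where B: "B \<noteq> {}" "B \<subseteq> S" "C \<in> open_face B"
      using sC(3) by (auto simp: closed_face_eq_Union)
    show "s = s' \<or> (\<exists>l\<in>{1..<k}. \<exists>\<gamma>\<in>sub_perms_S k \<sigma> l.
        C \<in> pos_sphere l \<gamma> \<and> (\<forall>i\<in>{1..l}. s (\<gamma> i) = s' (\<gamma> i)))"
    proof (cases "B = S")
      case True
      then have "s i = s' i" if "i \<in> S" for i
        using agree B(3) that by (auto simp: open_face_def)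
      then have "s = s'"
        using sC(2) sC'(2) unfolding topspace_torus by (intro PiE_ext) auto
      then show ?thesis by simp
    next
      case False
      obtain c where c: "c \<in> cells" "circle_labels c = B"
        using lab_surj B by blast
      define l \<gamma> where "l = fst c + 1" and "\<gamma> = snd c"
      have im: "\<gamma> ` {1..l} = B" using c(2) by (simp add: circle_labels_def l_def \<gamma>_def)
      have "card B < card S" using False B(2) by (intro psubset_card_mono) auto
      then have l: "l < k"
        using lab_card [OF c(1)] c(2) perms_S_card_image [OF \<sigma> k(2)] by (simp add: l_def S_def)
      have "(fst c, snd c) \<in> cells" using c(1) by simp
      then have "\<gamma> \<in> sub_perms_S k \<sigma> l"
        unfolding cell_index_def l_def \<gamma>_def by blast
      moreover from this have "C \<in> pos_sphere l \<gamma>" using B(3) pos [OF l] im by simp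
      moreover have "\<forall>i\<in>{1..l}. s (\<gamma> i) = s' (\<gamma> i)"
      proof
        fix i assume "i \<in> {1..l}"
        then have "\<gamma> i \<in> B" using im by blast
        then have "C $ \<gamma> i \<noteq> 0" using B(3) by (force simp: open_face_def)
        then show "s (\<gamma> i) = s' (\<gamma> i)" using agree by blast
      qed
      moreover have "l \<in> {1..<k}" using l by (simp add: l_def)
      ultimately show ?thesis by blast
    qed
  qed
qed

lemma X_class_eq_iff:
  assumes "p \<in> topspace (X_base k \<sigma>)" "q \<in> topspace (X_base k \<sigma>)"
  shows "X_class k \<sigma> p = X_class k \<sigma> q \<longleftrightarrow> level_pt a \<nu> p = level_pt a \<nu> q"
proof -
  have "X_rel k \<sigma> `` {r} = {r' \<in> topspace (X_base k \<sigma>). level_pt a \<nu> r = level_pt a \<nu> r'}"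
    if "r \<in> topspace (X_base k \<sigma>)" for r
    using X_rel_iff [OF that] by (auto simp: X_rel_def)
  then show ?thesis
    unfolding X_class_def using assms by auto
qed

text \<open>Angles with indices outside \<open>A\<close> do not influence the point, so they may be filled in arbitrarily.\<close>

lemma level_pt_image_cell:
  assumes A: "A \<noteq> {}" "A \<subseteq> S"
  shows "level_pt a \<nu> ` (topspace (torus S) \<times> open_face A) = level_cell a \<nu> A"
proof (intro equalityI subsetI)
  fix p assume "p \<in> level_pt a \<nu> ` (topspace (torus S) \<times> open_face A)"
  then obtain s C where sC: "p = level_pt a \<nu> (s, C)" "s \<in> topspace (torus S)" "C \<in> open_face A" by blast
  have C: "C \<in> closed_face S" using open_face_subset closed_face_mono [OF A(2)] sC(3) by blast
  have unit: "norm (s i) = 1" if "C $ i \<noteq> 0" for i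
    using that C sC(2) by (auto simp: closed_face_def topspace_torus PiE_iff)
  show "p \<in> level_cell a \<nu> A"
    using pt_props(2,5) [where C = C and s = s, OF _ C unit] open_face_support [OF sC(3)]
    by (simp add: level_cell_def sC(1))
next
  fix p assume p: "p \<in> level_cell a \<nu> A"
  have maps: "homeomorphic_maps (prod_topology (torus A) (top_of_set (open_face A)))
      (top_of_set (level_cell a \<nu> A)) (level_pt a \<nu>) (\<lambda>p. (angles A p, direction p))"
    by (rule homeomorphic_maps_level_cell [OF opposite A(2,1)])
  then have inn: "(angles A p, direction p) \<in> topspace (torus A) \<times> open_face A"
    and eq: "level_pt a \<nu> (angles A p, direction p) = p"
    using p by (auto simp: homeomorphic_maps_def continuous_map_def)
  define s where "s = (\<lambda>i\<in>S. if i \<in> A then angles A p i else (1, 0))"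
  have "s \<in> topspace (torus S)"
    using inn by (auto simp: topspace_torus s_def PiE_iff norm_prod_def)
  moreover have "level_pt a \<nu> (s, direction p) = level_pt a \<nu> (angles A p, direction p)"
    using inn A(2) by (auto simp: level_pt_def vec_eq_iff s_def open_face_def)
  ultimately show "p \<in> level_pt a \<nu> ` (topspace (torus S) \<times> open_face A)"
    using inn eq by (intro image_eqI [of _ _ "(s, direction p)"]) auto
qed

lemma level_pt_image: "level_pt a \<nu> ` topspace (X_base k \<sigma>) = level_set a \<nu> S"
proof -
  have "topspace (X_base k \<sigma>) = (\<Union>A\<in>{A. A \<noteq> {} \<and> A \<subseteq> S}. topspace (torus S) \<times> open_face A)"
    unfolding topspace_X_base closed_face_eq_Union by blast
  then have "level_pt a \<nu> ` topspace (X_base k \<sigma>) = (\<Union>A\<in>{A. A \<noteq> {} \<and> A \<subseteq> S}. level_pt a \<nu> ` (topspace (torus S) \<times> open_face A))"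
    by (simp add: image_UN)
  also have "\<dots> = (\<Union>A\<in>{A. A \<noteq> {} \<and> A \<subseteq> S}. level_cell a \<nu> A)"
    by (intro SUP_cong refl level_pt_image_cell) auto
  finally show ?thesis using level_set_eq_Union [OF opposite S_nonempty] by simp
qed

text \<open>The parametrisation of the level set descends to an injective map on the quotient, by \<open>X_rel_iff\<close>, and a
  continuous bijection from a compact space to a Hausdorff space is a homeomorphism.\<close>

lemma homeomorphic_map_level_set_X_space:
  "\<exists>h. homeomorphic_map (top_of_set (level_set a \<nu> S)) (X_space k \<sigma>) h \<and>
     (\<forall>c\<in>cells. h ` level_cell a \<nu> (circle_labels c) = X_cell k \<sigma> c)"
proof -
  have cont: "continuous_map (X_base k \<sigma>) (top_of_set (level_set a \<nu> S)) (level_pt a \<nu>)"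
    unfolding continuous_map_in_subtopology
  proof
    show "continuous_map (X_base k \<sigma>) euclidean (level_pt a \<nu>)"
      unfolding X_base_def lab_base S_def [symmetric]
      by (rule continuous_map_level_pt [OF opposite order_refl]) (simp_all add: closed_face_def)
    show "level_pt a \<nu> \<in> topspace (X_base k \<sigma>) \<rightarrow> level_set a \<nu> S"
      using level_pt_image by blast
  qed
  have quot: "quotient_map (X_base k \<sigma>) (X_space k \<sigma>) (X_class k \<sigma>)"
    unfolding X_space_def by (rule quotient_map_quotient_topology)
  obtain G where G: "continuous_map (X_space k \<sigma>) (top_of_set (level_set a \<nu> S)) G"
    "G ` topspace (X_space k \<sigma>) = level_pt a \<nu> ` topspace (X_base k \<sigma>)"
    "\<And>p. p \<in> topspace (X_base k \<sigma>) \<Longrightarrow> G (X_class k \<sigma> p) = level_pt a \<nu> p"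
    using quotient_map_lift_exists [OF quot cont] X_class_eq_iff by metis
  have top: "topspace (X_space k \<sigma>) = X_class k \<sigma> ` topspace (X_base k \<sigma>)"
    using quot by (simp add: quotient_map_def)
  have comp: "compact_space (X_base k \<sigma>)"
    by (simp add: X_base_def lab_base compact_space_prod_topology compact_space_torus
        compact_space_subtopology compact_closed_face)
  have "compact_space (X_space k \<sigma>)"
    using comp image_compactin [of "X_base k \<sigma>" "topspace (X_base k \<sigma>)" "X_space k \<sigma>" "X_class k \<sigma>"]
      quotient_imp_continuous_map [OF quot] by (simp add: compact_space_def top)
  then have hG: "homeomorphic_map (X_space k \<sigma>) (top_of_set (level_set a \<nu> S)) G"
  proof (rule continuous_imp_homeomorphic_map [OF G(1)])
    show "Hausdorff_space (top_of_set (level_set a \<nu> S))"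
      by (simp add: Hausdorff_space_subtopology)
    show "G ` topspace (X_space k \<sigma>) = topspace (top_of_set (level_set a \<nu> S))"
      by (simp add: G(2) level_pt_image)
    show "inj_on G (topspace (X_space k \<sigma>))"
      unfolding top by (auto simp: inj_on_def G(3) X_class_eq_iff)
  qed
  then obtain h where h: "homeomorphic_maps (X_space k \<sigma>) (top_of_set (level_set a \<nu> S)) G h"
    by (auto simp: homeomorphic_map_maps)
  have "h ` level_cell a \<nu> (circle_labels c) = X_cell k \<sigma> c" if c: "c \<in> cells" for c
  proof -
    let ?D = "{p \<in> topspace (X_base k \<sigma>). snd p \<in> sphere_cell c}"
    have "?D = topspace (torus S) \<times> open_face (circle_labels c)"
      using open_face_subset closed_face_mono [OF lab(2) [OF c]]
      by (fastforce simp: topspace_X_base lab_sphere_cell [OF c])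
    then have "level_cell a \<nu> (circle_labels c) = level_pt a \<nu> ` ?D"
      using level_pt_image_cell lab [OF c] by simp
    also have "\<dots> = (\<lambda>p. G (X_class k \<sigma> p)) ` ?D"
      by (rule image_cong) (auto simp: G(3))
    finally have "h ` level_cell a \<nu> (circle_labels c) = (\<lambda>p. h (G (X_class k \<sigma> p))) ` ?D"
      by (simp add: image_image)
    also have "\<dots> = X_class k \<sigma> ` ?D"
      using h top by (intro image_cong refl) (auto simp: homeomorphic_maps_def)
    finally show ?thesis by (simp add: X_cell_def)
  qed
  moreover have "homeomorphic_map (top_of_set (level_set a \<nu> S)) (X_space k \<sigma>) h"
    using h homeomorphic_maps_map by blast
  ultimately show ?thesis by blast
qed

end

section \<open>Invariance, stability and instability of the level set\<close>

lemma norm_flow_line_vec: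
  assumes "t \<in> life_span a \<nu> p"
  shows "norm (flow_line \<omega> a \<nu> p t) = norm p / sqrt (inv_sq \<nu> (quad a p) t)"
proof -
  have "(norm (flow_line \<omega> a \<nu> p t))\<^sup>2 = (norm p / sqrt (inv_sq \<nu> (quad a p) t))\<^sup>2"
    unfolding norm_vec_squared power_divide norm_flow_line [OF assms] by (simp add: sum_divide_distrib)
  moreover have "sqrt (inv_sq \<nu> (quad a p) t) > 0" using assms by (simp add: life_span_def)
  ultimately show ?thesis by (simp add: power2_eq_iff_nonneg)
qed

lemma flow_line_in_coord_space: "p \<in> coord_space S \<Longrightarrow> flow_line \<omega> a \<nu> p t \<in> coord_space S"
  by (simp add: coord_space_def flow_line_def)

lemma flow_line_support:
  assumes "t \<in> life_span a \<nu> p"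
  shows "{i. flow_line \<omega> a \<nu> p t $ i \<noteq> 0} = {i. p $ i \<noteq> 0}"
proof -
  have "flow_line \<omega> a \<nu> p t $ i = 0 \<longleftrightarrow> p $ i = 0" for i
    using norm_flow_line [OF assms, of \<omega> i] assms
    by (metis (mono_tags) divide_eq_0_iff less_irrefl life_span_def mem_Collect_eq norm_eq_zero real_sqrt_gt_0_iff)
  then show ?thesis by simp
qed

lemma inv_sq_equilibrium: "\<nu> + q = 0 \<Longrightarrow> inv_sq \<nu> q t = 1"
  by (auto simp: inv_sq_def add_eq_0_iff)

lemma flow_invariant_level_cell: "flow_invariant (euler_field \<omega> a \<nu>) (level_cell a \<nu> A)"
  unfolding flow_invariant_def
proof (intro allI impI ballI, elim conjE bexE)
  fix J x s t assume "solution (euler_field \<omega> a \<nu>) J x" "t \<in> J" "s \<in> J" "x s \<in> level_cell a \<nu> A"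
  then show "x t \<in> level_cell a \<nu> A"
    using solution_eq_flow_line [of \<omega> a \<nu> J x s t] flow_line_support [of "t - s" a \<nu> "x s" \<omega>]
      quad_flow_line [of "t - s" a \<nu> "x s" \<omega>] inv_sq_equilibrium [of \<nu> "quad a (x s)"]
    by (simp add: level_cell_def)
qed

lemma flow_invariant_level_set: "flow_invariant (euler_field \<omega> a \<nu>) (level_set a \<nu> A)"
  unfolding flow_invariant_def
proof (intro allI impI ballI, elim conjE bexE)
  fix J x s t assume "solution (euler_field \<omega> a \<nu>) J x" "t \<in> J" "s \<in> J" "x s \<in> level_set a \<nu> A"
  then show "x t \<in> level_set a \<nu> A"
    using solution_eq_flow_line [of \<omega> a \<nu> J x s t] flow_line_in_coord_space [of "x s" A \<omega> a \<nu> "t - s"]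
      quad_flow_line [of "t - s" a \<nu> "x s" \<omega>] inv_sq_equilibrium [of \<nu> "quad a (x s)"]
    by (simp add: level_set_def)
qed

text \<open>When \<open>\<nu>\<close> does not oppose the sign of \<open>quad a p\<close>, the function \<open>inv_sq\<close> attains every positive value up to \<open>1\<close>,
  and the norm is inversely proportional to its square root. The value \<open>s\<close> is chosen such that the norm becomes
  \<open>\<bar>B\<bar> + n + 1\<close>.\<close>

lemma orbit_unbounded:
  assumes q: "quad a p \<noteq> 0" "\<nu> * quad a p \<ge> 0"
  obtains t where "t \<in> life_span a \<nu> p" "norm (flow_line \<omega> a \<nu> p t) > B"
proof -
  define n where "n = norm p"
  have n: "n > 0" using q by (auto simp: n_def quad_def)
  define s where "s = (n / (\<bar>B\<bar> + n + 1))\<^sup>2"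
  have s: "s > 0" using n by (simp add: s_def)
  obtain t where t: "inv_sq \<nu> (quad a p) t = s"
  proof (cases "\<nu> = 0")
    case True
    then have "inv_sq \<nu> (quad a p) ((1 - s) / (2 * quad a p)) = s"
      using q by (simp add: inv_sq_def)
    then show thesis using that by blast
  next
    case False
    define w where "w = quad a p / \<nu>"
    have w: "w > 0" using q False by (auto simp: w_def zero_less_divide_iff zero_le_mult_iff)
    have "inv_sq \<nu> (quad a p) (- ln ((s + w) / (1 + w)) / (2 * \<nu>)) = s"
      using w s False by (simp add: inv_sq_def flip: w_def)
    then show thesis using that by blast
  qed
  have "t \<in> life_span a \<nu> p" using t s by (simp add: life_span_def)
  moreover have "sqrt s = n / (\<bar>B\<bar> + n + 1)" using n by (simp add: s_def real_sqrt_abs)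
  then have "norm p / sqrt s = \<bar>B\<bar> + n + 1" using n by (simp add: n_def)
  moreover have "\<bar>B\<bar> + n + 1 > B" using n by linarith
  ultimately show thesis using that [of t] by (simp add: norm_flow_line_vec t)
qed

text \<open>With \<open>e = exp (- 2 * \<nu> * t)\<close> this is the affine combination of \<open>1\<close> and the equilibrium \<open>- q / \<nu>\<close> with weights
  \<open>e\<close> and \<open>1 - e\<close>. If \<open>\<nu> * q < 0\<close>, the equilibrium is positive, and \<open>inv_sq\<close> is compared with \<open>e\<close> by the sign of \<open>1 - e\<close>.\<close>

lemma inv_sq_convex:
  "\<nu> \<noteq> 0 \<Longrightarrow> inv_sq \<nu> q t = exp (- 2 * \<nu> * t) + (1 - exp (- 2 * \<nu> * t)) * (- q / \<nu>)"
  by (simp add: inv_sq_def algebra_simps)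

lemma deviation_flow_line:
  assumes "\<nu> \<noteq> 0" "t \<in> life_span a \<nu> p"
  shows "\<nu> + quad a (flow_line \<omega> a \<nu> p t) =
    (\<nu> + quad a p) * (exp (- 2 * \<nu> * t) / inv_sq \<nu> (quad a p) t)"
proof -
  have "inv_sq \<nu> (quad a p) t \<noteq> 0" using assms by (simp add: life_span_def)
  moreover have "\<nu> * inv_sq \<nu> (quad a p) t + quad a p = (\<nu> + quad a p) * exp (- 2 * \<nu> * t)"
    using assms(1) by (simp add: inv_sq_def field_simps)
  ultimately show ?thesis
    unfolding quad_flow_line [OF assms(2)] by (simp add: field_simps)
qed

lemma inv_sq_ge_exp:
  assumes "\<nu> * q < 0" "\<nu> * t \<ge> 0"
  shows "exp (- 2 * \<nu> * t) \<le> inv_sq \<nu> q t"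
proof -
  have "- q / \<nu> > 0" using assms(1) by (auto simp: mult_less_0_iff divide_less_0_iff)
  moreover have "1 - exp (- 2 * \<nu> * t) \<ge> 0" using assms(2) by simp
  ultimately have "(1 - exp (- 2 * \<nu> * t)) * (- q / \<nu>) \<ge> 0" by (intro mult_nonneg_nonneg) auto
  then show ?thesis using assms(1) by (subst inv_sq_convex) auto
qed

lemma inv_sq_le_exp:
  assumes "\<nu> * q < 0" "\<nu> * t \<le> 0"
  shows "inv_sq \<nu> q t \<le> exp (- 2 * \<nu> * t)"
proof -
  have "- q / \<nu> > 0" using assms(1) by (auto simp: mult_less_0_iff divide_less_0_iff)
  moreover have "1 - exp (- 2 * \<nu> * t) \<le> 0" using assms(2) by simp
  ultimately have "(1 - exp (- 2 * \<nu> * t)) * (- q / \<nu>) \<le> 0" by (intro mult_nonpos_nonneg) auto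
  then show ?thesis using assms(1) by (subst inv_sq_convex) auto
qed

text \<open>Stated for \<open>\<nu> * t \<ge> 0\<close>, the lemma covers forward time in the stable case and backward time in the unstable case.\<close>

lemma in_life_span:
  assumes "\<nu> * quad a p < 0" "\<nu> * t \<ge> 0"
  shows "t \<in> life_span a \<nu> p"
  using less_le_trans [OF exp_gt_zero inv_sq_ge_exp [OF assms]] by (simp add: life_span_def)

lemma deviation_decreases:
  assumes "\<nu> * quad a p < 0" "\<nu> * t \<ge> 0"
  shows "\<bar>\<nu> + quad a (flow_line \<omega> a \<nu> p t)\<bar> \<le> \<bar>\<nu> + quad a p\<bar>"
proof -
  have L: "t \<in> life_span a \<nu> p" using assms by (rule in_life_span)
  then have z: "inv_sq \<nu> (quad a p) t > 0" by (simp add: life_span_def)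
  have "exp (- 2 * \<nu> * t) / inv_sq \<nu> (quad a p) t \<le> 1"
    using inv_sq_ge_exp [OF assms] z by simp
  moreover have "exp (- 2 * \<nu> * t) / inv_sq \<nu> (quad a p) t \<ge> 0" using z by simp
  moreover have "\<nu> \<noteq> 0" using assms by auto
  ultimately show ?thesis
    using deviation_flow_line [OF _ L, of \<omega>] by (metis abs_ge_zero abs_mult abs_of_nonneg mult_left_le)
qed

lemma deviation_increases:
  assumes "\<nu> * quad a p < 0" "\<nu> * t \<le> 0" "t \<in> life_span a \<nu> p"
  shows "\<bar>\<nu> + quad a p\<bar> \<le> \<bar>\<nu> + quad a (flow_line \<omega> a \<nu> p t)\<bar>"
proof -
  have z: "inv_sq \<nu> (quad a p) t > 0" using assms(3) by (simp add: life_span_def)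
  have e: "exp (- 2 * \<nu> * t) / inv_sq \<nu> (quad a p) t \<ge> 1"
    using inv_sq_le_exp [OF assms(1,2)] z by simp
  have "\<bar>\<nu> + quad a p\<bar> * 1 \<le> \<bar>\<nu> + quad a p\<bar> * (exp (- 2 * \<nu> * t) / inv_sq \<nu> (quad a p) t)"
    using e by (intro mult_left_mono) auto
  moreover have "\<nu> \<noteq> 0" using assms by auto
  ultimately show ?thesis
    using e by (subst deviation_flow_line [OF _ assms(3)]) (simp_all only: abs_mult mult_1_right, simp)
qed

text \<open>The distance to the level set is at most the distance to the point of the level set with the same rotated
  direction, whose factor is the limit \<open>1 / sqrt w\<close> of the factor of the trajectory.\<close>

lemma tendsto_level_set:
  assumes p: "p \<in> coord_space S" and q: "\<nu> * quad a p < 0"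
    and F: "((\<lambda>t. exp (- 2 * \<nu> * t)) \<longlongrightarrow> 0) F"
  shows "((\<lambda>t. infdist (flow_line \<omega> a \<nu> p t) (level_set a \<nu> S)) \<longlongrightarrow> 0) F"
proof -
  define w where "w = - quad a p / \<nu>"
  have \<nu>: "\<nu> \<noteq> 0" and w: "w > 0" using q by (auto simp: w_def mult_less_0_iff divide_less_0_iff)
  define R where "R t = (\<chi> i. rot (\<omega> i * t) (p $ i))" for t
  have R: "R t \<in> coord_space S" "quad a (R t) = quad a p" "norm (R t) = norm p" for t
    using p by (simp_all add: R_def coord_space_def quad_def norm_vec_def)
  have "(1 / sqrt w) *\<^sub>R R t \<in> level_set a \<nu> S" for t
  proof -
    have "quad a ((1 / sqrt w) *\<^sub>R R t) = quad a p / w"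
      using R w by (simp add: quad_scaleR power_divide)
    also have "\<dots> = - \<nu>" using \<nu> q by (auto simp: w_def)
    finally show ?thesis using R(1) [of t] by (simp add: level_set_def coord_space_def)
  qed
  moreover have "flow_line \<omega> a \<nu> p t = (1 / sqrt (inv_sq \<nu> (quad a p) t)) *\<^sub>R R t" for t
    by (simp add: flow_line_def R_def vec_eq_iff)
  moreover have "dist (r *\<^sub>R R t) (r' *\<^sub>R R t) = \<bar>r - r'\<bar> * norm p" for r r' t
    by (simp add: dist_norm R flip: scaleR_left_diff_distrib)
  ultimately have bound: "infdist (flow_line \<omega> a \<nu> p t) (level_set a \<nu> S)
      \<le> \<bar>1 / sqrt (inv_sq \<nu> (quad a p) t) - 1 / sqrt w\<bar> * norm p" for t
    by (metis infdist_le)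
  have "((\<lambda>t. inv_sq \<nu> (quad a p) t) \<longlongrightarrow> 0 + (1 - 0) * w) F"
    unfolding inv_sq_convex [OF \<nu>] w_def by (intro tendsto_intros F)
  then have "((\<lambda>t. \<bar>1 / sqrt (inv_sq \<nu> (quad a p) t) - 1 / sqrt w\<bar> * norm p)
      \<longlongrightarrow> \<bar>1 / sqrt w - 1 / sqrt w\<bar> * norm p) F"
    using w by (intro tendsto_intros) auto
  then have "((\<lambda>t. \<bar>1 / sqrt (inv_sq \<nu> (quad a p) t) - 1 / sqrt w\<bar> * norm p) \<longlongrightarrow> 0) F"
    by simp
  then show ?thesis
    by (rule Lim_null_comparison [rotated])
       (intro always_eventually allI, simp only: real_norm_def abs_of_nonneg infdist_nonneg bound)
qed

lemma exp_decay_at_top: "\<nu> > 0 \<Longrightarrow> ((\<lambda>t::real. exp (- 2 * \<nu> * t)) \<longlongrightarrow> 0) at_top"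
  by (intro filterlim_compose [OF exp_at_bot] filterlim_tendsto_neg_mult_at_bot [of "\<lambda>_. - 2 * \<nu>" "- 2 * \<nu>"]
      tendsto_const filterlim_ident) simp

lemma exp_decay_at_bot: "\<nu> < 0 \<Longrightarrow> ((\<lambda>t::real. exp (- 2 * \<nu> * t)) \<longlongrightarrow> 0) at_bot"
  by (intro filterlim_compose [OF exp_at_bot] filterlim_tendsto_pos_mult_at_bot [of "\<lambda>_. - 2 * \<nu>" "- 2 * \<nu>"]
      tendsto_const filterlim_ident) simp

context
  fixes a :: "'n::finite \<Rightarrow> real" and \<nu> :: real and S :: "'n set" and \<omega> :: "'n \<Rightarrow> real"
  assumes opposite: "\<And>i. i \<in> S \<Longrightarrow> a i * \<nu> < 0" and ne: "S \<noteq> {}"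
begin

lemma nu_nonzero: "\<nu> \<noteq> 0"
  using opposite ne by auto

lemma level_set_nonempty: "level_set a \<nu> S \<noteq> {}"
proof -
  obtain c where "c \<in> open_face S" using open_face_nonempty [OF ne] .
  then have c: "c \<in> closed_face S" using open_face_subset by blast
  define p :: "'n phase" where "p = (\<chi> i. (c $ i, 0))"
  have "c \<noteq> 0" using c by (auto simp: closed_face_def)
  then have "p \<noteq> 0" by (auto simp: p_def vec_eq_iff zero_prod_def)
  moreover have pM: "p \<in> coord_space S" using c by (auto simp: p_def closed_face_def coord_space_def zero_prod_def)
  ultimately have s: "\<nu> * quad a p < 0" using quad_sign opposite by blast
  then have "- \<nu> / quad a p > 0" by (auto simp: mult_less_0_iff divide_less_0_iff)
  then have "(sqrt (- \<nu> / quad a p))\<^sup>2 = - \<nu> / quad a p" by (intro real_sqrt_pow2) simp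
  then have "sqrt (- \<nu> / quad a p) *\<^sub>R p \<in> level_set a \<nu> S"
    using pM s by (auto simp: level_set_def quad_scaleR coord_space_def)
  then show ?thesis by blast
qed

text \<open>Sublevel sets of \<open>\<bar>\<nu> + quad a p\<bar>\<close> are a neighbourhood base of the compact level set inside the closed cell:
  on the compact part outside \<open>U\<close> where it is at most \<open>1\<close> this function has a positive minimum.\<close>

lemma deviation_neighbourhood:
  assumes U: "open U" "level_set a \<nu> S \<subseteq> U"
  obtains \<epsilon> where "\<epsilon> > 0" "\<epsilon> \<le> \<bar>\<nu>\<bar>" "\<And>p. p \<in> coord_space S \<Longrightarrow> \<bar>\<nu> + quad a p\<bar> < \<epsilon> \<Longrightarrow> p \<in> U"
proof -
  let ?D = "{p \<in> coord_space S. \<bar>\<nu> + quad a p\<bar> \<le> 1} - U"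
  have "closed {p. \<bar>\<nu> + quad a p\<bar> \<le> 1}"
    by (intro closed_Collect_le continuous_intros continuous_on_quad)
  then have "closed (coord_space S \<inter> {p. \<bar>\<nu> + quad a p\<bar> \<le> 1} \<inter> - U)"
    using U closed_coord_space by (intro closed_Int) auto
  moreover have "coord_space S \<inter> {p. \<bar>\<nu> + quad a p\<bar> \<le> 1} \<inter> - U = ?D" by auto
  moreover have "norm p \<le> sqrt ((\<Sum>i\<in>S. 1 / \<bar>a i\<bar>) * (\<bar>\<nu>\<bar> + 1))" if "p \<in> ?D" for p
  proof (rule real_le_rsqrt)
    have "(norm p)\<^sup>2 \<le> (\<Sum>i\<in>S. 1 / \<bar>a i\<bar>) * \<bar>quad a p\<bar>"
      using norm_squared_le_quad [OF definite] opposite that by blast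
    also have "\<dots> \<le> (\<Sum>i\<in>S. 1 / \<bar>a i\<bar>) * (\<bar>\<nu>\<bar> + 1)"
      using that by (intro mult_left_mono sum_nonneg) auto
    finally show "(norm p)\<^sup>2 \<le> (\<Sum>i\<in>S. 1 / \<bar>a i\<bar>) * (\<bar>\<nu>\<bar> + 1)" .
  qed
  then have "bounded ?D" by (meson boundedI)
  ultimately have comp: "compact ?D" by (simp only: compact_eq_bounded_closed)
  have "\<exists>\<delta>>0. \<forall>p\<in>?D. \<delta> \<le> \<bar>\<nu> + quad a p\<bar>"
  proof (cases "?D = {}")
    case False
    have "continuous_on ?D (\<lambda>p. \<bar>\<nu> + quad a p\<bar>)" by (intro continuous_intros continuous_on_quad)
    then obtain p where p: "p \<in> ?D" "\<forall>p'\<in>?D. \<bar>\<nu> + quad a p\<bar> \<le> \<bar>\<nu> + quad a p'\<bar>"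
      using continuous_attains_inf [OF comp False] by blast
    then have "\<bar>\<nu> + quad a p\<bar> > 0" using U(2) by (auto simp: level_set_def)
    then show ?thesis using p(2) by blast
  qed (auto intro: exI [of _ 1])
  then obtain \<delta> where \<delta>: "\<delta> > 0" "\<And>p. p \<in> ?D \<Longrightarrow> \<delta> \<le> \<bar>\<nu> + quad a p\<bar>" by blast
  show thesis
  proof (rule that [of "min (min \<delta> 1) \<bar>\<nu>\<bar>"])
    show "p \<in> U" if "p \<in> coord_space S" "\<bar>\<nu> + quad a p\<bar> < min (min \<delta> 1) \<bar>\<nu>\<bar>" for p
      using that \<delta>(2) [of p] by force
  qed (use \<delta> nu_nonzero in auto)
qed

lemma sign_near_level_set: "\<bar>\<nu> + q\<bar> < \<bar>\<nu>\<bar> \<Longrightarrow> \<nu> * q < 0"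
  by (cases "\<nu> > 0") (auto simp: mult_less_0_iff abs_if split: if_splits)

lemma converges_to_level_set:
  assumes "\<nu> > 0" and p: "p \<in> coord_space S" "\<nu> * quad a p < 0"
    and max: "maximal_solution (euler_field \<omega> a \<nu>) J x" "0 \<in> J" "x 0 = p"
  shows "converges_to (level_set a \<nu> S) J x"
proof -
  have J: "J = life_span a \<nu> p" and x: "\<And>t. t \<in> J \<Longrightarrow> x t = flow_line \<omega> a \<nu> p t"
    using maximal_solution_eq_flow_line [OF max(1,2)] unfolding max(3) by blast+
  have sub: "{0..} \<subseteq> J"
    unfolding J using in_life_span [OF p(2)] \<open>\<nu> > 0\<close> by auto
  have "((\<lambda>t. infdist (flow_line \<omega> a \<nu> p t) (level_set a \<nu> S)) \<longlongrightarrow> 0) at_top"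
    using tendsto_level_set [OF p exp_decay_at_top [OF \<open>\<nu> > 0\<close>]] .
  moreover have "\<forall>\<^sub>F t in at_top. infdist (flow_line \<omega> a \<nu> p t) (level_set a \<nu> S) = infdist (x t) (level_set a \<nu> S)"
    using eventually_ge_at_top [of 0] by eventually_elim (use sub x in auto)
  ultimately have "((\<lambda>t. infdist (x t) (level_set a \<nu> S)) \<longlongrightarrow> 0) at_top"
    by (rule Lim_transform_eventually)
  then show ?thesis using sub by (simp add: converges_to_def)
qed

text \<open>The neighbourhoods \<open>\<bar>\<nu> + quad a p\<bar> < \<epsilon>\<close> are forward invariant because the deviation decreases, and for
  \<open>\<epsilon> \<le> \<bar>\<nu>\<bar>\<close> they contain only points that are attracted to the level set.\<close>

lemma asymptotically_stable_level_set:
  assumes "\<nu> > 0"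
  shows "asymptotically_stable (euler_field \<omega> a \<nu>) (coord_space S) (level_set a \<nu> S)"
proof -
  have opn: "open {p. \<bar>\<nu> + quad a p\<bar> < \<epsilon>}" for \<epsilon>
    by (intro open_Collect_less continuous_intros continuous_on_quad)
  have sub: "level_set a \<nu> S \<subseteq> {p. \<bar>\<nu> + quad a p\<bar> < \<epsilon>}" if "\<epsilon> > 0" for \<epsilon>
    using that by (auto simp: level_set_def)
  show ?thesis
    unfolding asymptotically_stable_def
  proof
    show "lyapunov_stable (euler_field \<omega> a \<nu>) (coord_space S) (level_set a \<nu> S)"
      unfolding lyapunov_stable_def
    proof (intro allI impI, elim conjE)
      fix U assume "open U" "level_set a \<nu> S \<subseteq> U"
      then obtain \<epsilon> where \<epsilon>: "\<epsilon> > 0" "\<epsilon> \<le> \<bar>\<nu>\<bar>" "\<And>p. p \<in> coord_space S \<Longrightarrow> \<bar>\<nu> + quad a p\<bar> < \<epsilon> \<Longrightarrow> p \<in> U"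
        using deviation_neighbourhood by metis
      have "{0..} \<subseteq> J \<and> (\<forall>t\<ge>0. x t \<in> U)"
        if *: "maximal_solution (euler_field \<omega> a \<nu>) J x" "0 \<in> J" "x 0 \<in> {p. \<bar>\<nu> + quad a p\<bar> < \<epsilon>} \<inter> coord_space S" for J x
      proof -
        have J: "J = life_span a \<nu> (x 0)" and x: "\<And>t. t \<in> J \<Longrightarrow> x t = flow_line \<omega> a \<nu> (x 0) t"
          by (fact maximal_solution_eq_flow_line [OF *(1,2)])+
        have neg: "\<nu> * quad a (x 0) < 0" using *(3) \<epsilon>(2) by (intro sign_near_level_set) simp
        have sub: "{0..} \<subseteq> J"
          using in_life_span [OF neg] assms by (subst J) auto
        have "x t \<in> U" if "t \<ge> 0" for t
        proof (rule \<epsilon>(3))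
          have xt: "x t = flow_line \<omega> a \<nu> (x 0) t" using that sub x by auto
          show "x t \<in> coord_space S" unfolding xt using *(3) by (intro flow_line_in_coord_space) simp
          show "\<bar>\<nu> + quad a (x t)\<bar> < \<epsilon>"
            unfolding xt using deviation_decreases [OF neg, of t \<omega>] assms that *(3) by simp
        qed
        then show ?thesis using sub by blast
      qed
      then show "\<exists>W. open W \<and> level_set a \<nu> S \<subseteq> W \<and>
           (\<forall>J x. maximal_solution (euler_field \<omega> a \<nu>) J x \<and> 0 \<in> J \<and> x 0 \<in> W \<inter> coord_space S \<longrightarrow>
              {0..} \<subseteq> J \<and> (\<forall>t\<ge>0. x t \<in> U))"
        using opn sub [OF \<epsilon>(1)] by (intro exI [of _ "{p. \<bar>\<nu> + quad a p\<bar> < \<epsilon>}"]) blast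
    qed
    have "converges_to (level_set a \<nu> S) J x"
      if "maximal_solution (euler_field \<omega> a \<nu>) J x" "0 \<in> J" "x 0 \<in> {p. \<bar>\<nu> + quad a p\<bar> < \<bar>\<nu>\<bar>} \<inter> coord_space S" for J x
      using that sign_near_level_set by (intro converges_to_level_set [OF assms]) auto
    then show "\<exists>W. open W \<and> level_set a \<nu> S \<subseteq> W \<and>
      (\<forall>J x. maximal_solution (euler_field \<omega> a \<nu>) J x \<and> 0 \<in> J \<and> x 0 \<in> W \<inter> coord_space S \<longrightarrow>
         converges_to (level_set a \<nu> S) J x)"
      using opn sub [of "\<bar>\<nu>\<bar>"] nu_nonzero by (intro exI [of _ "{p. \<bar>\<nu> + quad a p\<bar> < \<bar>\<nu>\<bar>}"]) auto
  qed
qed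

text \<open>Points slightly inside the level set, \<open>r *\<^sub>R p\<close> with \<open>r < 1\<close>, exist forever but spiral into the origin.\<close>

lemma unstable_level_set:
  assumes "\<nu> < 0"
  shows "\<not> lyapunov_stable (euler_field \<omega> a \<nu>) (coord_space S) (level_set a \<nu> S)"
proof
  assume L: "lyapunov_stable (euler_field \<omega> a \<nu>) (coord_space S) (level_set a \<nu> S)"
  let ?U = "{p. quad a p > - \<nu> / 2}"
  have "open ?U" by (intro open_Collect_less continuous_intros continuous_on_quad)
  moreover have "level_set a \<nu> S \<subseteq> ?U" using assms by (auto simp: level_set_def)
  ultimately obtain W where W: "open W" "level_set a \<nu> S \<subseteq> W"
    "\<And>J x. maximal_solution (euler_field \<omega> a \<nu>) J x \<and> 0 \<in> J \<and> x 0 \<in> W \<inter> coord_space S \<Longrightarrow>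
              {0..} \<subseteq> J \<and> (\<forall>t\<ge>0. x t \<in> ?U)"
    using L unfolding lyapunov_stable_def by metis
  obtain p where p: "p \<in> level_set a \<nu> S" using level_set_nonempty by blast
  have "((\<lambda>r. r *\<^sub>R p) \<longlongrightarrow> 1 *\<^sub>R p) (at_left 1)" by (intro tendsto_intros)
  then have "\<forall>\<^sub>F r in at_left 1. r *\<^sub>R p \<in> W"
    using W(1,2) p by (intro topological_tendstoD [of _ p]) auto
  moreover have "\<forall>\<^sub>F r in at_left (1::real). r \<in> {0<..<1}"
    by (rule eventually_at_leftI [of 0]) auto
  ultimately have "\<forall>\<^sub>F r in at_left (1::real). r *\<^sub>R p \<in> W \<and> r \<in> {0<..<1}" by (rule eventually_conj)
  then obtain r where r: "r *\<^sub>R p \<in> W" "0 < r" "r < 1"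
    using eventually_happens' [of "at_left (1::real)"] by (auto simp: trivial_limit_at_left_real)
  let ?p = "r *\<^sub>R p"
  have pM: "?p \<in> coord_space S" using p by (auto simp: level_set_def coord_space_def)
  have q: "quad a ?p = - r\<^sup>2 * \<nu>" using p by (simp add: level_set_def quad_scaleR add_eq_0_iff algebra_simps)
  have L: "{0..} \<subseteq> life_span a \<nu> ?p" "\<And>t. t \<ge> 0 \<Longrightarrow> flow_line \<omega> a \<nu> ?p t \<in> ?U"
    using W(3) [of "life_span a \<nu> ?p" "flow_line \<omega> a \<nu> ?p"] maximal_solution_flow_line r pM by auto
  have z: "inv_sq \<nu> (quad a ?p) t = (1 - r\<^sup>2) * exp (- 2 * \<nu> * t) + r\<^sup>2" for t
    using assms unfolding q by (simp add: inv_sq_def)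
  have r2: "0 < r\<^sup>2" "r\<^sup>2 < 1" using r by (auto simp: power_less_one_iff)
  \<comment> \<open>At this time \<open>inv_sq\<close> equals \<open>2 + r\<^sup>2\<close>, and the trajectory has left the neighbourhood.\<close>
  define t where "t = ln (2 / (1 - r\<^sup>2)) / (- 2 * \<nu>)"
  have "ln (2 / (1 - r\<^sup>2)) \<ge> 0" using r2 by (intro ln_ge_zero) (simp add: field_simps)
  then have "t \<ge> 0" using assms by (simp add: t_def divide_nonneg_neg)
  then have U: "flow_line \<omega> a \<nu> ?p t \<in> ?U" and lt: "t \<in> life_span a \<nu> ?p" using L by auto
  have "- 2 * \<nu> * t = ln (2 / (1 - r\<^sup>2))" using assms by (simp add: t_def)
  then have "exp (- 2 * \<nu> * t) = 2 / (1 - r\<^sup>2)" using r2 by simp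
  then have "inv_sq \<nu> (quad a ?p) t = 2 + r\<^sup>2" using r2 by (simp only: z) (simp add: field_simps)
  then have "quad a (flow_line \<omega> a \<nu> ?p t) = r\<^sup>2 * (- \<nu>) / (2 + r\<^sup>2)"
    using quad_flow_line [OF lt, of \<omega>] by (simp add: q)
  moreover have "r\<^sup>2 * (- \<nu>) / (2 + r\<^sup>2) \<le> - \<nu> / 2"
  proof -
    have "s / (2 + s) \<le> 1 / 2" if "0 < s" "s < 1" for s :: real
      using that by (simp add: field_simps)
    from this [OF r2] have "(- \<nu>) * (r\<^sup>2 / (2 + r\<^sup>2)) \<le> (- \<nu>) * (1 / 2)"
      using assms by (intro mult_left_mono) auto
    then show ?thesis by (simp add: mult.commute)
  qed
  ultimately show False using U by simp
qed

text \<open>In forward time the deviation increases, so a trajectory off the level set stays in a closed set that is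
  disjoint from it and hence at positive distance by compactness.\<close>

lemma diverges_from_level_set:
  assumes "\<nu> < 0" and p: "p \<in> coord_space S" "\<nu> * quad a p < 0"
    and max: "maximal_solution (euler_field \<omega> a \<nu>) J x" "0 \<in> J" "x 0 = p"
  shows "diverges_from (level_set a \<nu> S) J x"
proof -
  have J: "J = life_span a \<nu> p" and x: "\<And>t. t \<in> J \<Longrightarrow> x t = flow_line \<omega> a \<nu> p t"
    using maximal_solution_eq_flow_line [OF max(1,2)] unfolding max(3) by blast+
  have sub: "{..0} \<subseteq> J"
    unfolding J using in_life_span [OF p(2)] \<open>\<nu> < 0\<close> by (auto simp: mult_nonpos_nonpos)
  have "((\<lambda>t. infdist (flow_line \<omega> a \<nu> p t) (level_set a \<nu> S)) \<longlongrightarrow> 0) at_bot"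
    using tendsto_level_set [OF p exp_decay_at_bot [OF \<open>\<nu> < 0\<close>]] .
  moreover have "\<forall>\<^sub>F t in at_bot. infdist (flow_line \<omega> a \<nu> p t) (level_set a \<nu> S) = infdist (x t) (level_set a \<nu> S)"
    using eventually_le_at_bot [of 0] by eventually_elim (use sub x in auto)
  ultimately have lim: "((\<lambda>t. infdist (x t) (level_set a \<nu> S)) \<longlongrightarrow> 0) at_bot"
    by (rule Lim_transform_eventually)
  have "\<exists>\<epsilon>>0. \<exists>t0\<in>J. \<forall>t\<in>J. t0 \<le> t \<longrightarrow> \<epsilon> \<le> infdist (x t) (level_set a \<nu> S)" if "x 0 \<notin> level_set a \<nu> S"
  proof -
    define \<delta> where "\<delta> = \<bar>\<nu> + quad a p\<bar>"
    have \<delta>: "\<delta> > 0" using that max(3) p(1) by (auto simp: \<delta>_def level_set_def)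
    have "closed {p. \<delta> \<le> \<bar>\<nu> + quad a p\<bar>}"
      by (intro closed_Collect_le continuous_intros continuous_on_quad)
    moreover have "level_set a \<nu> S \<inter> {p. \<delta> \<le> \<bar>\<nu> + quad a p\<bar>} = {}"
      using \<delta> by (auto simp: level_set_def)
    moreover have "compact (level_set a \<nu> S)" by (rule compact_level_set [OF opposite])
    ultimately have "\<exists>\<epsilon>>0. \<forall>y\<in>level_set a \<nu> S. \<forall>y'\<in>{p. \<delta> \<le> \<bar>\<nu> + quad a p\<bar>}. \<epsilon> \<le> dist y y'"
      by (intro separate_compact_closed)
    then obtain \<epsilon> where \<epsilon>: "\<epsilon> > 0"
      "\<And>y y'. y \<in> level_set a \<nu> S \<Longrightarrow> \<delta> \<le> \<bar>\<nu> + quad a y'\<bar> \<Longrightarrow> \<epsilon> \<le> dist y y'"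
      by auto
    have "\<epsilon> \<le> infdist (x t) (level_set a \<nu> S)" if t: "t \<in> J" "0 \<le> t" for t
    proof -
      have "\<delta> \<le> \<bar>\<nu> + quad a (x t)\<bar>"
        using deviation_increases [OF p(2), of t \<omega>] t assms(1) x [OF t(1)] J
        by (simp add: \<delta>_def mult_nonpos_nonneg)
      then have "\<epsilon> \<le> dist (x t) y" if "y \<in> level_set a \<nu> S" for y
        using \<epsilon>(2) [OF that] by (metis dist_commute)
      then show ?thesis
        using level_set_nonempty by (simp add: infdist_def cINF_greatest)
    qed
    then show ?thesis using \<epsilon>(1) max(2) by blast
  qed
  then show ?thesis using sub lim by (simp add: diverges_from_def)
qed

end

section \<open>Topological equivalence for parameters of equal sign\<close>

definition signed_powr :: "real \<Rightarrow> real \<Rightarrow> real" where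
  "signed_powr \<kappa> m = sgn m * \<bar>m\<bar> powr \<kappa>"

lemma abs_signed_powr: "\<bar>signed_powr \<kappa> m\<bar> = \<bar>m\<bar> powr \<kappa>"
  by (cases "m = 0") (auto simp: signed_powr_def abs_mult sgn_if)

lemma signed_powr_inverse: "\<kappa> > 0 \<Longrightarrow> signed_powr (1 / \<kappa>) (signed_powr \<kappa> m) = m"
  unfolding signed_powr_def [of "1 / \<kappa>"] abs_signed_powr
  by (simp add: powr_powr) (simp add: signed_powr_def sgn_mult sgn_if)

lemma signed_powr_scale: "r > 0 \<Longrightarrow> signed_powr \<kappa> (m * r) = signed_powr \<kappa> m * r powr \<kappa>"
  by (simp add: signed_powr_def sgn_mult abs_mult powr_mult)

lemma signed_powr_side:
  assumes "\<kappa> > 0"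
  shows "m > -1 \<Longrightarrow> signed_powr \<kappa> m > -1" and "m < -1 \<Longrightarrow> signed_powr \<kappa> m < -1"
proof -
  show "signed_powr \<kappa> m > -1" if "m > -1"
  proof (cases "m \<ge> 0")
    case True
    then have "signed_powr \<kappa> m \<ge> 0" by (simp add: signed_powr_def)
    then show ?thesis by simp
  next
    case False
    then have "\<bar>m\<bar> powr \<kappa> < 1"
      using powr_less_mono2 [OF assms, of "\<bar>m\<bar>" 1] that by simp
    then show ?thesis using False by (simp add: signed_powr_def)
  qed
  show "signed_powr \<kappa> m < -1" if "m < -1"
  proof -
    have "1 < \<bar>m\<bar> powr \<kappa>"
      using powr_less_mono2 [OF assms, of 1 "\<bar>m\<bar>"] that by simp
    then show ?thesis using that by (simp add: signed_powr_def)
  qed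
qed

lemma signed_powr_ratio_pos:
  assumes "\<kappa> > 0" "m \<noteq> -1"
  shows "(1 + m) / (1 + signed_powr \<kappa> m) > 0"
  using signed_powr_side [OF assms(1), of m] assms(2)
  by (cases "m > -1") (auto simp: zero_less_divide_iff)

lemma continuous_on_signed_powr:
  assumes "\<kappa> > 0"
  shows "continuous_on UNIV (signed_powr \<kappa>)"
proof -
  have "continuous_on ({x. x \<ge> 0} \<union> {x. x \<le> 0}) (\<lambda>m. if m \<ge> 0 then m powr \<kappa> else - ((- m) powr \<kappa>))"
    by (intro continuous_on_If closed_Collect_le continuous_intros continuous_on_powr')
       (use assms in auto)
  moreover have un: "{x. x \<ge> 0} \<union> {x. x \<le> 0} = (UNIV :: real set)" by auto
  moreover have "(\<lambda>m. if m \<ge> 0 then m powr \<kappa> else - ((- m) powr \<kappa>)) = signed_powr \<kappa>"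
    by (auto simp: signed_powr_def fun_eq_iff sgn_if)
  ultimately show ?thesis by (simp only: un)
qed

text \<open>The scalar invariant of a point with \<open>quad a p = q\<close>: along trajectories it is multiplied by
  \<open>exp (- 2 * \<nu> * t)\<close>. It vanishes on the level set, is infinite at the origin and tends to \<open>-1\<close> at infinity.\<close>

definition excess :: "real \<Rightarrow> real \<Rightarrow> real" where
  "excess \<nu> q = - \<nu> / q - 1"

text \<open>The scaling factor for which the excess of the new point at \<open>\<nu>'\<close> is the signed power of the excess of the old
  point at \<open>\<nu>\<close>, since \<open>1 + excess \<nu> q = - \<nu> / q\<close>.\<close>

definition conj_factor :: "real \<Rightarrow> real \<Rightarrow> real \<Rightarrow> real" where
  "conj_factor \<nu> \<nu>' q =
     sqrt (\<nu>' / \<nu> * ((1 + excess \<nu> q) / (1 + signed_powr (\<nu>' / \<nu>) (excess \<nu> q))))"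

definition conj_map :: "('n::finite \<Rightarrow> real) \<Rightarrow> real \<Rightarrow> real \<Rightarrow> 'n phase \<Rightarrow> 'n phase" where
  "conj_map a \<nu> \<nu>' p = conj_factor \<nu> \<nu>' (quad a p) *\<^sub>R p"

lemma conj_map_0 [simp]: "conj_map a \<nu> \<nu>' 0 = 0"
  by (simp add: conj_map_def)

lemma conj_map_in_coord_space: "p \<in> coord_space S \<Longrightarrow> conj_map a \<nu> \<nu>' p \<in> coord_space S"
  by (simp add: conj_map_def coord_space_def)

context
  fixes \<nu> \<nu>' \<kappa> :: real
  assumes \<kappa>_def: "\<kappa> = \<nu>' / \<nu>" and \<kappa>: "\<kappa> > 0" and \<nu>: "\<nu> \<noteq> 0"
begin

lemma excess_ne: "q \<noteq> 0 \<Longrightarrow> excess \<nu> q \<noteq> -1" "1 + excess \<nu> q = - \<nu> / q"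
  using \<nu> by (simp_all add: excess_def)

lemma powr_excess_ne: "q \<noteq> 0 \<Longrightarrow> 1 + signed_powr \<kappa> (excess \<nu> q) \<noteq> 0"
  using signed_powr_ratio_pos [OF \<kappa> excess_ne(1), of q] by auto

lemma conj_factor_squared:
  assumes "q \<noteq> 0"
  shows "conj_factor \<nu> \<nu>' q > 0"
    and "(conj_factor \<nu> \<nu>' q)\<^sup>2 = \<kappa> * ((1 + excess \<nu> q) / (1 + signed_powr \<kappa> (excess \<nu> q)))"
proof -
  have "\<kappa> * ((1 + excess \<nu> q) / (1 + signed_powr \<kappa> (excess \<nu> q))) > 0"
    using signed_powr_ratio_pos [OF \<kappa> excess_ne(1) [OF assms]] \<kappa> by (rule mult_pos_pos [rotated])
  then show "conj_factor \<nu> \<nu>' q > 0"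
    and "(conj_factor \<nu> \<nu>' q)\<^sup>2 = \<kappa> * ((1 + excess \<nu> q) / (1 + signed_powr \<kappa> (excess \<nu> q)))"
    unfolding conj_factor_def \<kappa>_def [symmetric] by (simp_all only: real_sqrt_gt_0_iff real_sqrt_pow2 less_imp_le)
qed

lemma quad_conj_map:
  assumes "quad a p \<noteq> 0"
  shows "quad a (conj_map a \<nu> \<nu>' p) = - \<nu>' / (1 + signed_powr \<kappa> (excess \<nu> (quad a p)))"
  using conj_factor_squared(2) [OF assms] excess_ne(2) [of "quad a p"] assms \<nu>
  by (simp add: conj_map_def quad_scaleR \<kappa>_def)

lemma excess_conj_map:
  assumes "quad a p \<noteq> 0"
  shows "quad a (conj_map a \<nu> \<nu>' p) \<noteq> 0"
    and "excess \<nu>' (quad a (conj_map a \<nu> \<nu>' p)) = signed_powr \<kappa> (excess \<nu> (quad a p))"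
  using powr_excess_ne [OF assms] \<kappa> \<nu> by (auto simp: quad_conj_map [OF assms] \<kappa>_def excess_def)

lemma conj_map_inverse:
  assumes "quad a p \<noteq> 0"
  shows "conj_map a \<nu>' \<nu> (conj_map a \<nu> \<nu>' p) = p"
proof -
  let ?q = "quad a p" and ?q' = "quad a (conj_map a \<nu> \<nu>' p)"
  have inv: "\<nu> / \<nu>' = 1 / \<kappa>" by (simp add: \<kappa>_def)
  have "conj_factor \<nu>' \<nu> ?q' * conj_factor \<nu> \<nu>' ?q = 1"
    unfolding conj_factor_def excess_conj_map(2) [OF assms] inv \<kappa>_def [symmetric] signed_powr_inverse [OF \<kappa>]
      real_sqrt_mult [symmetric]
    using powr_excess_ne [OF assms] excess_ne(1) [OF assms] \<kappa>
    by (simp add: add_eq_0_iff)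
  then show ?thesis by (simp add: conj_map_def [of a \<nu>' \<nu>]) (simp add: conj_map_def)
qed

text \<open>The excess \<open>m\<close> becomes \<open>m * e\<close> after time \<open>t\<close>, and its signed power becomes \<open>m' * e'\<close>. Both sides are multiples
  of the same rotated point, and the squares of the factors agree by the formulas for \<open>z\<close> and \<open>z'\<close> in terms of the
  excess.\<close>

lemma flow_line_conj_map:
  assumes q: "quad a p \<noteq> 0" and t: "t \<in> life_span a \<nu> p"
  shows "t \<in> life_span a \<nu>' (conj_map a \<nu> \<nu>' p)"
    and "conj_map a \<nu> \<nu>' (flow_line \<omega> a \<nu> p t) = flow_line \<omega> a \<nu>' (conj_map a \<nu> \<nu>' p) t"
proof -
  let ?q = "quad a p" and ?q' = "quad a (conj_map a \<nu> \<nu>' p)"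
  define z z' where "z = inv_sq \<nu> ?q t" and "z' = inv_sq \<nu>' ?q' t"
  define m m' e e' where "m = excess \<nu> ?q" and "m' = signed_powr \<kappa> m"
    and "e = exp (- 2 * \<nu> * t)" and "e' = exp (- 2 * \<nu>' * t)"
  have z0: "z > 0" using t by (simp add: life_span_def z_def)
  have \<nu>': "\<nu>' \<noteq> 0" using \<kappa> by (auto simp: \<kappa>_def)
  have m1: "1 + m \<noteq> 0" "1 + m = - \<nu> / ?q" and m1': "1 + m' \<noteq> 0"
    using excess_ne(1) [OF q] excess_ne(2) [of ?q] powr_excess_ne [OF q] by (auto simp: m_def m'_def)
  have q': "?q' = - \<nu>' / (1 + m')" using quad_conj_map [OF q] by (simp add: m_def m'_def)
  have zm: "z * (1 + m) = 1 + m * e"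
  proof -
    have z: "z = (1 + ?q / \<nu>) * e - ?q / \<nu>" using \<nu> by (simp add: z_def inv_sq_def e_def)
    have m: "m = - \<nu> / ?q - 1" by (simp add: m_def excess_def)
    show ?thesis using q \<nu> unfolding z m by (simp add: field_simps)
  qed
  have zm': "z' * (1 + m') = 1 + m' * e'"
  proof -
    have "z' = (1 - 1 / (1 + m')) * e' + 1 / (1 + m')"
      using \<nu>' by (simp add: z'_def inv_sq_def q' e'_def)
    then show ?thesis using m1' by (simp add: field_simps)
  qed
  have "e' = e powr \<kappa>" using \<nu> by (simp add: e_def e'_def \<kappa>_def exp_powr_real [symmetric] powr_def)
  then have me: "signed_powr \<kappa> (m * e) = m' * e'"
    by (simp add: signed_powr_scale m'_def) (simp add: e_def signed_powr_scale)
  have qz: "quad a (flow_line \<omega> a \<nu> p t) = ?q / z" using quad_flow_line [OF t] by (simp add: z_def)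
  have ex: "excess \<nu> (?q / z) = m * e"
  proof -
    have "excess \<nu> (?q / z) = z * (1 + m) - 1" by (simp add: excess_def m1(2))
    then show ?thesis using zm by simp
  qed
  have me1: "1 + m * e \<noteq> 0" using zm z0 m1(1) by auto
  have "(1 + m) / (1 + m') > 0" "(1 + m * e) / (1 + m' * e') > 0"
    using signed_powr_ratio_pos [OF \<kappa>, of m] signed_powr_ratio_pos [OF \<kappa>, of "m * e"] m1(1) me1
    by (auto simp: me add_eq_0_iff simp flip: m'_def)
  moreover have "z' / z = ((1 + m) / (1 + m')) / ((1 + m * e) / (1 + m' * e'))"
  proof -
    have "z = (1 + m * e) / (1 + m)" "z' = (1 + m' * e') / (1 + m')"
      using zm zm' m1(1) m1' by (simp_all add: eq_divide_eq)
    then show ?thesis by (simp add: mult.commute)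
  qed
  ultimately have "z' / z > 0" by (simp only: divide_pos_pos)
  then have z'0: "z' > 0" using z0 by (simp add: zero_less_divide_iff)
  then show "t \<in> life_span a \<nu>' (conj_map a \<nu> \<nu>' p)" by (simp add: life_span_def z'_def)
  have c1: "conj_factor \<nu> \<nu>' (?q / z) > 0" "(conj_factor \<nu> \<nu>' (?q / z))\<^sup>2 = \<kappa> * ((1 + m * e) / (1 + m' * e'))"
    using conj_factor_squared [of "?q / z"] q z0 unfolding ex me by auto
  have c2: "conj_factor \<nu> \<nu>' ?q > 0" "(conj_factor \<nu> \<nu>' ?q)\<^sup>2 = \<kappa> * ((1 + m) / (1 + m'))"
    using conj_factor_squared [of ?q] q unfolding m_def [symmetric] m'_def [symmetric] by auto
  have "conj_factor \<nu> \<nu>' (?q / z) * (1 / sqrt z) = conj_factor \<nu> \<nu>' ?q * (1 / sqrt z')"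
  proof (rule power2_eq_imp_eq)
    have "(conj_factor \<nu> \<nu>' (?q / z) * (1 / sqrt z))\<^sup>2 = \<kappa> * ((1 + m * e) / (1 + m' * e')) / z"
      using z0 by (simp add: power_mult_distrib power_divide c1(2))
    also have "\<dots> = \<kappa> * ((1 + m) / (1 + m')) / z'"
      unfolding zm [symmetric] zm' [symmetric] using z0 z'0 by simp
    also have "\<dots> = (conj_factor \<nu> \<nu>' ?q * (1 / sqrt z'))\<^sup>2"
      using z'0 by (simp add: power_mult_distrib power_divide c2(2))
    finally show "(conj_factor \<nu> \<nu>' (?q / z) * (1 / sqrt z))\<^sup>2 = (conj_factor \<nu> \<nu>' ?q * (1 / sqrt z'))\<^sup>2" .
  qed (use c1 c2 z0 z'0 in auto)
  moreover have "conj_map a \<nu> \<nu>' (flow_line \<omega> a \<nu> p t) $ i =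
      (conj_factor \<nu> \<nu>' (?q / z) * (1 / sqrt z)) *\<^sub>R rot (\<omega> i * t) (p $ i)" for i
    unfolding conj_map_def qz by (simp add: flow_line_def z_def)
  moreover have "flow_line \<omega> a \<nu>' (conj_map a \<nu> \<nu>' p) t $ i =
      (conj_factor \<nu> \<nu>' ?q * (1 / sqrt z')) *\<^sub>R rot (\<omega> i * t) (p $ i)" for i
    unfolding flow_line_def z'_def [symmetric] by (simp add: conj_map_def rot_scaleR)
  ultimately show "conj_map a \<nu> \<nu>' (flow_line \<omega> a \<nu> p t) = flow_line \<omega> a \<nu>' (conj_map a \<nu> \<nu>' p) t"
    by (simp add: vec_eq_iff)
qed

lemma filterlim_signed_powr_at_infinity: "filterlim (signed_powr \<kappa>) at_infinity at_infinity"
proof -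
  have "filterlim (\<lambda>x. exp (\<kappa> * ln x)) at_top at_top"
    by (intro filterlim_compose [OF exp_at_top] filterlim_tendsto_pos_mult_at_top [OF tendsto_const \<kappa>] ln_at_top)
  moreover have "\<forall>\<^sub>F x in at_top. exp (\<kappa> * ln x) = x powr \<kappa>"
    using eventually_gt_at_top [of "0::real"] by eventually_elim (simp add: powr_def)
  ultimately have "filterlim (\<lambda>x. x powr \<kappa>) at_top at_top"
    by (rule filterlim_cong [OF refl refl, THEN iffD1, rotated])
  from filterlim_compose [OF this filterlim_norm_at_top [where 'a = real]]
  have "filterlim (\<lambda>m. \<bar>m\<bar> powr \<kappa>) at_top (at_infinity :: real filter)" by simp
  then have "filterlim (\<lambda>m. norm (signed_powr \<kappa> m)) at_top at_infinity"
    by (simp add: abs_signed_powr)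
  then show ?thesis by (rule filterlim_norm_at_top_imp_at_infinity)
qed

text \<open>As the point approaches the origin, the excess and hence its signed power tend to infinity, so the new value
  of \<open>quad a\<close> tends to zero.\<close>

lemma conj_quad_tendsto_0: "((\<lambda>q. - \<nu>' / (1 + signed_powr \<kappa> (excess \<nu> q))) \<longlongrightarrow> 0) (at 0)"
proof -
  have "filterlim (\<lambda>q. - \<nu> * inverse q + (-1)) at_infinity (at (0::real))"
    using \<nu> by (intro tendsto_add_filterlim_at_infinity' [OF _ tendsto_const]
      tendsto_mult_filterlim_at_infinity [OF tendsto_const] filterlim_inverse_at_infinity) simp
  then have "filterlim (excess \<nu>) at_infinity (at 0)"
    by (simp add: excess_def [abs_def] divide_inverse)
  then have "filterlim (\<lambda>q. 1 + signed_powr \<kappa> (excess \<nu> q)) at_infinity (at 0)"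
    by (intro tendsto_add_filterlim_at_infinity [OF tendsto_const]
        filterlim_compose [OF filterlim_signed_powr_at_infinity])
  then show ?thesis by (intro tendsto_divide_0 [OF tendsto_const])
qed

end

context
  fixes a :: "'n::finite \<Rightarrow> real" and S :: "'n set"
  assumes dfn: "(\<forall>i\<in>S. a i > 0) \<or> (\<forall>i\<in>S. a i < 0)"
begin

lemma quad_eq_0_iff: "p \<in> coord_space S \<Longrightarrow> quad a p = 0 \<longleftrightarrow> p = 0"
  using norm_squared_le_quad [OF dfn, of p] by (auto simp: quad_def)

text \<open>At the origin the scaling factor itself may be unbounded. Continuity holds because \<open>quad a\<close> of the image tends
  to zero and controls the norm.\<close>

lemma continuous_on_conj_map:
  assumes \<kappa>: "\<nu>' / \<nu> > 0"
  shows "continuous_on (coord_space S) (conj_map a \<nu> \<nu>')"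
  unfolding continuous_on_eq_continuous_within
proof
  fix p assume p: "p \<in> coord_space S"
  let ?M = "coord_space S" and ?\<kappa> = "\<nu>' / \<nu>"
  have \<nu>: "\<nu> \<noteq> 0" using \<kappa> by auto
  have qlim: "(quad a \<longlongrightarrow> quad a p) (at p within ?M)"
    using continuous_on_quad [of ?M a] p by (simp add: continuous_on_def)
  show "continuous (at p within ?M) (conj_map a \<nu> \<nu>')"
  proof (cases "p = 0")
    case False
    then have q: "quad a p \<noteq> 0" using quad_eq_0_iff [OF p] by simp
    have ex: "((\<lambda>x. excess \<nu> (quad a x)) \<longlongrightarrow> excess \<nu> (quad a p)) (at p within ?M)"
      unfolding excess_def using q by (intro tendsto_intros qlim)
    have "isCont (signed_powr ?\<kappa>) m" for m
      using continuous_on_signed_powr [OF \<kappa>] by (simp add: continuous_on_eq_continuous_at)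
    then have "((\<lambda>x. signed_powr ?\<kappa> (excess \<nu> (quad a x))) \<longlongrightarrow> signed_powr ?\<kappa> (excess \<nu> (quad a p))) (at p within ?M)"
      using isCont_tendsto_compose ex by blast
    then show ?thesis
      unfolding continuous_within conj_map_def conj_factor_def
      using powr_excess_ne [OF refl \<kappa> \<nu> q] by (intro tendsto_intros ex)
  next
    case True
    have "filterlim (quad a) (at 0) (at 0 within ?M)"
      unfolding filterlim_at
    proof
      show "\<forall>\<^sub>F x in at 0 within ?M. quad a x \<in> UNIV \<and> quad a x \<noteq> 0"
        by (auto simp: eventually_at_filter quad_eq_0_iff)
      show "(quad a \<longlongrightarrow> 0) (at 0 within ?M)" using qlim True by (simp add: quad_def)
    qed
    then have "((\<lambda>x. - \<nu>' / (1 + signed_powr ?\<kappa> (excess \<nu> (quad a x)))) \<longlongrightarrow> 0) (at 0 within ?M)"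
      using filterlim_compose conj_quad_tendsto_0 [OF refl \<kappa> \<nu>] by blast
    moreover have "\<forall>\<^sub>F x in at 0 within ?M. - \<nu>' / (1 + signed_powr ?\<kappa> (excess \<nu> (quad a x))) = quad a (conj_map a \<nu> \<nu>' x)"
      using quad_conj_map [OF refl \<kappa> \<nu>, of a] quad_eq_0_iff
      unfolding eventually_at_filter by (intro always_eventually) auto
    ultimately have "((\<lambda>x. quad a (conj_map a \<nu> \<nu>' x)) \<longlongrightarrow> 0) (at 0 within ?M)"
      by (rule Lim_transform_eventually)
    then have "((\<lambda>x. sqrt ((\<Sum>i\<in>S. 1 / \<bar>a i\<bar>) * \<bar>quad a (conj_map a \<nu> \<nu>' x)\<bar>)) \<longlongrightarrow> sqrt ((\<Sum>i\<in>S. 1 / \<bar>a i\<bar>) * \<bar>0\<bar>)) (at 0 within ?M)"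
      by (intro tendsto_intros)
    moreover have "\<forall>\<^sub>F x in at 0 within ?M. norm (conj_map a \<nu> \<nu>' x) \<le> sqrt ((\<Sum>i\<in>S. 1 / \<bar>a i\<bar>) * \<bar>quad a (conj_map a \<nu> \<nu>' x)\<bar>)"
      using norm_squared_le_quad [OF dfn conj_map_in_coord_space]
      by (auto simp: eventually_at_filter intro!: always_eventually real_le_rsqrt)
    ultimately have "(conj_map a \<nu> \<nu>' \<longlongrightarrow> 0) (at 0 within ?M)"
      by (intro Lim_null_comparison [where f = "conj_map a \<nu> \<nu>'"]) auto
    then show ?thesis by (simp add: True continuous_within)
  qed
qed

lemma solution_conj_map:
  assumes \<kappa>: "\<nu>' / \<nu> > 0" and sol: "solution (euler_field \<omega> a \<nu>) J x" and M: "x ` J \<subseteq> coord_space S"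
  shows "solution (euler_field \<omega> a \<nu>') J (\<lambda>t. conj_map a \<nu> \<nu>' (x t))"
proof -
  have J: "open J" "is_interval J" "J \<noteq> {}" using sol by (auto simp: solution_def)
  then obtain s where s: "s \<in> J" by blast
  have \<nu>: "\<nu> \<noteq> 0" using \<kappa> by auto
  define p where "p = conj_map a \<nu> \<nu>' (x s)"
  have step: "t - s \<in> life_span a \<nu>' p" "conj_map a \<nu> \<nu>' (x t) = flow_line \<omega> a \<nu>' p (t - s)" if t: "t \<in> J" for t
  proof -
    have L: "t - s \<in> life_span a \<nu> (x s)" and x: "x t = flow_line \<omega> a \<nu> (x s) (t - s)"
      using solution_eq_flow_line [OF sol s t] by auto
    have "t - s \<in> life_span a \<nu>' p \<and> conj_map a \<nu> \<nu>' (x t) = flow_line \<omega> a \<nu>' p (t - s)"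
    proof (cases "x s = 0")
      case True
      have "flow_line \<omega> a \<mu> 0 u = 0" for \<mu> u by (simp add: flow_line_def vec_eq_iff)
      moreover have "u \<in> life_span a \<mu> 0" for \<mu> u by (simp add: life_span_def quad_def inv_sq_def)
      ultimately show ?thesis by (simp add: x p_def True)
    next
      case False
      then have "quad a (x s) \<noteq> 0" using quad_eq_0_iff M s by blast
      then show ?thesis using flow_line_conj_map [OF refl \<kappa> \<nu> _ L] by (simp add: x p_def)
    qed
    then show "t - s \<in> life_span a \<nu>' p" "conj_map a \<nu> \<nu>' (x t) = flow_line \<omega> a \<nu>' p (t - s)" by auto
  qed
  have "((\<lambda>t. conj_map a \<nu> \<nu>' (x t)) has_vector_derivative euler_field \<omega> a \<nu>' (conj_map a \<nu> \<nu>' (x t))) (at t)"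
    if t: "t \<in> J" for t
  proof -
    have "(flow_line \<omega> a \<nu>' p has_vector_derivative euler_field \<omega> a \<nu>' (flow_line \<omega> a \<nu>' p (t - s))) (at (t - s))"
      using solution_flow_line [of \<omega> a \<nu>' p] step(1) [OF t] by (simp add: solution_def)
    moreover have "((\<lambda>t. t - s) has_vector_derivative 1) (at t)"
      by (auto intro!: derivative_eq_intros)
    ultimately have "((\<lambda>t. flow_line \<omega> a \<nu>' p (t - s)) has_vector_derivative
        euler_field \<omega> a \<nu>' (flow_line \<omega> a \<nu>' p (t - s))) (at t)"
      using vector_diff_chain_at [of "\<lambda>t. t - s" 1 t "flow_line \<omega> a \<nu>' p"] by (simp add: o_def)
    then have "((\<lambda>t. conj_map a \<nu> \<nu>' (x t)) has_vector_derivative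
        euler_field \<omega> a \<nu>' (flow_line \<omega> a \<nu>' p (t - s))) (at t)"
      by (rule has_vector_derivative_transform_within_open [OF _ J(1) t]) (simp add: step(2))
    then show ?thesis by (simp add: step(2) [OF t])
  qed
  then show ?thesis using J by (simp add: solution_def)
qed

lemma solution_stays_in_coord_space:
  assumes sol: "solution (euler_field \<omega> a \<nu>) J x" and "s \<in> J" "x s \<in> coord_space A" "t \<in> J"
  shows "x t \<in> coord_space A"
  using solution_eq_flow_line(2) [OF sol assms(2,4)] flow_line_in_coord_space [OF assms(3)] by simp

text \<open>The conjugating map and its inverse, which is the map with the parameters exchanged, carry solutions to
  solutions with the same time. Hence a proper extension of the image of a maximal solution would give a proper
  extension of the solution.\<close>

lemma topologically_equivalent_same_sign:
  assumes \<kappa>: "\<nu>' / \<nu> > 0"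
  shows "topologically_equivalent (coord_space S) (euler_field \<omega> a \<nu>) (euler_field \<omega> a \<nu>')"
proof -
  let ?M = "coord_space S" and ?h = "conj_map a \<nu> \<nu>'" and ?h' = "conj_map a \<nu>' \<nu>"
  have \<nu>: "\<nu> \<noteq> 0" "\<nu>' \<noteq> 0" and \<kappa>': "\<nu> / \<nu>' > 0" using \<kappa> by (auto simp: zero_less_divide_iff)
  have inv: "?h' (?h p) = p" if "p \<in> ?M" for p
    using conj_map_inverse [OF refl \<kappa> \<nu>(1), of a p] quad_eq_0_iff [OF that] by (cases "p = 0") auto
  have inv': "?h (?h' p) = p" if "p \<in> ?M" for p
    using conj_map_inverse [OF refl \<kappa>' \<nu>(2), of a p] quad_eq_0_iff [OF that] by (cases "p = 0") auto
  have hom: "homeomorphism ?M ?M ?h ?h'"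
    by (rule homeomorphismI)
       (auto simp: inv inv' conj_map_in_coord_space continuous_on_conj_map \<kappa> \<kappa>')
  have "maximal_solution (euler_field \<omega> a \<nu>') J (\<lambda>t. ?h (x t))"
    if max: "maximal_solution (euler_field \<omega> a \<nu>) J x" and M: "x ` J \<subseteq> ?M" for J x
    unfolding maximal_solution_def
  proof (intro conjI allI impI)
    have sol: "solution (euler_field \<omega> a \<nu>) J x" using max by (simp add: maximal_solution_def)
    then show "solution (euler_field \<omega> a \<nu>') J (\<lambda>t. ?h (x t))" by (rule solution_conj_map [OF \<kappa> _ M])
    fix J' y
    assume *: "solution (euler_field \<omega> a \<nu>') J' y \<and> J \<subseteq> J' \<and> (\<forall>t\<in>J. y t = ?h (x t))"
    obtain s where s: "s \<in> J" using sol by (auto simp: solution_def)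
    have "x s \<in> ?M" using M s by blast
    then have "y s \<in> ?M" using * s conj_map_in_coord_space [of "x s" S] by simp
    moreover have "s \<in> J'" using s * by blast
    ultimately have "y ` J' \<subseteq> ?M" using solution_stays_in_coord_space * by blast
    then have "solution (euler_field \<omega> a \<nu>) J' (\<lambda>t. ?h' (y t))"
      using solution_conj_map [OF \<kappa>'] * by blast
    moreover have "\<forall>t\<in>J. ?h' (y t) = x t" using * inv M by auto
    ultimately show "J' = J" using max * unfolding maximal_solution_def by blast
  qed
  then have "\<exists>J' y \<tau>. maximal_solution (euler_field \<omega> a \<nu>') J' y \<and> strict_mono_on J \<tau> \<and> \<tau> ` J = J' \<and>
              (\<forall>t\<in>J. y (\<tau> t) = ?h (x t))"
    if "maximal_solution (euler_field \<omega> a \<nu>) J x \<and> x ` J \<subseteq> ?M" for J x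
    using that by (intro exI [of _ J] exI [of _ "\<lambda>t. ?h (x t)"] exI [of _ "\<lambda>t. t"]) (auto simp: strict_mono_on_def)
  then show ?thesis
    unfolding topologically_equivalent_def using hom by blast
qed

section \<open>The bifurcation at the origin\<close>

text \<open>A homeomorphism respecting orbits pulls the compact invariant level set back to a compact set that contains
  the \<open>\<nu> = 0\<close> trajectory of each of its points. Since only the origin has a bounded trajectory there, the level set
  would be a single point, but it contains \<open>y\<close> and \<open>- y\<close>.\<close>

lemma not_topologically_equivalent_zero:
  assumes ne: "S \<noteq> {}" and opposite: "\<And>i. i \<in> S \<Longrightarrow> a i * \<nu>' < 0"
  shows "\<not> topologically_equivalent (coord_space S) (euler_field \<omega> a 0) (euler_field \<omega> a \<nu>')"
proof
  let ?M = "coord_space S" and ?K = "level_set a \<nu>' S"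
  assume "topologically_equivalent ?M (euler_field \<omega> a 0) (euler_field \<omega> a \<nu>')"
  then obtain h h' where hom: "homeomorphism ?M ?M h h'"
    and orb: "\<And>J x. maximal_solution (euler_field \<omega> a 0) J x \<and> x ` J \<subseteq> ?M \<Longrightarrow>
           (\<exists>J' y \<tau>. maximal_solution (euler_field \<omega> a \<nu>') J' y \<and> strict_mono_on J \<tau> \<and> \<tau> ` J = J' \<and>
              (\<forall>t\<in>J. y (\<tau> t) = h (x t)))"
    unfolding topologically_equivalent_def by metis
  have KM: "?K \<subseteq> ?M" by (auto simp: level_set_def)
  have "compact (h' ` ?K)"
    using compact_level_set [of S a \<nu>', OF opposite]
    by (intro compact_continuous_image continuous_on_subset [OF homeomorphism_cont2 [OF hom] KM]) auto
  then obtain B where B: "\<And>y. y \<in> ?K \<Longrightarrow> norm (h' y) \<le> B"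
    using compact_imp_bounded [of "h' ` level_set a \<nu>' S"] unfolding bounded_iff by blast
  have zero: "h' y = 0" if y: "y \<in> ?K" for y
  proof (rule ccontr)
    assume nz: "h' y \<noteq> 0"
    define p where "p = h' y"
    have pM: "p \<in> ?M" and hp: "h p = y"
      unfolding p_def using hom y KM by (metis homeomorphism_def imageI subsetD)+
    let ?x = "flow_line \<omega> a 0 p" and ?J = "life_span a 0 p"
    have "?x ` ?J \<subseteq> ?M" using flow_line_in_coord_space [OF pM] by blast
    then obtain J' z \<tau> where z: "maximal_solution (euler_field \<omega> a \<nu>') J' z" "\<tau> ` ?J = J'"
      "\<forall>t\<in>?J. z (\<tau> t) = h (?x t)"
      using orb [of ?J ?x] maximal_solution_flow_line by blast
    have "solution (euler_field \<omega> a \<nu>') J' z" using z(1) by (simp add: maximal_solution_def)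
    moreover have "z (\<tau> 0) \<in> ?K" "\<tau> 0 \<in> J'" using z(2,3) y hp by auto
    ultimately have zK: "\<forall>u\<in>J'. z u \<in> ?K"
      using flow_invariant_level_set [of \<omega> a \<nu>' S] unfolding flow_invariant_def by blast
    have "quad a p \<noteq> 0" using nz quad_eq_0_iff [OF pM] by (simp add: p_def)
    then obtain t where t: "t \<in> ?J" "norm (?x t) > B" using orbit_unbounded [of a p 0 B \<omega>] by auto
    have "h (?x t) \<in> ?K" using z t(1) zK by (metis imageI)
    moreover have "h' (h (?x t)) = ?x t"
      using hom flow_line_in_coord_space [OF pM] by (auto simp: homeomorphism_def)
    ultimately show False using B t(2) by fastforce
  qed
  obtain y where y: "y \<in> ?K" using level_set_nonempty [of S a \<nu>', OF opposite ne] by blast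
  then have my: "- y \<in> ?K" by (simp add: level_set_def coord_space_def quad_def)
  have "h' y = h' (- y)" using zero y my by simp
  then have "y = - y" using hom y my KM unfolding homeomorphism_def by (metis subsetD)
  then have "y + y = 0" by (metis add.right_inverse)
  then have "2 *\<^sub>R y = 0" by (simp only: scaleR_2)
  then have "y = 0" by simp
  then show False using y level_set_nonzero [of S a \<nu>', OF opposite ne] by blast
qed

lemma cell_bifurcation_variety_coord_space:
  assumes ne: "S \<noteq> {}"
  shows "cell_bifurcation_variety (coord_space S) (euler_field \<omega> a) = {\<nu>. \<nu> = 0}"
proof -
  have "\<forall>\<^sub>F \<nu>' in nhds \<nu>. topologically_equivalent (coord_space S) (euler_field \<omega> a \<nu>) (euler_field \<omega> a \<nu>')"
    if "\<nu> \<noteq> 0" for \<nu>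
  proof -
    have "((\<lambda>x. x / \<nu>) \<longlongrightarrow> \<nu> / \<nu>) (nhds \<nu>)"
      using that by (intro tendsto_intros filterlim_ident) 
    then have "\<forall>\<^sub>F \<nu>' in nhds \<nu>. \<nu>' / \<nu> > 0"
      using that by (intro order_tendstoD(1) [of _ "\<nu> / \<nu>"]) auto
    then show ?thesis by (rule eventually_mono) (rule topologically_equivalent_same_sign)
  qed
  moreover have "\<not> (\<forall>\<^sub>F \<nu>' in nhds 0. topologically_equivalent (coord_space S) (euler_field \<omega> a 0) (euler_field \<omega> a \<nu>'))"
  proof
    assume "\<forall>\<^sub>F \<nu>' in nhds 0. topologically_equivalent (coord_space S) (euler_field \<omega> a 0) (euler_field \<omega> a \<nu>')"
    then obtain d where d: "d > 0" "\<And>\<nu>'. dist \<nu>' 0 < d \<Longrightarrow> topologically_equivalent (coord_space S) (euler_field \<omega> a 0) (euler_field \<omega> a \<nu>')"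
      unfolding eventually_nhds_metric by blast
    from dfn show False
    proof
      assume "\<forall>i\<in>S. a i > 0"
      then show False
        using not_topologically_equivalent_zero [OF ne, of "- (d / 2)" \<omega>] d by (auto simp: mult_pos_pos)
    next
      assume "\<forall>i\<in>S. a i < 0"
      then show False
        using not_topologically_equivalent_zero [OF ne, of "d / 2" \<omega>] d by (auto simp: mult_neg_pos)
    qed
  qed
  ultimately show ?thesis unfolding cell_bifurcation_variety_def by blast
qed

end

section \<open>The bifurcation theorem\<close>

lemma level_set_shrinks:
  fixes a :: "'n::finite \<Rightarrow> real"
  assumes dfn: "(\<forall>i\<in>S. a i > 0) \<or> (\<forall>i\<in>S. a i < 0)" and "\<epsilon> > 0"
  shows "\<exists>\<delta>>0. \<forall>\<nu>. \<bar>\<nu>\<bar> < \<delta> \<longrightarrow> level_set a \<nu> S \<subseteq> ball 0 \<epsilon>"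
proof -
  define c where "c = (\<Sum>i\<in>S. 1 / \<bar>a i\<bar>) + 1"
  have c: "c > 0" by (auto simp: c_def intro!: add_nonneg_pos sum_nonneg)
  have "norm p < \<epsilon>" if "\<bar>\<nu>\<bar> < \<epsilon>\<^sup>2 / c" "p \<in> level_set a \<nu> S" for \<nu> p
  proof -
    have "p \<in> coord_space S" "\<bar>quad a p\<bar> = \<bar>\<nu>\<bar>" using that(2) by (auto simp: level_set_def add_eq_0_iff)
    then have "(norm p)\<^sup>2 \<le> (c - 1) * \<bar>\<nu>\<bar>" using norm_squared_le_quad [OF dfn, of p] by (simp add: c_def)
    also have "\<dots> \<le> c * \<bar>\<nu>\<bar>" by (intro mult_right_mono) auto
    also have "\<dots> < \<epsilon>\<^sup>2" using that(1) c by (simp add: pos_less_divide_eq mult.commute)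
    finally show ?thesis using \<open>\<epsilon> > 0\<close> by (simp add: power_less_imp_less_base)
  qed
  moreover have "\<epsilon>\<^sup>2 / c > 0" using \<open>\<epsilon> > 0\<close> c by simp
  ultimately show ?thesis by (intro exI [of _ "\<epsilon>\<^sup>2 / c"]) auto
qed

lemma compact_invariant_subset_zero:
  assumes nonneg: "\<And>p. p \<in> M \<Longrightarrow> p \<noteq> 0 \<Longrightarrow> quad a p \<noteq> 0 \<and> \<nu> * quad a p \<ge> 0"
    and A: "A \<subseteq> M" "flow_invariant (euler_field \<omega> a \<nu>) A" "bounded A"
  shows "A \<subseteq> {0}"
proof
  fix p assume p: "p \<in> A"
  obtain B where B: "\<And>x. x \<in> A \<Longrightarrow> norm x \<le> B" using A(3) unfolding bounded_iff by blast
  show "p \<in> {0}"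
  proof (rule ccontr)
    assume "p \<notin> {0}"
    then have "quad a p \<noteq> 0" "\<nu> * quad a p \<ge> 0" using nonneg A(1) p by auto
    then obtain t where t: "t \<in> life_span a \<nu> p" "norm (flow_line \<omega> a \<nu> p t) > B"
      using orbit_unbounded by blast
    have "flow_line \<omega> a \<nu> p 0 \<in> A" using p by simp
    then have "flow_line \<omega> a \<nu> p t \<in> A"
      using A(2) solution_flow_line [of \<omega> a \<nu> p] t(1) zero_in_life_span [of a \<nu> p]
      unfolding flow_invariant_def by blast
    then show False using B t(2) by fastforce
  qed
qed

lemma polar_form:
  fixes v :: "real \<times> real"
  obtains \<theta> where "v = norm v *\<^sub>R (cos \<theta>, sin \<theta>)"
proof (cases "v = 0")
  case False
  then have "(fst v / norm v)\<^sup>2 + (snd v / norm v)\<^sup>2 = 1"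
    unfolding power_divide add_divide_distrib [symmetric] norm_prod_squared [symmetric] by simp
  then obtain \<theta> where "fst v / norm v = cos \<theta>" "snd v / norm v = sin \<theta>"
    using sincos_total_2pi by metis
  then have "v = norm v *\<^sub>R (cos \<theta>, sin \<theta>)"
    using False by (cases v) (auto simp: field_simps)
  then show thesis using that by blast
qed (use that in \<open>auto simp: zero_prod_def\<close>)

lemma flow_line_frequency:
  fixes p :: "'n::finite phase"
  obtains \<theta> where "\<And>t. t \<in> life_span a \<nu> p \<Longrightarrow>
    flow_line \<omega> a \<nu> p t $ i = norm (flow_line \<omega> a \<nu> p t $ i) *\<^sub>R (cos (\<omega> i * t + \<theta>), sin (\<omega> i * t + \<theta>))"
proof -
  obtain \<theta> where \<theta>: "p $ i = norm (p $ i) *\<^sub>R (cos \<theta>, sin \<theta>)" by (rule polar_form)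
  have "flow_line \<omega> a \<nu> p t $ i = norm (flow_line \<omega> a \<nu> p t $ i) *\<^sub>R (cos (\<omega> i * t + \<theta>), sin (\<omega> i * t + \<theta>))"
    if t: "t \<in> life_span a \<nu> p" for t
  proof -
    have "rot (\<omega> i * t) (p $ i) = norm (p $ i) *\<^sub>R (cos (\<omega> i * t + \<theta>), sin (\<omega> i * t + \<theta>))"
      by (subst \<theta>, subst rot_scaleR) (simp add: rot_def cos_add sin_add algebra_simps)
    then show ?thesis
      unfolding norm_flow_line [OF t] by (simp add: flow_line_def)
  qed
  then show thesis using that by blast
qed

lemma flow_line_radial_velocity:
  assumes t: "t \<in> life_span a \<nu> p"
  shows "((\<lambda>t. norm (flow_line \<omega> a \<nu> p t $ i)) has_real_derivative
    norm (flow_line \<omega> a \<nu> p t $ i) * (\<nu> + quad a (flow_line \<omega> a \<nu> p t))) (at t)"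
proof -
  let ?z = "inv_sq \<nu> (quad a p)"
  have z: "?z t > 0" using t by (simp add: life_span_def)
  have "((\<lambda>t. norm (p $ i) / sqrt (?z t)) has_real_derivative
      norm (p $ i) / sqrt (?z t) * (\<nu> + quad a p / ?z t)) (at t)"
    using z by (auto intro!: derivative_eq_intros inv_sq_derivative simp: field_simps)
  then show ?thesis
    unfolding norm_flow_line [OF t] quad_flow_line [OF t]
    by (rule has_field_derivative_transform_within_open [OF _ open_life_span t]) (simp add: norm_flow_line)
qed

text \<open>On a leaf the ratios of the amplitudes are constant, so \<open>quad a\<close> is a multiple of the square of any one of them.\<close>

lemma leaf_radial_velocity:
  fixes p :: "'n::finite phase"
  assumes leaf: "\<And>i. norm (p $ i) = r * C $ i" and r: "r > 0" and j: "C $ j \<noteq> 0"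
    and t: "t \<in> life_span a \<nu> p"
  shows "norm (flow_line \<omega> a \<nu> p t $ i) * (\<nu> + quad a (flow_line \<omega> a \<nu> p t)) =
    C $ i / C $ j * norm (flow_line \<omega> a \<nu> p t $ j) *
      (\<nu> + (norm (flow_line \<omega> a \<nu> p t $ j))\<^sup>2 * (\<Sum>m\<in>UNIV. a m * ((C $ m)\<^sup>2 / (C $ j)\<^sup>2)))"
proof -
  define R where "R = norm (flow_line \<omega> a \<nu> p t $ j)"
  have n: "norm (flow_line \<omega> a \<nu> p t $ m) = C $ m / C $ j * R" for m
    using j by (simp add: R_def norm_flow_line [OF t] leaf)
  have "quad a (flow_line \<omega> a \<nu> p t) = R\<^sup>2 * (\<Sum>m\<in>UNIV. a m * ((C $ m)\<^sup>2 / (C $ j)\<^sup>2))"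
    by (simp add: quad_def n power_mult_distrib power_divide sum_distrib_left algebra_simps)
  then show ?thesis by (simp add: n flip: R_def)
qed

theorem theorem6p8:
  fixes k :: nat and \<sigma> :: "nat \<Rightarrow> 'n::{finite,linorder}" and \<omega> a :: "'n \<Rightarrow> real"
  assumes "1 < k" and "k \<le> CARD('n)" and "\<sigma> \<in> perms_S k"
    and "\<And>i. \<omega> i \<noteq> 0" and "\<And>i j. i < j \<Longrightarrow> \<omega> i / \<omega> j \<notin> \<rat>"
    and "\<And>i j. 1 \<le> i \<Longrightarrow> i < j \<Longrightarrow> j \<le> k \<Longrightarrow> sgn (a (\<sigma> j) * a (\<sigma> i)) = 1"
  shows
    "cell_bifurcation_variety (closure (cell_M k \<sigma>)) (euler_field \<omega> a) = {\<nu>. \<nu> = 0} \<and>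
     (\<exists>(K :: real \<Rightarrow> 'n phase set)
       (T :: real \<Rightarrow> nat \<times> (nat \<Rightarrow> 'n) \<Rightarrow> 'n phase set) \<phi>.
       (\<forall>\<nu>. a (\<sigma> k) * \<nu> < 0 \<longrightarrow>
          K \<nu> \<subseteq> closure (cell_M k \<sigma>) - {0} \<and>
          flow_invariant (euler_field \<omega> a \<nu>) (K \<nu>) \<and>
          (\<forall>c\<in>cell_index k \<sigma>. flow_invariant (euler_field \<omega> a \<nu>) (T \<nu> c)) \<and>
          toral_CW_complex (top_of_set (closure (pos_sphere k \<sigma>))) (cell_index k \<sigma>) sphere_cell fst \<phi>
            circle_labels (top_of_set (K \<nu>)) (T \<nu>) \<and>
          (\<exists>h. homeomorphic_map (top_of_set (K \<nu>)) (X_space k \<sigma>) h \<and>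
             (\<forall>c\<in>cell_index k \<sigma>. h ` T \<nu> c = X_cell k \<sigma> c)) \<and>
          (a (\<sigma> k) < 0 \<longrightarrow>
             asymptotically_stable (euler_field \<omega> a \<nu>) (closure (cell_M k \<sigma>)) (K \<nu>)) \<and>
          (\<not> a (\<sigma> k) < 0 \<longrightarrow>
             \<not> lyapunov_stable (euler_field \<omega> a \<nu>) (closure (cell_M k \<sigma>)) (K \<nu>)) \<and>
          (\<forall>C\<in>pos_sphere k \<sigma>. \<forall>J x.
             maximal_solution (euler_field \<omega> a \<nu>) J x \<and> 0 \<in> J \<and> x 0 \<in> leaf_M k \<sigma> C \<longrightarrow>
               (a (\<sigma> k) < 0 \<longrightarrow> converges_to (K \<nu>) J x) \<and>
               (\<not> a (\<sigma> k) < 0 \<longrightarrow> diverges_from (K \<nu>) J x) \<and>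
               (\<forall>i\<in>{1..k}.
                  (\<exists>\<theta>. \<forall>t\<in>J. x t $ \<sigma> i = norm (x t $ \<sigma> i) *\<^sub>R
                     (cos (2 * pi * (\<omega> (\<sigma> i) / (2 * pi)) * t + \<theta>),
                      sin (2 * pi * (\<omega> (\<sigma> i) / (2 * pi)) * t + \<theta>))) \<and>
                  (\<forall>t\<in>J. ((\<lambda>t. norm (x t $ \<sigma> i)) has_real_derivative
                     C $ \<sigma> i / C $ \<sigma> k * norm (x t $ \<sigma> k) *
                     (\<nu> + (norm (x t $ \<sigma> k))\<^sup>2 * (\<Sum>j\<in>UNIV. a j * ((C $ j)\<^sup>2 / (C $ \<sigma> k)\<^sup>2))))
                     (at t))))) \<and>
       (\<forall>\<epsilon>>0. \<exists>\<delta>>0. \<forall>\<nu>. a (\<sigma> k) * \<nu> < 0 \<and> \<bar>\<nu>\<bar> < \<delta> \<longrightarrow> K \<nu> \<subseteq> ball 0 \<epsilon>)) \<and>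
     (\<forall>\<nu>. \<not> a (\<sigma> k) * \<nu> < 0 \<longrightarrow>
        \<not> (\<exists>A \<subseteq> closure (cell_M k \<sigma>). flow_invariant (euler_field \<omega> a \<nu>) A \<and>
             top_of_set A homeomorphic_space X_space k \<sigma>))"
proof -
  define S where "S = \<sigma> ` {1..k}"
  have k0: "0 < k" and kn: "k \<le> CARD('n)" and \<sigma>: "\<sigma> \<in> perms_S k" using assms by auto
  have M: "closure (cell_M k \<sigma>) = coord_space S"
    unfolding S_def by (rule closure_cell_M [OF \<sigma> kn])
  have S: "S \<noteq> {}" "\<sigma> k \<in> S" using k0 by (auto simp: S_def)
  have pos: "a (\<sigma> j) * a (\<sigma> i) > 0" if "1 \<le> i" "i < j" "j \<le> k" for i j
    using assms(6) [OF that] by (simp add: sgn_1_pos)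
  \<comment> \<open>Since \<open>k > 1\<close>, the sign condition excludes \<open>a (\<sigma> k) = 0\<close>.\<close>
  have ak: "a (\<sigma> k) \<noteq> 0" using pos [of 1 k] assms(1) by auto
  have same: "a i * a (\<sigma> k) > 0" if i: "i \<in> S" for i
  proof -
    obtain m where "m \<in> {1..k}" "i = \<sigma> m" using i unfolding S_def by blast
    then have m: "i = \<sigma> m" "1 \<le> m" "m \<le> k" by auto
    then show ?thesis using pos [of m k] ak by (cases "m = k") (auto simp: mult.commute zero_less_mult_iff)
  qed
  have dfn: "(\<forall>i\<in>S. a i > 0) \<or> (\<forall>i\<in>S. a i < 0)"
    using same ak by (cases "a (\<sigma> k) > 0") (auto simp: zero_less_mult_iff)
  have opp: "a i * \<nu> < 0" if "a (\<sigma> k) * \<nu> < 0" "i \<in> S" for i \<nu>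
    using same [OF that(2)] that(1) by (auto simp: zero_less_mult_iff mult_less_0_iff)
  have hX: "\<exists>h. homeomorphic_map (top_of_set (level_set a \<nu> S)) (X_space k \<sigma>) h \<and>
     (\<forall>c\<in>cell_index k \<sigma>. h ` level_cell a \<nu> (circle_labels c) = X_cell k \<sigma> c)" if "a (\<sigma> k) * \<nu> < 0" for \<nu>
    unfolding S_def
    by (rule homeomorphic_map_level_set_X_space [OF \<sigma> k0 kn]) (use opp [OF that] in \<open>simp add: S_def\<close>)
  have leaf: "p \<in> coord_space S" "\<nu> * quad a p < 0"
    if a\<nu>: "a (\<sigma> k) * \<nu> < 0" and p: "p \<in> leaf_M k \<sigma> C" for \<nu> p C
  proof -
    have cell: "p \<in> cell_M k \<sigma>" using p by (simp add: leaf_M_def)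
    then show "p \<in> coord_space S" using closure_subset M by blast
    moreover have "p $ \<sigma> k \<noteq> 0" using cell k0 by (simp add: cell_M_def)
    then have "p \<noteq> 0" by auto
    ultimately show "\<nu> * quad a p < 0" using quad_sign [of S a \<nu>, OF opp [OF a\<nu>]] by blast
  qed
  define T where "T = (\<lambda>\<nu> (c :: nat \<times> (nat \<Rightarrow> 'n)). level_cell a \<nu> (circle_labels c))"
  have no_manifold: "\<not> (\<exists>A \<subseteq> coord_space S. flow_invariant (euler_field \<omega> a \<nu>) A \<and>
      top_of_set A homeomorphic_space X_space k \<sigma>)" if a\<nu>: "\<not> a (\<sigma> k) * \<nu> < 0" for \<nu>
  proof
    assume "\<exists>A \<subseteq> coord_space S. flow_invariant (euler_field \<omega> a \<nu>) A \<and>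
      top_of_set A homeomorphic_space X_space k \<sigma>"
    then obtain A where A: "A \<subseteq> coord_space S" "flow_invariant (euler_field \<omega> a \<nu>) A"
      "top_of_set A homeomorphic_space X_space k \<sigma>" by blast
    \<comment> \<open>At the parameter \<open>- a (\<sigma> k)\<close> the space \<open>X_space k \<sigma>\<close> is realised by a level set, which shows that it is
      compact and has two points.\<close>
    let ?L = "level_set a (- a (\<sigma> k)) S"
    have neg: "a (\<sigma> k) * - a (\<sigma> k) < 0" using ak by (simp add: zero_less_mult_iff) linarith
    have "top_of_set A homeomorphic_space top_of_set ?L"
    proof -
      have "top_of_set ?L homeomorphic_space X_space k \<sigma>"
        using hX [OF neg] homeomorphic_map_imp_homeomorphic_space by blast
      then show ?thesis
        using A(3) homeomorphic_space_sym homeomorphic_space_trans by blast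
    qed
    then obtain f g where fg: "homeomorphic_maps (top_of_set A) (top_of_set ?L) f g"
      by (auto simp: homeomorphic_space_def)
    then have g: "homeomorphic_map (top_of_set ?L) (top_of_set A) g"
      using homeomorphic_maps_map by blast
    then have gL: "g ` ?L = A" and inj: "inj_on g ?L"
      using homeomorphic_imp_surjective_map [OF g] homeomorphic_imp_injective_map [OF g] by simp_all
    have "compact ?L" by (rule compact_level_set [of S a, OF opp [OF neg]])
    moreover have "continuous_on ?L g"
      using homeomorphic_imp_continuous_map [OF g] by (simp add: continuous_map_in_subtopology)
    ultimately have "compact (g ` ?L)" by (intro compact_continuous_image)
    then have "bounded A" unfolding gL by (rule compact_imp_bounded)
    moreover have "quad a p \<noteq> 0 \<and> \<nu> * quad a p \<ge> 0" if p: "p \<in> coord_space S" "p \<noteq> 0" for p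
    proof -
      have "- a (\<sigma> k) * quad a p < 0" by (rule quad_sign [OF opp [OF neg] p])
      then have q: "a (\<sigma> k) * quad a p > 0" by simp
      have "a (\<sigma> k) * \<nu> \<ge> 0" using a\<nu> by simp
      then show ?thesis
        using q by (cases "a (\<sigma> k) > 0") (auto simp: zero_less_mult_iff zero_le_mult_iff)
    qed
    ultimately have A0: "A \<subseteq> {0}"
      using compact_invariant_subset_zero [OF _ A(1,2)] by blast
    obtain y where y: "y \<in> ?L" using level_set_nonempty [of S a "- a (\<sigma> k)", OF opp [OF neg] S(1)] by blast
    then have "- y \<in> ?L" by (simp add: level_set_def coord_space_def quad_def)
    moreover have "g y = 0" "g (- y) = 0"
      using y \<open>- y \<in> ?L\<close> gL A0 by blast+
    ultimately have "y = - y" using inj_onD [OF inj _ y, of "- y"] by simp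
    then have "y + y = 0" by (metis add.right_inverse)
    then have "2 *\<^sub>R y = 0" by (simp only: scaleR_2)
    then have "y = 0" by simp
    then show False
      using y level_set_nonzero [of S a "- a (\<sigma> k)", OF opp [OF neg] S(1)] by blast
  qed
  show ?thesis
    unfolding M
  proof (intro conjI exI [of _ "\<lambda>\<nu>. level_set a \<nu> S"] exI [of _ T] exI [of _ attach] ballI allI impI, goal_cases)
    case 1
    show ?case by (rule cell_bifurcation_variety_coord_space [OF dfn S(1)])
  next
    case (2 \<nu>)
    have "0 \<notin> level_set a \<nu> S"
      using level_set_nonzero [of S a \<nu>, OF opp [OF 2(1)] S(1)] by blast
    then show ?case by (auto simp: level_set_def)
  next
    case (3 \<nu>)
    show ?case by (rule flow_invariant_level_set)
  next
    case (4 \<nu> c)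
    show ?case unfolding T_def by (rule flow_invariant_level_cell)
  next
    case (5 \<nu>)
    show ?case
      unfolding T_def S_def
      by (rule toral_CW_complex_level [OF \<sigma> k0 kn]) (use opp [OF 5(1)] in \<open>simp add: S_def\<close>)
  next
    case (6 \<nu>)
    show ?case unfolding T_def by (rule hX [OF 6(1)])
  next
    case (7 \<nu>)
    then have "\<nu> > 0" using 7(1) by (simp add: mult_less_0_iff)
    then show ?case
      by (intro asymptotically_stable_level_set [OF opp [OF 7(1)] S(1)])
  next
    case (8 \<nu>)
    then have "\<nu> < 0" using 8(1) by (simp add: mult_less_0_iff)
    then show ?case
      by (intro unstable_level_set [OF opp [OF 8(1)] S(1)])
  next
    case (9 \<nu> C J x)
    then have "\<nu> > 0" using 9(1) by (simp add: mult_less_0_iff)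
    then show ?case
      using 9 leaf [OF 9(1), of "x 0" C]
      by (intro converges_to_level_set [of S a \<nu>, OF opp [OF 9(1)] S(1), where p = "x 0"]) auto
  next
    case (10 \<nu> C J x)
    then have "\<nu> < 0" using 10(1) by (simp add: mult_less_0_iff)
    then show ?case
      using 10 leaf [OF 10(1), of "x 0" C]
      by (intro diverges_from_level_set [of S a \<nu>, OF opp [OF 10(1)] S(1), where p = "x 0"]) auto
  next
    case (11 \<nu> C J x i)
    have frequency: "2 * pi * (\<omega> (\<sigma> i) / (2 * pi)) = \<omega> (\<sigma> i)" by simp
    have "maximal_solution (euler_field \<omega> a \<nu>) J x" "0 \<in> J" using 11 by auto
    note x = maximal_solution_eq_flow_line [OF this]
    obtain \<theta> where \<theta>: "\<And>t. t \<in> life_span a \<nu> (x 0) \<Longrightarrow>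
      flow_line \<omega> a \<nu> (x 0) t $ \<sigma> i =
        norm (flow_line \<omega> a \<nu> (x 0) t $ \<sigma> i) *\<^sub>R (cos (\<omega> (\<sigma> i) * t + \<theta>), sin (\<omega> (\<sigma> i) * t + \<theta>))"
      using flow_line_frequency by blast
    show ?case
    proof (intro exI ballI)
      fix t assume t: "t \<in> J"
      then have L: "t \<in> life_span a \<nu> (x 0)" using x(1) by blast
      show "x t $ \<sigma> i = norm (x t $ \<sigma> i) *\<^sub>R
          (cos (2 * pi * (\<omega> (\<sigma> i) / (2 * pi)) * t + \<theta>), sin (2 * pi * (\<omega> (\<sigma> i) / (2 * pi)) * t + \<theta>))"
        unfolding frequency x(2) [OF t] by (rule \<theta> [OF L])
    qed
  next
    case (12 \<nu> C J x i t)
    have "maximal_solution (euler_field \<omega> a \<nu>) J x" "0 \<in> J" using 12 by auto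
    note J = maximal_solution_eq_flow_line(1) [OF this] and x = maximal_solution_eq_flow_line(2) [OF this]
    obtain r where r: "r > 0" "\<And>i. norm (x 0 $ i) = r * C $ i"
      using 12 by (auto simp: leaf_M_def)
    have "C $ \<sigma> k > 0" using 12(2) k0 by (simp add: pos_sphere_def)
    then have Ck: "C $ \<sigma> k \<noteq> 0" by simp
    have t: "t \<in> life_span a \<nu> (x 0)" using 12 J by simp
    have "((\<lambda>t. norm (flow_line \<omega> a \<nu> (x 0) t $ \<sigma> i)) has_real_derivative
        C $ \<sigma> i / C $ \<sigma> k * norm (flow_line \<omega> a \<nu> (x 0) t $ \<sigma> k) *
        (\<nu> + (norm (flow_line \<omega> a \<nu> (x 0) t $ \<sigma> k))\<^sup>2 * (\<Sum>j\<in>UNIV. a j * ((C $ j)\<^sup>2 / (C $ \<sigma> k)\<^sup>2)))) (at t)"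
      using flow_line_radial_velocity [OF t, of \<omega> "\<sigma> i"]
      unfolding leaf_radial_velocity [where r = r and C = C and j = "\<sigma> k", OF r(2,1) Ck t] .
    then show ?case
      unfolding x [OF 12(5)]
    proof (rule has_field_derivative_transform_within_open [OF _ open_life_span t])
      fix s assume "s \<in> life_span a \<nu> (x 0)"
      then have "s \<in> J" using J by blast
      show "norm (flow_line \<omega> a \<nu> (x 0) s $ \<sigma> i) = norm (x s $ \<sigma> i)"
        unfolding x [OF \<open>s \<in> J\<close>] ..
    qed
  next
    case (13 \<epsilon>)
    then show ?case using level_set_shrinks [OF dfn] by blast
  next
    case (14 \<nu>)
    then show ?case by (rule no_manifold)
  qed
qed

end
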